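(* Let $d\in\mathbb{N}$, $T>0$, $1\le i\le l$. Let $u\in C^4(\widetilde\Omega_i)$, $\widetilde\Omega_i=D\times[0,t_i]$, be the classical solution of the heat problem, let $u_{\theta_1},\dots,u_{\theta_i}$ be HLConcPINNs with parameters $\theta_1,\dots,\theta_i$, and let $\hat u_i=u_{\theta_i}-u$. Then $$\int_{t_{i-1}}^{t_i}\int_D|\hat u_i(x,t)|^2dx\,dt\le C_{T_i}\,\Delta t\,\exp(\Delta t)=\mathcal{O}\Big(\mathcal{E}_{T_i}(\theta_i,\mathcal{S}_i)^2+M_{int_i}^{-\frac{2}{d+1}}+M_{tb_i}^{-\frac2d}+M_{sb_i}^{-\frac1d}\Big),$$ where $C_{T_0}=0$, $C_{T_i}=\widetilde C_{T_i}+2C_{T_{i-1}}\exp(\Delta t)$ and $$\widetilde C_{T_i}=2\sum_{j=1}^{i}\Big(C_{(R_{tb_i}^2(x,t_{j-1}))}M_{tb_i}^{-\frac2d}+\mathcal{Q}^{D}_{M_{tb_i}}(R_{tb_i}^2(x,t_{j-1}))\Big)+C_{(R_{int_i}^2)}M_{int_i}^{-\frac{2}{d+1}}+\mathcal{Q}^{\Omega_i}_{M_{int_i}}(R_{int_i}^2)$$ $$\qquad+2C_{\partial D_i}|\Delta t|^{\frac12}\Big(C_{(R_{sb_i}^2)}M_{sb_i}^{-\frac2d}+\mathcal{Q}^{\Omega_{*i}}_{M_{sb_i}}(R_{sb_i}^2)\Big)^{\frac12},$$ with $C_{\partial D_i}=|\partial D|^{1/2}\big(\|u\|_{C^1(\partial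 D\times[0,t_i])}+\|u_{\theta_i}\|_{C^1(\partial D\times[0,t_i])}\big)$.
   Context: Heat problem. $D\subset\mathbb{R}^d$ is an open connected bounded domain with $C^k$ boundary $\partial D$, $T>0$, and $u:D\times[0,T]\to\mathbb{R}$ solves $\partial_t u-\Delta u=f$ in $D\times[0,T]$, $u(x,0)=u_{in}(x)$ in $D$, $u=u_d$ on $\partial D\times[0,T]$, for given data $f,u_{in},u_d$. Time blocks. For an integer $l\ge1$ put $\Delta t=T/l$, $t_i=i\Delta t$ ($0\le i\le l$), $\Omega_i=D\times[t_{i-1},t_i]$, $\Omega_{*i}=\partial D\times[t_{i-1},t_i]$. HLConcPINN (hidden-layer concatenated neural network). With $L\ge 3$, input dimension $l_0$, output dimension $l_L$ and hidden widths $l_1,\dots,l_{L-1}$, it is a map $z\in\mathbb{R}^{l_0}\mapsto\sum_{m=1}^{L-1}M_m h_m(z)+b_L$, where $h_0(z)=z$ and $h_m(z)=\sigma_m(W_m h_{m-1}(z)+b_m)$, with $W_m\in\mathbb{R}^{l_m\times l_{m-1}}$, $b_m\in\mathbb{R}^{l_m}$, $M_m\in\mathbb{R}^{l_L\times l_m}$, $b_L\in\mathbb{R}^{l_L}$; activations act componentwise, $\sigma_1=\sigma_2=\tanh$, and $\sigma_m$ for $m\ge3$ are smooth activation functions. $\theta$ denotes the collection of all parameters. Here $l_0=d+1$ (input $(x,t)$), $l_L=1$, and $u_{\theta_i}$ is considered on $D\times[0,t_i]$. Residuals. $R_{int_i}=\partial_t u_{\theta_i}-\Delta u_{\theta_i}-f$;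 $R_{tb_i}(x,t_{j-1})=u_{\theta_i}(x,t_{j-1})-u_{\theta_{j-1}}(x,t_{j-1})$ for $x\in D$, $1\le j\le i$, with the convention $u_{\theta_0}(x,t_0)=u_{in}(x)$; $R_{sb_i}=u_{\theta_i}-u_d$ on $\partial D$. Quadrature. For a set $\Lambda$ of dimension $m$, $\mathcal{Q}^{\Lambda}_M(g)=\sum_{n=1}^M\omega_n g(z_n)$ is the midpoint rule with nodes $z_n$ the midpoints of $M\sim N^m$ cubes of edge length $1/N$ partitioning $\Lambda$ and appropriate weights $\omega_n\ge0$. It satisfies, for $g\in C^2$, $|\int_\Lambda g-\mathcal{Q}^\Lambda_M(g)|\le C_{(g)}M^{-2/m}$, with $C_{(g)}\lesssim\|g\|_{C^2(\Lambda)}$. Here the dimensions are $d$ for $D$, $d+1$ for $\Omega_i$, $d$ for $\Omega_{*i}$, and $M_{tb_i},M_{int_i},M_{sb_i}$ are the numbers of nodes on $D,\Omega_i,\Omega_{*i}$; these nodes form the training set $\mathcal{S}_i$. Training error. $\mathcal{E}_{T_0}=0$ and $\mathcal{E}_{T_i}(\theta_i,\mathcal{S}_i)^2=\widetilde{\mathcal{E}}_{T_i}^2+\mathcal{E}_{T_{i-1}}(\theta_{i-1},\mathcal{S}_{i-1})^2$, with $\widetilde{\mathcal{E}}_{T_i}^2=\mathcal{Q}^{\Omega_i}_{M_{int_i}}(R_{int_i}^2)+\sum_{j=1}^i\mathcal{Q}^D_{M_{tb_i}}(R_{tb_i}^2(x,t_{j-1}))+\big(\mathcal{Q}^{\Omega_{*i}}_{M_{sb_i}}(R_{sb_i}^2)\big)^{1/2}$.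 $|\partial D|$ is the surface measure of $\partial D$, and $\|v\|_{C^1(S)}$ is the usual $C^1$ norm on $S$ (sum of sup norms of $v$ and its first-order partial derivatives). In the $\mathcal{O}$-statement the numbers of quadrature nodes are of the same order on all blocks $j\le i$, and the implied constant does not depend on these numbers (it may depend on $i$, $d$, $\Delta t$, the constants $C_{\partial D_j}$ and the constants $C_{(\cdot)}$). *)

theory Defs
  imports "HOL-Analysis.Analysis"
begin

section \<open>Functions of class C^k\<close>

definition pd :: "'a::euclidean_space \<Rightarrow> ('a \<Rightarrow> real) \<Rightarrow> 'a \<Rightarrow> real" where
  "pd b g x = frechet_derivative g (at x) b"

primrec Ck_open :: "nat \<Rightarrow> 'a::euclidean_space set \<Rightarrow> ('a \<Rightarrow> real) \<Rightarrow> bool" where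
  "Ck_open 0 U g \<longleftrightarrow> continuous_on U g"
| "Ck_open (Suc k) U g \<longleftrightarrow>
     (\<forall>x\<in>U. g differentiable (at x)) \<and> (\<forall>b\<in>Basis. Ck_open k U (pd b g))"

text \<open>Class C^k up to the boundary, for a set S that need not be open and may be
  lower-dimensional (a lateral boundary): g agrees on S with a C^k function
  defined on a neighbourhood of the closure of S.\<close>

definition Ck_upto :: "nat \<Rightarrow> 'a::euclidean_space set \<Rightarrow> ('a \<Rightarrow> real) \<Rightarrow> bool" where
  "Ck_upto k S g \<longleftrightarrow>
     (\<exists>U h. open U \<and> closure S \<subseteq> U \<and> Ck_open k U h \<and> (\<forall>z\<in>S. g z = h z))"

text \<open>The C^1 norm over a part S of the boundary of an open set G.  The partial derivatives
  of v on S are the limits of those in G, so only the values of v in G and on S matter.\<close>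

definition C1_norm :: "'a::euclidean_space set \<Rightarrow> 'a set \<Rightarrow> ('a \<Rightarrow> real) \<Rightarrow> real" where
  "C1_norm G S v = (SUP z\<in>S. \<bar>v z\<bar>) +
     (\<Sum>b\<in>Basis. SUP z\<in>S. \<bar>Lim (at z within G) (pd b v)\<bar>)"

definition laplacian :: "('a::euclidean_space \<Rightarrow> real) \<Rightarrow> 'a \<Rightarrow> real" where
  "laplacian g x = (\<Sum>b\<in>Basis. pd b (pd b g) x)"

section \<open>Domains with C^k boundary and the surface measure\<close>

text \<open>In the ball around x0 with radius r, D is the part above the graph of \<gamma> in direction n,
  where n is a coordinate direction up to sign.  The function \<gamma> of the remaining d - 1 coordinates
  is represented by a function on the whole space that is constant in direction n.\<close>

definition graph_chart ::
  "nat \<Rightarrow> 'a::euclidean_space set \<Rightarrow> 'a \<Rightarrow> real \<Rightarrow> 'a \<Rightarrow> ('a \<Rightarrow> real) \<Rightarrow> bool" where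
  "graph_chart k D x0 r n \<gamma> \<longleftrightarrow>
     0 < r \<and> (n \<in> Basis \<or> - n \<in> Basis) \<and> Ck_open k UNIV \<gamma> \<and>
     (\<forall>x c. \<gamma> (x + c *\<^sub>R n) = \<gamma> x) \<and>
     D \<inter> ball x0 r = {x \<in> ball x0 r. \<gamma> x < x \<bullet> n}"

definition Ck_boundary :: "nat \<Rightarrow> 'a::euclidean_space set \<Rightarrow> bool" where
  "Ck_boundary k D \<longleftrightarrow> (\<forall>x0\<in>frontier D. \<exists>r n \<gamma>. graph_chart k D x0 r n \<gamma>)"

text \<open>The surface measure of the boundary of D, carried by the boundary and given in each C^1 graph
  chart by the usual density.  The point of the graph over x is x + (\<gamma> x - x \<bullet> n) n.  Integration
  over the (d - 1)-dimensional hyperplane orthogonal to n is written as Lebesgue integration over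
  the slab of height 1 above it, since the integrand does not depend on the coordinate along n;
  for d = 1 this gives the counting measure.  For C^1 boundaries these conditions determine the
  measure.\<close>

definition is_surface_measure :: "'a::euclidean_space set \<Rightarrow> 'a measure \<Rightarrow> bool" where
  "is_surface_measure D \<sigma> \<longleftrightarrow>
     sets \<sigma> = sets borel \<and> emeasure \<sigma> (- frontier D) = 0 \<and>
     (\<forall>x0 r n \<gamma> A. x0 \<in> frontier D \<and> graph_chart 1 D x0 r n \<gamma> \<and>
        A \<in> sets borel \<and> A \<subseteq> frontier D \<inter> ball x0 r \<longrightarrow>
        emeasure \<sigma> A =
          (\<integral>\<^sup>+ x \<in> {x. 0 \<le> x \<bullet> n \<and> x \<bullet> n \<le> 1 \<and> x + (\<gamma> x - x \<bullet> n) *\<^sub>R n \<in> A}.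
             ennreal (sqrt (1 + (\<Sum>b\<in>Basis. (pd b \<gamma> x)\<^sup>2))) \<partial>lborel))"

section \<open>The heat problem\<close>

definition heat_solution ::
  "(real^'d) set \<Rightarrow> real \<Rightarrow> ((real^'d) \<times> real \<Rightarrow> real) \<Rightarrow> (real^'d \<Rightarrow> real) \<Rightarrow>
     ((real^'d) \<times> real \<Rightarrow> real) \<Rightarrow> ((real^'d) \<times> real \<Rightarrow> real) \<Rightarrow> bool" where
  "heat_solution D T f uin ud u \<longleftrightarrow>
     continuous_on (closure D \<times> {0..T}) u \<and>
     (\<forall>t\<in>{0..T}. Ck_open 2 D (\<lambda>x. u (x, t))) \<and>
     (\<forall>x\<in>D. \<forall>t\<in>{0..T}. ((\<lambda>s. u (x, s)) has_real_derivative
         (laplacian (\<lambda>y. u (y, t)) x + f (x, t))) (at t within {0..T})) \<and>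
     (\<forall>x\<in>D. u (x, 0) = uin x) \<and>
     (\<forall>x\<in>frontier D. \<forall>t\<in>{0..T}. u (x, t) = ud (x, t))"

section \<open>Hidden-layer concatenated networks\<close>

text \<open>Vectors and matrices are functions on indices starting from 0, of which only the entries
  below the corresponding widths are used.  The output is scalar, so that the matrices of the output
  layer are rows.\<close>

record hlconc =
  depth :: nat
  width :: "nat \<Rightarrow> nat"
  act :: "nat \<Rightarrow> real \<Rightarrow> real"
  weight :: "nat \<Rightarrow> nat \<Rightarrow> nat \<Rightarrow> real"
  bias :: "nat \<Rightarrow> nat \<Rightarrow> real"
  out_weight :: "nat \<Rightarrow> nat \<Rightarrow> real"
  out_bias :: real

definition coord :: "nat \<Rightarrow> 'z::euclidean_space" where
  "coord = (SOME e. bij_betw e {..<DIM('z)} Basis)"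

primrec hidden :: "hlconc \<Rightarrow> 'z::euclidean_space \<Rightarrow> nat \<Rightarrow> nat \<Rightarrow> real" where
  "hidden \<theta> z 0 = (\<lambda>j. z \<bullet> coord j)"
| "hidden \<theta> z (Suc m) = (\<lambda>j. act \<theta> (Suc m)
     ((\<Sum>k<width \<theta> m. weight \<theta> (Suc m) j k * hidden \<theta> z m k) + bias \<theta> (Suc m) j))"

definition net :: "hlconc \<Rightarrow> 'z::euclidean_space \<Rightarrow> real" where
  "net \<theta> z = (\<Sum>m = 1..depth \<theta> - 1. \<Sum>j<width \<theta> m. out_weight \<theta> m j * hidden \<theta> z m j) + out_bias \<theta>"

definition smooth_activation :: "(real \<Rightarrow> real) \<Rightarrow> bool" where
  "smooth_activation s \<longleftrightarrow> (\<forall>n x. (deriv ^^ n) s differentiable (at x))"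

definition is_HLConcPINN :: "nat \<Rightarrow> hlconc \<Rightarrow> bool" where
  "is_HLConcPINN l0 \<theta> \<longleftrightarrow> 3 \<le> depth \<theta> \<and> width \<theta> 0 = l0 \<and>
     (\<forall>m\<in>{1..<depth \<theta>}. 1 \<le> width \<theta> m) \<and>
     act \<theta> 1 = tanh \<and> act \<theta> 2 = tanh \<and> (\<forall>m\<in>{3..<depth \<theta>}. smooth_activation (act \<theta> m))"

section \<open>Residuals\<close>

definition R_int ::
  "((real^'d) \<times> real \<Rightarrow> real) \<Rightarrow> (nat \<Rightarrow> hlconc) \<Rightarrow> nat \<Rightarrow> (real^'d) \<times> real \<Rightarrow> real" where
  "R_int f \<theta> i = (\<lambda>(x, t). pd (0, 1) (net (\<theta> i)) (x, t)
     - laplacian (\<lambda>y. net (\<theta> i) (y, t)) x - f (x, t))"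

definition R_tb ::
  "(real^'d \<Rightarrow> real) \<Rightarrow> real \<Rightarrow> (nat \<Rightarrow> hlconc) \<Rightarrow> nat \<Rightarrow> nat \<Rightarrow> real^'d \<Rightarrow> real" where
  "R_tb uin \<Delta>t \<theta> i j x = net (\<theta> i) (x, real (j - 1) * \<Delta>t)
     - (if j = 1 then uin x else net (\<theta> (j - 1)) (x, real (j - 1) * \<Delta>t))"

definition R_sb ::
  "((real^'d) \<times> real \<Rightarrow> real) \<Rightarrow> (nat \<Rightarrow> hlconc) \<Rightarrow> nat \<Rightarrow> (real^'d) \<times> real \<Rightarrow> real" where
  "R_sb ud \<theta> i z = net (\<theta> i) z - ud z"

section \<open>Quadrature\<close>

text \<open>A rule with qnum nodes; qconst g is the constant C(g) of its error estimate.\<close>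

record 'z quadrature =
  qnum :: nat
  qnode :: "nat \<Rightarrow> 'z"
  qweight :: "nat \<Rightarrow> real"
  qconst :: "('z \<Rightarrow> real) \<Rightarrow> real"

definition quad :: "'z quadrature \<Rightarrow> ('z \<Rightarrow> real) \<Rightarrow> real" where
  "quad q g = (\<Sum>n<qnum q. qweight q n * g (qnode q n))"

text \<open>The properties of the midpoint rule on a set \<Lambda> of dimension m with measure \<mu>.  A curved set is
  not a union of cubes, so the nodes and weights are not prescribed beyond these.\<close>

definition quadrature_on ::
  "'z::euclidean_space measure \<Rightarrow> 'z set \<Rightarrow> nat \<Rightarrow> 'z quadrature \<Rightarrow> bool" where
  "quadrature_on \<mu> \<Lambda> m q \<longleftrightarrow> 0 < qnum q \<and>
     (\<forall>n<qnum q. qnode q n \<in> \<Lambda> \<and> 0 \<le> qweight q n) \<and>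
     (\<forall>g. Ck_upto 2 \<Lambda> g \<longrightarrow>
        \<bar>(LINT z:\<Lambda>|\<mu>. g z) - quad q g\<bar> \<le> qconst q g * real (qnum q) powr (- 2 / real m))"

text \<open>The training set of a time block: the rules on the space-time block, on D, and on the
  lateral boundary.\<close>

record 'd training_set =
  int_rule :: "((real^'d) \<times> real) quadrature"
  tb_rule :: "(real^'d) quadrature"
  sb_rule :: "((real^'d) \<times> real) quadrature"

definition is_training_set ::
  "(real^'d) set \<Rightarrow> (real^'d) measure \<Rightarrow> real \<Rightarrow> nat \<Rightarrow> 'd::finite training_set \<Rightarrow> bool" where
  "is_training_set D \<sigma> \<Delta>t i S \<longleftrightarrow>
     quadrature_on lborel (D \<times> {real (i - 1) * \<Delta>t..real i * \<Delta>t}) (CARD('d) + 1) (int_rule S) \<and>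
     quadrature_on lborel D CARD('d) (tb_rule S) \<and>
     quadrature_on (\<sigma> \<Otimes>\<^sub>M lborel) (frontier D \<times> {real (i - 1) * \<Delta>t..real i * \<Delta>t}) CARD('d) (sb_rule S)"

section \<open>Training error and the error constants\<close>

definition block_training_error_sq ::
  "((real^'d) \<times> real \<Rightarrow> real) \<Rightarrow> (real^'d \<Rightarrow> real) \<Rightarrow> ((real^'d) \<times> real \<Rightarrow> real) \<Rightarrow> real \<Rightarrow>
     (nat \<Rightarrow> hlconc) \<Rightarrow> (nat \<Rightarrow> 'd::finite training_set) \<Rightarrow> nat \<Rightarrow> real" where
  "block_training_error_sq f uin ud \<Delta>t \<theta> S i =
     quad (int_rule (S i)) (\<lambda>z. (R_int f \<theta> i z)\<^sup>2)
     + (\<Sum>j = 1..i. quad (tb_rule (S i)) (\<lambda>x. (R_tb uin \<Delta>t \<theta> i j x)\<^sup>2))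
     + sqrt (quad (sb_rule (S i)) (\<lambda>z. (R_sb ud \<theta> i z)\<^sup>2))"

primrec training_error ::
  "((real^'d) \<times> real \<Rightarrow> real) \<Rightarrow> (real^'d \<Rightarrow> real) \<Rightarrow> ((real^'d) \<times> real \<Rightarrow> real) \<Rightarrow> real \<Rightarrow>
     (nat \<Rightarrow> hlconc) \<Rightarrow> (nat \<Rightarrow> 'd::finite training_set) \<Rightarrow> nat \<Rightarrow> real" where
  "training_error f uin ud \<Delta>t \<theta> S 0 = 0"
| "training_error f uin ud \<Delta>t \<theta> S (Suc i) =
     sqrt (block_training_error_sq f uin ud \<Delta>t \<theta> S (Suc i) + (training_error f uin ud \<Delta>t \<theta> S i)\<^sup>2)"

definition C_bd ::
  "(real^'d) set \<Rightarrow> (real^'d) measure \<Rightarrow> ((real^'d) \<times> real \<Rightarrow> real) \<Rightarrow> real \<Rightarrow>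
     (nat \<Rightarrow> hlconc) \<Rightarrow> nat \<Rightarrow> real" where
  "C_bd D \<sigma> u \<Delta>t \<theta> i = sqrt (measure \<sigma> (frontier D)) *
     (C1_norm (D \<times> {0<..<real i * \<Delta>t}) (frontier D \<times> {0..real i * \<Delta>t}) u
    + C1_norm (D \<times> {0<..<real i * \<Delta>t}) (frontier D \<times> {0..real i * \<Delta>t}) (net (\<theta> i)))"

definition C_block ::
  "(real^'d) set \<Rightarrow> (real^'d) measure \<Rightarrow> ((real^'d) \<times> real \<Rightarrow> real) \<Rightarrow> (real^'d \<Rightarrow> real) \<Rightarrow>
     ((real^'d) \<times> real \<Rightarrow> real) \<Rightarrow> ((real^'d) \<times> real \<Rightarrow> real) \<Rightarrow> real \<Rightarrow>
     (nat \<Rightarrow> hlconc) \<Rightarrow> (nat \<Rightarrow> 'd::finite training_set) \<Rightarrow> nat \<Rightarrow> real" where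
  "C_block D \<sigma> f uin ud u \<Delta>t \<theta> S i =
     2 * (\<Sum>j = 1..i.
        qconst (tb_rule (S i)) (\<lambda>x. (R_tb uin \<Delta>t \<theta> i j x)\<^sup>2)
          * real (qnum (tb_rule (S i))) powr (- 2 / real CARD('d))
        + quad (tb_rule (S i)) (\<lambda>x. (R_tb uin \<Delta>t \<theta> i j x)\<^sup>2))
     + qconst (int_rule (S i)) (\<lambda>z. (R_int f \<theta> i z)\<^sup>2)
          * real (qnum (int_rule (S i))) powr (- 2 / real (CARD('d) + 1))
     + quad (int_rule (S i)) (\<lambda>z. (R_int f \<theta> i z)\<^sup>2)
     + 2 * C_bd D \<sigma> u \<Delta>t \<theta> i * sqrt \<bar>\<Delta>t\<bar> *
        sqrt (qconst (sb_rule (S i)) (\<lambda>z. (R_sb ud \<theta> i z)\<^sup>2)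
            * real (qnum (sb_rule (S i))) powr (- 2 / real CARD('d))
          + quad (sb_rule (S i)) (\<lambda>z. (R_sb ud \<theta> i z)\<^sup>2))"

primrec C_T ::
  "(real^'d) set \<Rightarrow> (real^'d) measure \<Rightarrow> ((real^'d) \<times> real \<Rightarrow> real) \<Rightarrow> (real^'d \<Rightarrow> real) \<Rightarrow>
     ((real^'d) \<times> real \<Rightarrow> real) \<Rightarrow> ((real^'d) \<times> real \<Rightarrow> real) \<Rightarrow> real \<Rightarrow>
     (nat \<Rightarrow> hlconc) \<Rightarrow> (nat \<Rightarrow> 'd::finite training_set) \<Rightarrow> nat \<Rightarrow> real" where
  "C_T D \<sigma> f uin ud u \<Delta>t \<theta> S 0 = 0"
| "C_T D \<sigma> f uin ud u \<Delta>t \<theta> S (Suc i) =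
     C_block D \<sigma> f uin ud u \<Delta>t \<theta> S (Suc i) + 2 * C_T D \<sigma> f uin ud u \<Delta>t \<theta> S i * exp \<Delta>t"

section \<open>What the implied constant may depend on\<close>

definition constants_bounded ::
  "(real^'d) set \<Rightarrow> (real^'d) measure \<Rightarrow> ((real^'d) \<times> real \<Rightarrow> real) \<Rightarrow> (real^'d \<Rightarrow> real) \<Rightarrow>
     ((real^'d) \<times> real \<Rightarrow> real) \<Rightarrow> ((real^'d) \<times> real \<Rightarrow> real) \<Rightarrow> real \<Rightarrow>
     (nat \<Rightarrow> hlconc) \<Rightarrow> (nat \<Rightarrow> 'd::finite training_set) \<Rightarrow> nat \<Rightarrow> real \<Rightarrow> bool" where
  "constants_bounded D \<sigma> f uin ud u \<Delta>t \<theta> S i B \<longleftrightarrow>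
     (\<forall>j\<in>{1..i}. C_bd D \<sigma> u \<Delta>t \<theta> j \<le> B \<and>
        qconst (int_rule (S j)) (\<lambda>z. (R_int f \<theta> j z)\<^sup>2) \<le> B \<and>
        (\<forall>m\<in>{1..j}. qconst (tb_rule (S j)) (\<lambda>x. (R_tb uin \<Delta>t \<theta> j m x)\<^sup>2) \<le> B) \<and>
        qconst (sb_rule (S j)) (\<lambda>z. (R_sb ud \<theta> j z)\<^sup>2) \<le> B)"

definition comparable :: "real \<Rightarrow> nat \<Rightarrow> nat \<Rightarrow> bool" where
  "comparable \<kappa> M N \<longleftrightarrow> real M \<le> \<kappa> * real N \<and> real N \<le> \<kappa> * real M"

definition same_order :: "real \<Rightarrow> (nat \<Rightarrow> 'd::finite training_set) \<Rightarrow> nat \<Rightarrow> bool" where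
  "same_order \<kappa> S i \<longleftrightarrow> (\<forall>j\<in>{1..i}.
     comparable \<kappa> (qnum (int_rule (S j))) (qnum (int_rule (S i))) \<and>
     comparable \<kappa> (qnum (tb_rule (S j))) (qnum (tb_rule (S i))) \<and>
     comparable \<kappa> (qnum (sb_rule (S j))) (qnum (sb_rule (S i))))"

end

theory Submission
  imports Defs
begin

text \<open>
  The error v = net - u on a time block satisfies the heat equation with right-hand side R_int, and
  the energy E(t), the integral of v(x,t)^2 over D, is controlled through
  E' = 2 \<integral> v (\<Delta>v + R_int) \<le> 2 \<integral> div (v \<nabla>v) + E + \<integral> R_int^2.
  Only the inequality \<integral> div F \<le> \<integral> |F| d\<sigma> is needed, not the divergence theorem itself, and so no
  unit normal has to be constructed.  In a graph chart it is obtained by multiplying F with a C^1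
  step function of (x \<bullet> n - \<gamma> x) / \<epsilon>: the product has compact support, so its divergence integrates to
  0, and the derivative of the step concentrates on the graph, with the surface density as weight,
  as \<epsilon> tends to 0.  Gronwall's inequality, Cauchy-Schwarz on the lateral boundary and the error
  estimates of the quadrature rules then bound E on one block by its initial value there, which
  is at most twice the energy of the previous block plus twice the integral of R_tb^2.
\<close>

section \<open>Calculus of functions of class C^k\<close>

text \<open>\<open>frechet_derivative\<close> looks at a full neighbourhood of a point, so
  derivatives of \<open>u\<close> on the lateral boundary have no direct meaning. All calculus is
  therefore done with a C^4 extension \<open>h\<close> of \<open>u\<close> to an open set around the
  closed cylinder. Four derivatives are what the residual costs: it contains second derivatives, and
  the quadrature estimate wants its square in C^2. The field F is v \<nabla>v, whose size on the
  boundary is at most |v| times the sum of the C^1 norms of \<open>u\<close> and of the network. The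
  boundary term is thus linear in v. Cauchy-Schwarz turns it into a square root, with the factors
  |\<partial>D|^(1/2) and \<Delta>t^(1/2), and this halves the exponent of the number of boundary
  nodes in the final rate. Since F enters only through a bound of its size, the divergence
  inequality is as good here as the identity.\<close>

lemma pd_cong:
  assumes "open U" "x \<in> U" "\<And>y. y \<in> U \<Longrightarrow> g y = h y"
  shows "pd b g x = pd b h x"
proof -
  \<comment> \<open>\<open>frechet_derivative\<close> is a choice among derivatives; equal
    predicates give the same choice, even at points where no derivative exists.\<close>
  have "(\<lambda>g'. (g has_derivative g') (at x)) = (\<lambda>g'. (h has_derivative g') (at x))"
    using has_derivative_transform_within_open[of g _ x UNIV U h]
      has_derivative_transform_within_open[of h _ x UNIV U g] assms by (intro ext) metis
  then show ?thesis by (simp add: pd_def frechet_derivative_def)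
qed

lemma pd_eq: "(g has_derivative g') (at x) \<Longrightarrow> pd b g x = g' b"
  by (metis frechet_derivative_at pd_def)

lemma has_derivative_pd: "g differentiable (at x) \<Longrightarrow> (g has_derivative (\<lambda>v. pd v g x)) (at x)"
  by (simp add: frechet_derivative_works pd_def)

lemma Ck_open_cong:
  assumes "open U" "\<And>x. x \<in> U \<Longrightarrow> g x = h x"
  shows "Ck_open k U g \<longleftrightarrow> Ck_open k U h"
  using assms(2)
proof (induction k arbitrary: g h)
  case 0
  then show ?case by (simp cong: continuous_on_cong)
next
  case (Suc k)
  have "g differentiable (at x) \<longleftrightarrow> h differentiable (at x)" if "x \<in> U" for x
    using has_derivative_transform_within_open[of g _ x UNIV U h]
      has_derivative_transform_within_open[of h _ x UNIV U g] assms(1) Suc.prems that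
    unfolding differentiable_def by metis
  moreover have "Ck_open k U (pd b g) \<longleftrightarrow> Ck_open k U (pd b h)" for b
    by (intro Suc.IH pd_cong[OF assms(1)]) (auto simp: Suc.prems)
  ultimately show ?case by simp
qed

lemma Ck_open_Suc_imp: "Ck_open (Suc k) U g \<Longrightarrow> Ck_open k U g"
proof (induction k arbitrary: g)
  case 0
  then show ?case
    by (auto intro!: continuous_at_imp_continuous_on differentiable_imp_continuous_within)
qed auto

lemma Ck_open_le: "Ck_open k U g \<Longrightarrow> m \<le> k \<Longrightarrow> Ck_open m U g"
  by (induction k) (auto simp: le_Suc_eq dest: Ck_open_Suc_imp simp del: Ck_open.simps)

lemma Ck_open_subset: "Ck_open k U g \<Longrightarrow> V \<subseteq> U \<Longrightarrow> Ck_open k V g"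
  by (induction k arbitrary: g) (auto intro: continuous_on_subset)

lemma Ck_open_imp_continuous_on: "Ck_open k U g \<Longrightarrow> continuous_on U g"
  using Ck_open_le[of k U g 0] by simp

lemma Ck_open_pd: "Ck_open (Suc k) U g \<Longrightarrow> b \<in> Basis \<Longrightarrow> Ck_open k U (pd b g)"
  by simp

lemma pd_const: "pd b (\<lambda>x. c) x = 0"
  by (rule pd_eq[of _ "\<lambda>_. 0"]) simp

lemma pd_add: "g differentiable (at x) \<Longrightarrow> h differentiable (at x) \<Longrightarrow>
    pd b (\<lambda>x. g x + h x) x = pd b g x + pd b h x"
  by (rule pd_eq) (intro has_derivative_add has_derivative_pd)

lemma pd_mult: "g differentiable (at x) \<Longrightarrow> h differentiable (at x) \<Longrightarrow>
    pd b (\<lambda>x. g x * h x) x = g x * pd b h x + pd b g x * h x"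
  by (rule pd_eq) (intro has_derivative_mult has_derivative_pd)

lemma pd_compose:
  assumes "(s has_real_derivative c) (at (g x))" "g differentiable (at x)"
  shows "pd b (\<lambda>x. s (g x)) x = c * pd b g x"
  using has_derivative_compose[OF has_derivative_pd[OF assms(2)]
      assms(1)[unfolded has_field_derivative_def]]
  by (rule pd_eq)

lemma Ck_open_const [intro]: "Ck_open k U (\<lambda>x. c)"
proof (induction k arbitrary: c)
  case (Suc k)
  have "pd b (\<lambda>x::'a. c) = (\<lambda>x. 0)" for b
    by (simp add: pd_const fun_eq_iff)
  then show ?case using Suc by simp
qed auto

lemma Ck_open_inner [intro]: "Ck_open k U (\<lambda>x. x \<bullet> a)"
proof (cases k)
  case (Suc m)
  have "pd b (\<lambda>x. x \<bullet> a) = (\<lambda>x. b \<bullet> a)" for b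
    by (intro ext pd_eq[where g' = "\<lambda>b. b \<bullet> a"]) (auto intro!: derivative_eq_intros)
  then show ?thesis using Suc Ck_open_const by auto
qed (auto intro!: continuous_intros)

lemma Ck_open_add:
  assumes "open U" "Ck_open k U g" "Ck_open k U h"
  shows "Ck_open k U (\<lambda>x. g x + h x)"
  using assms(2,3)
proof (induction k arbitrary: g h)
  case (Suc k)
  have "Ck_open k U (pd b (\<lambda>x. g x + h x))" if "b \<in> Basis" for b
    using Suc.IH[of "pd b g" "pd b h"] Suc.prems that
    by (subst Ck_open_cong[OF assms(1) pd_add]) auto
  then show ?case using Suc.prems by auto
qed (auto intro: continuous_on_add)

lemma Ck_open_mult:
  assumes "open U" "Ck_open k U g" "Ck_open k U h"
  shows "Ck_open k U (\<lambda>x. g x * h x)"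
  using assms(2,3)
proof (induction k arbitrary: g h)
  case (Suc k)
  have "Ck_open k U (pd b (\<lambda>x. g x * h x))" if "b \<in> Basis" for b
    using Suc.IH[of g "pd b h"] Suc.IH[of "pd b g" h] Suc.prems that Ck_open_Suc_imp[OF Suc.prems(1)]
      Ck_open_Suc_imp[OF Suc.prems(2)]
    by (subst Ck_open_cong[OF assms(1) pd_mult]) (auto intro!: Ck_open_add[OF assms(1)])
  then show ?case using Suc.prems by (auto intro: differentiable_mult)
qed (auto intro: continuous_on_mult)

lemma Ck_open_diff:
  assumes "open U" "Ck_open k U g" "Ck_open k U h"
  shows "Ck_open k U (\<lambda>x. g x - h x)"
  using Ck_open_add[OF assms(1,2) Ck_open_mult[OF assms(1) Ck_open_const assms(3), of "-1"]] by simp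

lemma Ck_open_power2:
  assumes "open U" "Ck_open k U g"
  shows "Ck_open k U (\<lambda>x. (g x)\<^sup>2)"
  using Ck_open_mult[OF assms assms(2)] by (simp add: power2_eq_square)

lemma Ck_open_sum:
  assumes "open U" "\<And>a. a \<in> A \<Longrightarrow> Ck_open k U (g a)"
  shows "Ck_open k U (\<lambda>x. \<Sum>a\<in>A. g a x)"
  using assms(2)
proof (induction A rule: infinite_finite_induct)
  case (insert a A)
  then show ?case by (simp add: Ck_open_add[OF assms(1)])
qed auto

section \<open>Activations and smoothness of the networks\<close>

lemma Ck_open_smooth_compose:
  assumes "open U" "Ck_open k U g" "smooth_activation s"
  shows "Ck_open k U (\<lambda>x. s (g x))"
  using assms(2,3)
proof (induction k arbitrary: s)
  case 0
  have "continuous (at y) s" for y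
    using 0(2)[unfolded smooth_activation_def, rule_format, of 0]
    by (intro differentiable_imp_continuous_within) simp
  then show ?case using 0(1)
    using continuous_on_compose2[of UNIV s U g] continuous_at_imp_continuous_on[of UNIV s] by auto
next
  case (Suc k)
  have d: "(s has_real_derivative deriv s y) (at y)" for y
    using Suc.prems(2)[unfolded smooth_activation_def, rule_format, of 0]
    by (simp add: DERIV_deriv_iff_real_differentiable)
  \<comment> \<open>The derivatives of \<open>deriv s\<close> are those of \<open>s\<close> shifted
    by one, so the induction, which leaves \<open>s\<close> arbitrary, applies to
    \<open>deriv s\<close>.\<close>
  have s': "smooth_activation (deriv s)"
    using Suc.prems(2)[unfolded smooth_activation_def, rule_format, of "Suc _"]
    by (simp add: smooth_activation_def funpow_Suc_right del: funpow.simps)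
  have "Ck_open k U (pd b (\<lambda>x. s (g x)))" if "b \<in> Basis" for b
    using Suc.IH[of "deriv s"] s' Suc.prems that Ck_open_Suc_imp[OF Suc.prems(1)]
    by (subst Ck_open_cong[OF assms(1) pd_compose[OF d]]) (auto intro!: Ck_open_mult[OF assms(1)])
  moreover have "(\<lambda>x. s (g x)) differentiable (at x)" if "x \<in> U" for x
    using has_derivative_compose[OF has_derivative_pd[of g x] d[unfolded has_field_derivative_def]]
      Suc.prems(1) that by (auto intro: differentiableI)
  ultimately show ?case by auto
qed

text \<open>tanh' = 1 - tanh^2 is a polynomial in tanh itself, so the induction on \<open>k\<close>
  closes on the same function, and higher derivatives of tanh never have to be computed.\<close>

lemma Ck_open_tanh_compose:
  fixes g :: "'a::euclidean_space \<Rightarrow> real"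
  assumes "open U" "Ck_open k U g"
  shows "Ck_open k U (\<lambda>x. tanh (g x))"
  using assms(2)
proof (induction k)
  case 0
  then show ?case
    by (auto intro!: continuous_intros)
next
  case (Suc k)
  have d: "(tanh has_real_derivative 1 - (tanh y)\<^sup>2) (at y)" for y :: real
    by (auto intro!: derivative_eq_intros)
  have "Ck_open k U (pd b (\<lambda>x. tanh (g x)))" if "b \<in> Basis" for b
    using Suc that Ck_open_Suc_imp[OF Suc.prems(1)]
    by (subst Ck_open_cong[OF assms(1) pd_compose[OF d]])
      (auto intro!: Ck_open_mult[OF assms(1)] Ck_open_diff[OF assms(1)] Ck_open_power2[OF assms(1)])
  moreover have "(\<lambda>x. tanh (g x)) differentiable (at x)" if "x \<in> U" for x
    using has_derivative_compose[OF has_derivative_pd[of g x] d[unfolded has_field_derivative_def]]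
      Suc.prems(1) that by (auto intro: differentiableI)
  ultimately show ?case by auto
qed

lemma Ck_open_hidden:
  fixes k :: nat
  assumes "is_HLConcPINN l0 \<theta>" "m < depth \<theta>"
  shows "Ck_open k UNIV (\<lambda>z::'z::euclidean_space. hidden \<theta> z m j)"
  using assms(2)
proof (induction m arbitrary: j)
  case 0
  then show ?case by auto
next
  case (Suc m)
  let ?s = "\<lambda>z::'z. (\<Sum>k<width \<theta> m. weight \<theta> (Suc m) j k * hidden \<theta> z m k) + bias \<theta> (Suc m) j"
  have s: "Ck_open k UNIV ?s"
    using Suc by (intro Ck_open_add Ck_open_sum Ck_open_mult) auto
  consider "act \<theta> (Suc m) = tanh" | "smooth_activation (act \<theta> (Suc m))"
    using assms(1) Suc.prems unfolding is_HLConcPINN_def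
    by (metis One_nat_def Suc_1 atLeastLessThan_iff less_2_cases not_less_eq_eq not_less numeral_3_eq_3)
  then show ?case
    using Ck_open_tanh_compose[OF _ s] Ck_open_smooth_compose[OF _ s] by cases auto
qed

lemma Ck_open_net:
  assumes "is_HLConcPINN l0 \<theta>"
  shows "Ck_open k UNIV (net \<theta>)"
proof -
  have "3 \<le> depth \<theta>" using assms by (simp add: is_HLConcPINN_def)
  then show ?thesis unfolding net_def
    by (intro Ck_open_add Ck_open_sum Ck_open_mult Ck_open_hidden[OF assms]) auto
qed

section \<open>Restriction to a fixed time\<close>

lemma has_derivative_slice: "((\<lambda>x. (x, t)) has_derivative (\<lambda>b. (b, 0))) (at x)"
  by (auto intro!: derivative_eq_intros)

lemma pd_slice:
  assumes "h differentiable (at (x, t))"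
  shows "pd b (\<lambda>y. h (y, t)) x = pd (b, 0) h (x, t)"
  using has_derivative_compose[OF has_derivative_slice has_derivative_pd[OF assms]] by (rule pd_eq)

lemma open_slice:
  assumes "open U"
  shows "open {x. (x, t) \<in> U}"
proof -
  have "{x. (x, t) \<in> U} = (\<lambda>x. (x, t)) -` U" by auto
  then show ?thesis using assms by (auto intro!: open_vimage continuous_intros)
qed

lemma Ck_open_slice:
  fixes h :: "'a::euclidean_space \<times> real \<Rightarrow> real"
  assumes "open U" "Ck_open k U h"
  shows "Ck_open k {x. (x, t) \<in> U} (\<lambda>x. h (x, t))"
  using assms(2)
proof (induction k arbitrary: h)
  case 0
  then show ?case by (auto intro!: continuous_on_compose2[of U h] continuous_intros)
next
  case (Suc k)
  have "(\<lambda>x. h (x, t)) differentiable (at x)" if "(x, t) \<in> U" for x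
    using has_derivative_compose[OF has_derivative_slice has_derivative_pd[of h "(x, t)"]] Suc.prems
      that by (auto intro: differentiableI)
  moreover have "Ck_open k {x. (x, t) \<in> U} (pd b (\<lambda>x. h (x, t)))" if "b \<in> Basis" for b
    using Suc that
    by (subst Ck_open_cong[OF open_slice[OF assms(1)] pd_slice]) (auto simp: Basis_prod_def)
  ultimately show ?case by simp
qed

text \<open>\<open>R_int\<close> and \<open>heat_solution\<close> differentiate slices at fixed t,
  whereas smoothness is known for functions of (x, t). This translates between the two. The identity
  for first derivatives holds on the whole open slice, as the second differentiation
  requires.\<close>

lemma laplacian_slice:
  fixes h :: "'a::euclidean_space \<times> real \<Rightarrow> real"
  assumes "open U" "Ck_open 2 U h" "(x, t) \<in> U"
  shows "laplacian (\<lambda>y. h (y, t)) x = (\<Sum>b\<in>Basis. pd (b, 0) (pd (b, 0) h) (x, t))"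
  unfolding laplacian_def
proof (rule sum.cong)
  fix b :: 'a assume b: "b \<in> Basis"
  have h: "h differentiable (at z)" "pd (b, 0) h differentiable (at z)" if "z \<in> U" for z
    using assms(2) b that by (auto simp: numeral_2_eq_2 Basis_prod_def)
  have "pd b (pd b (\<lambda>y. h (y, t))) x = pd b (\<lambda>y. pd (b, 0) h (y, t)) x"
    by (rule pd_cong[OF open_slice[OF assms(1)], of _ t]) (auto simp: pd_slice h assms(3))
  also have "\<dots> = pd (b, 0) (pd (b, 0) h) (x, t)"
    using h assms(3) by (simp add: pd_slice)
  finally show "pd b (pd b (\<lambda>y. h (y, t))) x = pd (b, 0) (pd (b, 0) h) (x, t)" .
qed simp

section \<open>Fubini along a direction and integration by parts\<close>

lemma nn_integral_lborel_translate:
  fixes f :: "'a::euclidean_space \<Rightarrow> ennreal"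
  assumes [measurable]: "f \<in> borel_measurable borel"
  shows "(\<integral>\<^sup>+x. f (x + c) \<partial>lborel) = (\<integral>\<^sup>+x. f x \<partial>lborel)"
proof -
  have "(\<integral>\<^sup>+x. f x \<partial>lborel) = (\<integral>\<^sup>+x. f x \<partial>distr lborel borel ((+) c))"
    by (simp add: lborel_distr_plus)
  also have "\<dots> = (\<integral>\<^sup>+x. f (x + c) \<partial>lborel)"
    by (subst nn_integral_distr) (auto simp: add.commute)
  finally show ?thesis ..
qed

lemma integral_lborel_translate:
  fixes f :: "'a::euclidean_space \<Rightarrow> real"
  assumes [measurable]: "f \<in> borel_measurable borel"
  shows "(\<integral>x. f (x + c) \<partial>lborel) = (\<integral>x. f x \<partial>lborel)"
proof -
  have "(\<integral>x. f x \<partial>lborel) = (\<integral>x. f x \<partial>distr lborel borel ((+) c))"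
    by (simp add: lborel_distr_plus)
  also have "\<dots> = (\<integral>x. f (x + c) \<partial>lborel)"
    by (subst integral_distr) (auto simp: add.commute)
  finally show ?thesis ..
qed

text \<open>Averaging over the slab uses only translation invariance and Tonelli, so no decomposition of
  the Lebesgue measure along n is needed.\<close>

lemma nn_integral_lborel_fibres:
  fixes f :: "'a::euclidean_space \<Rightarrow> ennreal" and n :: 'a
  assumes [measurable]: "f \<in> borel_measurable borel" and n: "norm n = 1"
  shows "(\<integral>\<^sup>+x. f x \<partial>lborel) =
    (\<integral>\<^sup>+x\<in>{x. 0 \<le> x \<bullet> n \<and> x \<bullet> n \<le> 1}. (\<integral>\<^sup>+s. f (x + (s - x \<bullet> n) *\<^sub>R n) \<partial>lborel) \<partial>lborel)"
proof -
  let ?A = "{x. 0 \<le> x \<bullet> n \<and> x \<bullet> n \<le> 1}"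
  have [measurable]: "?A \<in> sets borel" by measurable
  have "(\<integral>\<^sup>+x\<in>?A. (\<integral>\<^sup>+s. f (x + (s - x \<bullet> n) *\<^sub>R n) \<partial>lborel) \<partial>lborel)
    = (\<integral>\<^sup>+x\<in>?A. (\<integral>\<^sup>+s. f (x + s *\<^sub>R n) \<partial>lborel) \<partial>lborel)"
    using nn_integral_lborel_translate[of "\<lambda>s. f (x + s *\<^sub>R n)" "- (x \<bullet> n)" for x] by simp
  also have "\<dots> = (\<integral>\<^sup>+x. (\<integral>\<^sup>+s. f (x + s *\<^sub>R n) * indicator ?A x \<partial>lborel) \<partial>lborel)"
    by (simp add: nn_integral_multc)
  also have "\<dots> = (\<integral>\<^sup>+s. (\<integral>\<^sup>+x. f (x + s *\<^sub>R n) * indicator ?A x \<partial>lborel) \<partial>lborel)"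
    by (rule lborel_pair.Fubini') measurable
  also have "\<dots> = (\<integral>\<^sup>+s. (\<integral>\<^sup>+x. f x * indicator ?A (x - s *\<^sub>R n) \<partial>lborel) \<partial>lborel)"
  proof (rule nn_integral_cong)
    fix s :: real
    show "(\<integral>\<^sup>+x. f (x + s *\<^sub>R n) * indicator ?A x \<partial>lborel)
      = (\<integral>\<^sup>+x. f x * indicator ?A (x - s *\<^sub>R n) \<partial>lborel)"
      using nn_integral_lborel_translate[of "\<lambda>x. f x * indicator ?A (x - s *\<^sub>R n)" "s *\<^sub>R n"] by simp
  qed
  also have "\<dots> = (\<integral>\<^sup>+x. (\<integral>\<^sup>+s. f x * indicator ?A (x - s *\<^sub>R n) \<partial>lborel) \<partial>lborel)"
    by (rule lborel_pair.Fubini') measurable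
  also have "\<dots> = (\<integral>\<^sup>+x. f x \<partial>lborel)"
  proof (rule nn_integral_cong)
    fix x
    have nn: "n \<bullet> n = 1" using n by (simp add: dot_square_norm)
    \<comment> \<open>For fixed x the shifted slab condition selects an interval of length 1. This
      is where the height 1 of the slab enters.\<close>
    have "(\<integral>\<^sup>+s. f x * indicator ?A (x - s *\<^sub>R n) \<partial>lborel)
      = (\<integral>\<^sup>+s. f x * indicator {x \<bullet> n - 1..x \<bullet> n} s \<partial>lborel)"
      by (intro nn_integral_cong) (auto simp: inner_diff_left nn split: split_indicator)
    also have "\<dots> = f x"
      by (subst nn_integral_cmult) (auto simp: nn_integral_indicator)
    finally show "(\<integral>\<^sup>+s. f x * indicator ?A (x - s *\<^sub>R n) \<partial>lborel) = f x" .
  qed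
  finally show ?thesis ..
qed

lemma integrable_lborel_compact_support:
  fixes f :: "'a::euclidean_space \<Rightarrow> real"
  assumes "continuous_on UNIV f" "\<And>x. x \<notin> K \<Longrightarrow> f x = 0" "compact K"
  shows "integrable lborel f"
proof -
  have "(\<lambda>x. indicator K x *\<^sub>R f x) = f"
    using assms(2) by (auto simp: fun_eq_iff indicator_def)
  then show ?thesis
    using borel_integrable_compact[of K f] assms continuous_on_subset by fastforce
qed

lemma has_real_derivative_along_line:
  assumes "g differentiable (at (x + s *\<^sub>R b))"
  shows "((\<lambda>s. g (x + s *\<^sub>R b)) has_real_derivative pd b g (x + s *\<^sub>R b)) (at s)"
proof -
  have "((\<lambda>s. g (x + s *\<^sub>R b)) has_derivative (\<lambda>h. pd (h *\<^sub>R b) g (x + s *\<^sub>R b))) (at s)"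
    by (rule has_derivative_compose[where f = "\<lambda>s. x + s *\<^sub>R b", OF _ has_derivative_pd[OF assms]])
      (auto intro!: derivative_eq_intros)
  moreover have "pd (h *\<^sub>R b) g (x + s *\<^sub>R b) = pd b g (x + s *\<^sub>R b) * h" for h
    using linear_cmul[OF has_derivative_linear[OF has_derivative_pd[OF assms]]] by simp
  ultimately show ?thesis by (simp add: has_field_derivative_def)
qed

lemma pd_outside_support:
  assumes "closed K" "\<And>x. x \<notin> K \<Longrightarrow> g x = 0" "x \<notin> K"
  shows "pd b g x = 0"
  using pd_cong[of "- K" x g "\<lambda>_. 0" b] assms by (auto simp: pd_const)

text \<open>The difference quotients have integral 0 by translation invariance.\<close>

lemma integral_pd_compact_support:
  fixes g :: "'a::euclidean_space \<Rightarrow> real"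
  assumes g: "Ck_open 1 UNIV g" and b: "b \<in> Basis" and K: "compact K" "\<And>x. x \<notin> K \<Longrightarrow> g x = 0"
  shows "integrable lborel (pd b g)" "integral\<^sup>L lborel (pd b g) = 0"
proof -
  have diff: "g differentiable (at x)" for x using g by simp
  have cont: "continuous_on UNIV (pd b g)" using g b by simp
  have contg: "continuous_on UNIV g" using g by (rule Ck_open_imp_continuous_on)
  then have [measurable]: "g \<in> borel_measurable borel"
    by (rule borel_measurable_continuous_onI)
  have [measurable]: "pd b g \<in> borel_measurable borel"
    using cont by (rule borel_measurable_continuous_onI)
  have pd0: "pd b g x = 0" if "x \<notin> K" for x
    using pd_outside_support[OF compact_imp_closed[OF K(1)] K(2) that] .
  then show "integrable lborel (pd b g)"
    by (rule integrable_lborel_compact_support[OF cont _ K(1)])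
  have "bounded (pd b g ` K)"
    by (intro compact_imp_bounded compact_continuous_image continuous_on_subset[OF cont] K) simp
  then obtain L where L0: "L > 0" and "\<And>x. x \<in> K \<Longrightarrow> \<bar>pd b g x\<bar> \<le> L"
    unfolding bounded_pos by auto
  then have L: "\<bar>pd b g x\<bar> \<le> L" for x
    by (cases "x \<in> K") (auto simp: pd0)
  obtain R where R: "\<And>x. x \<in> K \<Longrightarrow> norm x \<le> R"
    using compact_imp_bounded[OF K(1)] unfolding bounded_iff by blast
  define h where "h k = 1 / real (Suc k)" for k
  have h: "0 < h k" "h k \<le> 1" for k by (auto simp: h_def)
  define q where "q k x = (g (x + h k *\<^sub>R b) - g x) / h k" for k x
  \<comment> \<open>The mean value theorem bounds the quotients by the bound \<open>L\<close> of the
    derivative, and steps of size at most 1 keep their supports in one ball of radius R + 1: an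
    integrable majorant independent of \<open>k\<close>.\<close>
  have bound: "\<bar>q k x\<bar> \<le> L * indicator (cball 0 (R + 1)) x" for k x
  proof (cases "x \<in> cball 0 (R + 1)")
    case True
    obtain z where "g (x + h k *\<^sub>R b) - g (x + 0 *\<^sub>R b) = (h k - 0) * pd b g (x + z *\<^sub>R b)"
      using MVT2[OF h(1)[of k], of "\<lambda>s. g (x + s *\<^sub>R b)" "\<lambda>s. pd b g (x + s *\<^sub>R b)"]
        has_real_derivative_along_line[OF diff] by blast
    then have "q k x = pd b g (x + z *\<^sub>R b)"
      using h(1)[of k] by (simp add: q_def field_simps)
    then show ?thesis using L True by simp
  next
    case False
    then have n: "norm x > R + 1" by simp
    have "norm x \<le> norm (x + h k *\<^sub>R b) + norm (h k *\<^sub>R b)"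
      by (metis add_diff_cancel norm_triangle_ineq4)
    then have "x \<notin> K" "x + h k *\<^sub>R b \<notin> K" using n h[of k] R[of "x + h k *\<^sub>R b"] R[of x] b by auto
    then show ?thesis using K L0 by (simp add: q_def)
  qed
  have lim: "(\<lambda>k. q k x) \<longlonglongrightarrow> pd b g x" for x
  proof -
    have "((\<lambda>s. (g (x + s *\<^sub>R b) - g x) / s) \<longlongrightarrow> pd b g x) (at 0)"
      using has_real_derivative_along_line[of g x 0 b, OF diff] by (simp add: DERIV_def)
    moreover have "filterlim h (at 0) sequentially"
      unfolding filterlim_at using LIMSEQ_inverse_real_of_nat
      by (auto simp: h_def[abs_def] inverse_eq_divide intro: always_eventually)
    ultimately show ?thesis unfolding q_def by (rule filterlim_compose)
  qed
  have "(\<lambda>k. integral\<^sup>L lborel (q k)) \<longlonglongrightarrow> integral\<^sup>L lborel (pd b g)"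
  proof (rule integral_dominated_convergence)
    show "integrable lborel (\<lambda>x. L * indicator (cball 0 (R + 1)) x :: real)"
      using emeasure_compact_finite[of "cball 0 (R + 1)"]
      by (intro integrable_mult_right integrable_real_indicator) auto
  next
    show "q k \<in> borel_measurable lborel" for k unfolding q_def[abs_def] by measurable
  qed (use bound lim in auto)
  moreover have "integral\<^sup>L lborel (q k) = 0" for k
  proof -
    have ig: "integrable lborel g" by (rule integrable_lborel_compact_support[OF contg K(2,1)])
    have "integrable lborel (\<lambda>x. g (x + h k *\<^sub>R b))"
    proof (rule integrable_lborel_compact_support)
      show "continuous_on UNIV (\<lambda>x. g (x + h k *\<^sub>R b))"
        by (intro continuous_on_compose2[OF contg] continuous_intros) auto
      show "compact ((\<lambda>x. x - h k *\<^sub>R b) ` K)"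
        by (intro compact_continuous_image continuous_intros K)
      show "g (x + h k *\<^sub>R b) = 0" if "x \<notin> (\<lambda>x. x - h k *\<^sub>R b) ` K" for x
      proof (rule K(2))
        show "x + h k *\<^sub>R b \<notin> K" using that by (metis add_diff_cancel image_eqI)
      qed
    qed
    then show ?thesis
      using ig integral_lborel_translate[of g "h k *\<^sub>R b"] by (simp add: q_def[abs_def])
  qed
  ultimately show "integral\<^sup>L lborel (pd b g) = 0"
    by (simp add: LIMSEQ_const_iff)
qed

text \<open>\<open>ramp\<close> is C^1 but not C^2, hence no \<open>smooth_activation\<close>; this
  chain rule asks only for a continuous derivative on the values of \<open>g\<close>. One derivative
  is all that the divergence inequality consumes.\<close>

lemma Ck_open_1_compose:
  assumes "open U" "Ck_open 1 U g"
    and s: "\<And>x. x \<in> U \<Longrightarrow> (s has_real_derivative s' (g x)) (at (g x))" "continuous_on (g ` U) s'"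
  shows "Ck_open 1 U (\<lambda>x. s (g x))"
proof -
  have g: "g differentiable (at x)" if "x \<in> U" for x using assms(2) that by simp
  have "continuous_on U g" using assms(2) by (rule Ck_open_imp_continuous_on)
  then have c: "continuous_on U (\<lambda>x. s' (g x) * pd b g x)" if "b \<in> Basis" for b
    using assms(2) that by (auto intro!: continuous_on_mult continuous_on_compose2[OF s(2)])
  have "Ck_open 0 U (pd b (\<lambda>x. s (g x)))" if "b \<in> Basis" for b
  proof -
    have "pd b (\<lambda>x. s (g x)) x = s' (g x) * pd b g x" if "x \<in> U" for x
      by (intro pd_compose s(1) g that)
    then show ?thesis
      using that c by (subst Ck_open_cong[OF assms(1)]) auto
  qed
  moreover have "(\<lambda>x. s (g x)) differentiable (at x)" if "x \<in> U" for x
    using has_derivative_compose[OF has_derivative_pd[OF g[OF that]]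
        s(1)[OF that, unfolded has_field_derivative_def]] by (rule differentiableI)
  ultimately show ?thesis by simp
qed

section \<open>A C^1 step function\<close>

lemma has_real_derivative_max0_power2:
  "((\<lambda>s::real. (max 0 s)\<^sup>2) has_real_derivative 2 * max 0 s) (at s)"
proof -
  consider "s < 0" | "s > 0" | "s = 0" by linarith
  then show ?thesis
  proof cases
    case 1
    have "((\<lambda>s::real. 0) has_real_derivative 2 * max 0 s) (at s)" using 1 by simp
    then show ?thesis
      by (rule has_field_derivative_transform_within_open[of _ _ _ "{..<0}"]) (use 1 in auto)
  next
    case 2
    have "((\<lambda>s::real. s\<^sup>2) has_real_derivative 2 * max 0 s) (at s)"
      using 2 by (auto intro!: derivative_eq_intros)
    then show ?thesis
      by (rule has_field_derivative_transform_within_open[of _ _ _ "{0<..}"]) (use 2 in auto)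
  next
    case 3
    have "((\<lambda>h::real. (max 0 h)\<^sup>2 / h) \<longlongrightarrow> 0) (at 0)"
    proof (rule Lim_null_comparison)
      show "\<forall>\<^sub>F h::real in at 0. norm ((max 0 h)\<^sup>2 / h) \<le> \<bar>h\<bar>"
        by (intro always_eventually) (auto simp: max_def power2_eq_square)
      show "((\<lambda>h::real. \<bar>h\<bar>) \<longlongrightarrow> 0) (at 0)"
        by (rule tendsto_rabs_zero) (rule tendsto_ident_at)
    qed
    then show ?thesis using 3 by (simp add: DERIV_def)
  qed
qed

text \<open>A quadratic spline that rises from 0 to 1 on the unit interval and is of class C^1.\<close>

definition ramp :: "real \<Rightarrow> real" where
  "ramp s = 2 * ((max 0 s)\<^sup>2 - 2 * (max 0 (s - 1/2))\<^sup>2 + (max 0 (s - 1))\<^sup>2)"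

text \<open>The tent on the unit interval with peak 2 at 1/2, hence of area 1; beyond 1 the slopes
  4, -8 and 4 cancel.\<close>

definition ramp' :: "real \<Rightarrow> real" where
  "ramp' s = 4 * (max 0 s - 2 * max 0 (s - 1/2) + max 0 (s - 1))"

lemma has_real_derivative_ramp: "(ramp has_real_derivative ramp' s) (at s)"
proof -
  have d: "((\<lambda>s. (max 0 (s - c))\<^sup>2) has_real_derivative 2 * max 0 (s - c)) (at s)" for c
    using DERIV_shift[of "\<lambda>s. (max 0 s)\<^sup>2" "2 * max 0 (s - c)" s "- c"]
      has_real_derivative_max0_power2[of "s - c"] by simp
  show ?thesis unfolding ramp_def[abs_def] ramp'_def
    by (rule derivative_eq_intros d d[of 0, simplified] refl)+ (simp add: algebra_simps)
qed

lemma continuous_on_ramp': "continuous_on S ramp'"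
  unfolding ramp'_def[abs_def] by (intro continuous_intros)

lemma ramp'_nonneg: "0 \<le> ramp' s"
  by (auto simp: ramp'_def max_def)

lemma ramp'_outside: "s \<le> 0 \<or> 1 \<le> s \<Longrightarrow> ramp' s = 0"
  by (auto simp: ramp'_def max_def)

lemma ramp_le_0: "s \<le> 0 \<Longrightarrow> ramp s = 0"
  by (auto simp: ramp_def max_def)

lemma ramp_ge_1: "1 \<le> s \<Longrightarrow> ramp s = 1"
  by (auto simp: ramp_def max_def power2_eq_square algebra_simps)

lemma ramp_mono: "s \<le> t \<Longrightarrow> ramp s \<le> ramp t"
  using has_real_derivative_ramp ramp'_nonneg by (metis DERIV_nonneg_imp_nondecreasing)

lemma ramp_bounds: "0 \<le> ramp s" "ramp s \<le> 1"
  using ramp_mono[of "min s 0" s] ramp_le_0[of "min s 0"]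
    ramp_mono[of s "max s 1"] ramp_ge_1[of "max s 1"] by auto

text \<open>The rescaled tents have mass 1 and live on [c, c + \<epsilon>], so they tend to the
  point mass at \<open>c\<close> from above. With \<open>c\<close> the height of the graph over a
  point, this is how the surface integral arises.\<close>

lemma nn_integral_ramp':
  assumes "\<epsilon> > 0"
  shows "(\<integral>\<^sup>+s. ennreal (ramp' ((s - c) / \<epsilon>) / \<epsilon>) \<partial>lborel) = 1"
proof -
  have [measurable]: "ramp' \<in> borel_measurable borel"
    by (intro borel_measurable_continuous_onI continuous_on_ramp')
  have "(\<integral>\<^sup>+s. ennreal (ramp' ((s - c) / \<epsilon>) / \<epsilon>) \<partial>lborel)
    = (\<integral>\<^sup>+s. ennreal (ramp' ((s - c) / \<epsilon>) / \<epsilon>) * indicator {c..c + \<epsilon>} s \<partial>lborel)"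
    using assms
    by (intro nn_integral_cong) (auto split: split_indicator simp: ramp'_outside field_simps)
  also have "\<dots> = ennreal (ramp ((c + \<epsilon> - c) / \<epsilon>) - ramp ((c - c) / \<epsilon>))"
  proof (rule nn_integral_FTC_Icc)
    show "((\<lambda>s. ramp ((s - c) / \<epsilon>)) has_real_derivative ramp' ((x - c) / \<epsilon>) / \<epsilon>) (at x)" for x
    proof -
      have "((\<lambda>s. (s - c) / \<epsilon>) has_real_derivative 1 / \<epsilon>) (at x)"
        using assms by (auto intro!: derivative_eq_intros)
      then show ?thesis using DERIV_chain2[OF has_real_derivative_ramp] by fastforce
    qed
  qed (use assms ramp'_nonneg in auto)
  also have "\<dots> = 1" using assms by (simp add: ramp_le_0 ramp_ge_1)
  finally show ?thesis .
qed

section \<open>The divergence inequality above a graph\<close>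

definition graph_proj :: "'a::euclidean_space \<Rightarrow> ('a \<Rightarrow> real) \<Rightarrow> 'a \<Rightarrow> 'a" where
  "graph_proj n \<gamma> x = x + (\<gamma> x - x \<bullet> n) *\<^sub>R n"

definition graph_density :: "('a::euclidean_space \<Rightarrow> real) \<Rightarrow> 'a \<Rightarrow> real" where
  "graph_density \<gamma> x = sqrt (1 + (\<Sum>b\<in>Basis. (pd b \<gamma> x)\<^sup>2))"

abbreviation slab :: "'a::euclidean_space \<Rightarrow> 'a set" where
  "slab n \<equiv> {x. 0 \<le> x \<bullet> n \<and> x \<bullet> n \<le> 1}"

text \<open>Only negative values are lost on the right. It lets a signed integral be continued as a
  nonnegative one, to which Tonelli applies without integrability conditions.\<close>

lemma ennreal_integral_le_nn_integral:
  assumes "integrable M f"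
  shows "ennreal (\<integral>x. f x \<partial>M) \<le> (\<integral>\<^sup>+x. ennreal (f x) \<partial>M)"
proof -
  have i: "integrable M (\<lambda>x. max 0 (f x))" using assms by auto
  have "ennreal (\<integral>x. f x \<partial>M) \<le> ennreal (\<integral>x. max 0 (f x) \<partial>M)"
    by (intro ennreal_leI integral_mono assms i) auto
  also have "\<dots> = (\<integral>\<^sup>+x. ennreal (max 0 (f x)) \<partial>M)"
    using nn_integral_eq_integral[OF i] by simp
  also have "\<dots> = (\<integral>\<^sup>+x. ennreal (f x) \<partial>M)"
    by (intro nn_integral_cong) (auto simp: max_def ennreal_neg)
  finally show ?thesis .
qed

text \<open>What a graph chart says about \<gamma> and \<open>n\<close> alone, without
  \<open>D\<close> and the ball. The region above the graph is then a subset of the whole space, and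
  localisation is left to the support of the field.\<close>

locale graph_data =
  fixes n :: "'a::euclidean_space" and \<gamma> :: "'a \<Rightarrow> real"
  assumes n: "n \<in> Basis \<or> - n \<in> Basis"
    and C1: "Ck_open 1 UNIV \<gamma>"
    and const: "\<gamma> (x + c *\<^sub>R n) = \<gamma> x"
begin

lemma norm_n: "norm n = 1"
  using n by (metis norm_Basis norm_minus_cancel)

lemma n_n: "n \<bullet> n = 1"
  using norm_n by (simp add: dot_square_norm)

lemma diff: "\<gamma> differentiable (at x)"
  using C1 by simp

lemma continuous_gamma: "continuous_on S \<gamma>"
  using Ck_open_imp_continuous_on[OF C1] continuous_on_subset by blast

lemma continuous_pd_gamma: "b \<in> Basis \<Longrightarrow> continuous_on S (pd b \<gamma>)"
  using C1 continuous_on_subset by fastforce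

lemma continuous_graph_proj: "continuous_on S (graph_proj n \<gamma>)"
  unfolding graph_proj_def[abs_def] by (intro continuous_intros continuous_gamma)

lemma continuous_graph_density: "continuous_on S (graph_density \<gamma>)"
  unfolding graph_density_def[abs_def] by (intro continuous_intros continuous_pd_gamma)

lemma measurable_graph [measurable]:
  "\<gamma> \<in> borel_measurable borel" "graph_proj n \<gamma> \<in> borel_measurable borel"
  "graph_density \<gamma> \<in> borel_measurable borel"
  by (intro borel_measurable_continuous_onI continuous_gamma continuous_graph_proj
      continuous_graph_density)+

lemma pd_const_along: "pd b \<gamma> (x + c *\<^sub>R n) = pd b \<gamma> x"
proof -
  have "((\<lambda>y. \<gamma> (y + c *\<^sub>R n)) has_derivative (\<lambda>v. pd v \<gamma> (x + c *\<^sub>R n))) (at x)"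
    by (rule has_derivative_compose[where f = "\<lambda>y. y + c *\<^sub>R n" and f' = "\<lambda>v. v",
          OF _ has_derivative_pd[OF diff]]) (auto intro!: derivative_eq_intros)
  then show ?thesis using pd_eq[of \<gamma> "\<lambda>v. pd v \<gamma> (x + c *\<^sub>R n)"] by (simp add: const)
qed

lemma graph_density_along: "graph_density \<gamma> (x + c *\<^sub>R n) = graph_density \<gamma> x"
  by (simp add: graph_density_def pd_const_along)

lemma sum_n_pd: "(\<Sum>b\<in>Basis. (n \<bullet> b) * pd b \<gamma> x) = 0"
proof -
  have l: "linear (\<lambda>v. pd v \<gamma> x)" by (rule has_derivative_linear[OF has_derivative_pd[OF diff]])
  have "pd n \<gamma> x = (\<Sum>b\<in>Basis. (n \<bullet> b) * pd b \<gamma> x)"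
    using linear_sum[OF l, of "\<lambda>b. (n \<bullet> b) *\<^sub>R b" Basis] linear_cmul[OF l]
    by (simp add: euclidean_representation)
  moreover have "((\<lambda>s. \<gamma> (x + s *\<^sub>R n)) has_real_derivative pd n \<gamma> x) (at 0)"
    using has_real_derivative_along_line[of \<gamma> x 0 n, OF diff] by simp
  then have "((\<lambda>s. \<gamma> x) has_real_derivative pd n \<gamma> x) (at 0)" by (simp add: const)
  then have "pd n \<gamma> x = 0" using DERIV_const DERIV_unique by blast
  ultimately show ?thesis by simp
qed

text \<open>Pythagoras: the gradient of \<gamma> is orthogonal to the unit vector \<open>n\<close>.
  Since n - \<nabla>\<gamma> is the gradient of the height x \<bullet> n - \<gamma> x above the
  graph, the surface density is exactly the factor that Cauchy-Schwarz produces when the cut-off is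
  differentiated.\<close>

lemma graph_density_eq_L2: "L2_set (\<lambda>b. n \<bullet> b - pd b \<gamma> x) Basis = graph_density \<gamma> x"
proof -
  have "(\<Sum>b\<in>Basis. (n \<bullet> b - pd b \<gamma> x)\<^sup>2)
    = (\<Sum>b\<in>Basis. (n \<bullet> b)\<^sup>2) - 2 * (\<Sum>b\<in>Basis. (n \<bullet> b) * pd b \<gamma> x) + (\<Sum>b\<in>Basis. (pd b \<gamma> x)\<^sup>2)"
    by (simp add: power2_diff sum.distrib sum_subtractf sum_distrib_left algebra_simps)
  also have "(\<Sum>b\<in>Basis. (n \<bullet> b)\<^sup>2) = 1"
    using n_n euclidean_inner[of n n] by (simp add: power2_eq_square)
  finally show ?thesis by (simp add: L2_set_def graph_density_def sum_n_pd)
qed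

lemma graph_proj_inner: "graph_proj n \<gamma> x \<bullet> n = \<gamma> (graph_proj n \<gamma> x)"
  by (simp add: graph_proj_def const inner_add_left n_n)

lemma graph_density_pos: "graph_density \<gamma> x \<ge> 1"
  by (simp add: graph_density_def sum_nonneg)

lemma bounded_slab_over:
  assumes "bounded K"
  shows "bounded {x \<in> slab n. graph_proj n \<gamma> x \<in> K}"
proof -
  obtain R where R: "\<And>x. x \<in> K \<Longrightarrow> norm x \<le> R" using assms unfolding bounded_iff by blast
  \<comment> \<open>With p the projected point, x differs from p by (x \<bullet> n - \<gamma> x) n.
    Here |p| \<le> R, |\<gamma> x| = |p \<bullet> n| \<le> R and |x \<bullet> n| \<le> 1.\<close>
  have "norm x \<le> 2 * R + 1" if x: "x \<in> slab n" "graph_proj n \<gamma> x \<in> K" for x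
  proof -
    let ?p = "graph_proj n \<gamma> x"
    have g: "\<gamma> x = ?p \<bullet> n" by (simp add: graph_proj_inner) (simp add: graph_proj_def const)
    have "x = ?p + (x \<bullet> n - \<gamma> x) *\<^sub>R n" by (simp add: graph_proj_def algebra_simps)
    then have "norm x \<le> norm ?p + \<bar>x \<bullet> n - \<gamma> x\<bar>"
      using norm_triangle_ineq[of ?p "(x \<bullet> n - \<gamma> x) *\<^sub>R n"] norm_n by simp
    moreover have "\<bar>?p \<bullet> n\<bar> \<le> norm ?p" using Cauchy_Schwarz_ineq2[of ?p n] norm_n by simp
    ultimately show ?thesis using x R[of ?p] g by auto
  qed
  then show ?thesis unfolding bounded_iff by blast
qed

text \<open>A bounded piece of the graph has finite area. This makes the approximation error in the
  divergence inequality vanish in the limit, and later gives the finiteness of the surface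
  measure.\<close>

lemma slab_area_finite:
  assumes "bounded K"
  shows "(\<integral>\<^sup>+x\<in>{x \<in> slab n. graph_proj n \<gamma> x \<in> K}. ennreal (graph_density \<gamma> x) \<partial>lborel) < \<infinity>"
proof -
  let ?S = "{x \<in> slab n. graph_proj n \<gamma> x \<in> K}"
  have b: "compact (closure ?S)" using bounded_slab_over[OF assms] by (simp add: compact_closure)
  then have "bounded (graph_density \<gamma> ` closure ?S)"
    by (intro compact_imp_bounded compact_continuous_image continuous_graph_density)
  then obtain L where L: "\<And>x. x \<in> closure ?S \<Longrightarrow> \<bar>graph_density \<gamma> x\<bar> \<le> L"
    unfolding bounded_iff by auto
  have "(\<integral>\<^sup>+x\<in>?S. ennreal (graph_density \<gamma> x) \<partial>lborel)
    \<le> (\<integral>\<^sup>+x. ennreal L * indicator (closure ?S) x \<partial>lborel)"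
  proof (rule nn_integral_mono)
    fix x
    show "ennreal (graph_density \<gamma> x) * indicator ?S x \<le> ennreal L * indicator (closure ?S) x"
    proof (cases "x \<in> ?S")
      case True
      then have "x \<in> closure ?S" using closure_subset[of ?S] by blast
      then show ?thesis using True L[of x] by (simp add: ennreal_leI)
    qed simp
  qed
  also have "\<dots> = ennreal L * emeasure lborel (closure ?S)"
    by (simp add: nn_integral_cmult_indicator)
  also have "\<dots> < \<infinity>"
    using emeasure_compact_finite[OF b] by (simp add: ennreal_mult_less_top)
  finally show ?thesis .
qed

text \<open>Both sides live in \<open>ennreal\<close>: a negative divergence integral becomes 0, and
  the right-hand side is open to Tonelli. For each width \<epsilon> the cut-off bounds the left side
  by an integral over a thin layer above the graph (\<open>key\<close>); uniform continuity of |H|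
  then moves the layer onto the graph at the cost of \<eta> times a finite area
  (\<open>bound\<close>).\<close>

lemma epigraph_divergence:
  fixes H :: "'a \<Rightarrow> 'a \<Rightarrow> real"
  assumes H: "\<And>b. b \<in> Basis \<Longrightarrow> Ck_open 1 UNIV (H b)"
    and supp: "\<And>b x. x \<notin> cball x0 \<rho> \<Longrightarrow> H b x = 0"
  shows "ennreal (LBINT x:{x. \<gamma> x < x \<bullet> n}. \<Sum>b\<in>Basis. pd b (H b) x)
    \<le> (\<integral>\<^sup>+x\<in>slab n. ennreal (graph_density \<gamma> x * L2_set (\<lambda>b. H b (graph_proj n \<gamma> x)) Basis) \<partial>lborel)"
    (is "ennreal ?I \<le> ?B")
proof -
  define N where "N x = L2_set (\<lambda>b. H b x) Basis" for x
  define dv where "dv x = (\<Sum>b\<in>Basis. pd b (H b) x)" for x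
  define \<psi> where "\<psi> x = x \<bullet> n - \<gamma> x" for x
  have cH: "continuous_on S (H b)" if "b \<in> Basis" for b S
    using Ck_open_imp_continuous_on[OF H[OF that]] continuous_on_subset by blast
  have cN: "continuous_on S N" for S
    unfolding N_def[abs_def] L2_set_def by (intro continuous_intros cH)
  have cdiv: "continuous_on S dv" for S
    unfolding dv_def[abs_def] using H
    by (intro continuous_on_sum) (auto intro: continuous_on_subset)
  have c\<psi>: "continuous_on S \<psi>" for S
    unfolding \<psi>_def[abs_def] by (intro continuous_intros continuous_gamma)
  have [measurable]: "N \<in> borel_measurable borel" "dv \<in> borel_measurable borel"
    "\<psi> \<in> borel_measurable borel" "ramp' \<in> borel_measurable borel" "ramp \<in> borel_measurable borel"
    using has_real_derivative_ramp
    by (auto intro!: borel_measurable_continuous_onI simp: cN cdiv c\<psi> continuous_on_ramp'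
        intro: DERIV_continuous_on has_field_derivative_at_within)
  have N0: "N x = 0" if "x \<notin> cball x0 \<rho>" for x using supp[OF that] by (simp add: N_def L2_set_def)
  have N_nonneg: "0 \<le> N x" for x by (simp add: N_def L2_set_nonneg)
  have div0: "dv x = 0" if "x \<notin> cball x0 \<rho>" for x
    unfolding dv_def using pd_outside_support[OF closed_cball supp that] by simp
  have idiv: "integrable lborel dv"
    by (rule integrable_lborel_compact_support[OF cdiv, of "cball x0 \<rho>"]) (auto simp: div0)
  have pd\<psi>: "pd b \<psi> x = n \<bullet> b - pd b \<gamma> x" for b x
  proof (rule pd_eq)
    show "(\<psi> has_derivative (\<lambda>b. n \<bullet> b - pd b \<gamma> x)) (at x)"
      unfolding \<psi>_def[abs_def] using has_derivative_pd[OF diff]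
      by (auto intro!: derivative_eq_intros simp: inner_commute)
  qed
  have C\<psi>: "Ck_open 1 UNIV \<psi>"
    unfolding \<psi>_def[abs_def] by (intro Ck_open_diff C1 Ck_open_inner) simp
  have key: "ennreal (\<integral>x. ramp (\<psi> x / \<epsilon>) * dv x \<partial>lborel)
      \<le> (\<integral>\<^sup>+x. ennreal (ramp' (\<psi> x / \<epsilon>) / \<epsilon> * (graph_density \<gamma> x * N x)) \<partial>lborel)"
    if \<epsilon>: "\<epsilon> > 0" for \<epsilon>
  proof -
    have d: "((\<lambda>y. ramp (y / \<epsilon>)) has_real_derivative ramp' (y / \<epsilon>) / \<epsilon>) (at y)" for y
    proof -
      have "((\<lambda>y. y / \<epsilon>) has_real_derivative 1 / \<epsilon>) (at y)"
        using \<epsilon> by (auto intro!: derivative_eq_intros)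
      then show ?thesis using DERIV_chain2[OF has_real_derivative_ramp] by fastforce
    qed
    have C: "Ck_open 1 UNIV (\<lambda>x. ramp (\<psi> x / \<epsilon>))"
      by (rule Ck_open_1_compose[where s = "\<lambda>y. ramp (y / \<epsilon>)" and s' = "\<lambda>y. ramp' (y / \<epsilon>) / \<epsilon>",
            OF open_UNIV C\<psi>])
        (use \<epsilon> in \<open>auto intro!: d continuous_intros
            continuous_on_compose2[OF continuous_on_ramp'[of UNIV]]\<close>)
    have pdr: "pd b (\<lambda>x. ramp (\<psi> x / \<epsilon>)) x = ramp' (\<psi> x / \<epsilon>) / \<epsilon> * pd b \<psi> x" for b x
      by (rule pd_compose[where s = "\<lambda>y. ramp (y / \<epsilon>)"]) (use C\<psi> in \<open>auto simp: d\<close>)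
    have CP: "Ck_open 1 UNIV (\<lambda>x. ramp (\<psi> x / \<epsilon>) * H b x)" if "b \<in> Basis" for b
      by (intro Ck_open_mult C H that) simp
    have pdP: "pd b (\<lambda>x. ramp (\<psi> x / \<epsilon>) * H b x) x
        = ramp (\<psi> x / \<epsilon>) * pd b (H b) x + ramp' (\<psi> x / \<epsilon>) / \<epsilon> * pd b \<psi> x * H b x"
      if "b \<in> Basis" for b x
      using C H[OF that] by (subst pd_mult) (auto simp: pdr)
    let ?P = "\<lambda>x. \<Sum>b\<in>Basis. pd b (\<lambda>x. ramp (\<psi> x / \<epsilon>) * H b x) x"
    let ?q = "\<lambda>x. ramp' (\<psi> x / \<epsilon>) / \<epsilon> * (\<Sum>b\<in>Basis. pd b \<psi> x * H b x)"
    have P: "?P x = ramp (\<psi> x / \<epsilon>) * dv x + ?q x" for x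
      by (simp add: pdP dv_def sum.distrib sum_distrib_left mult.assoc)
    have supp': "ramp (\<psi> x / \<epsilon>) * H b x = 0" if "x \<notin> cball x0 \<rho>" for b x
      using supp[OF that] by simp
    have iP: "integrable lborel ?P" "integral\<^sup>L lborel ?P = 0"
      using integral_pd_compact_support[OF CP _ compact_cball supp']
      by (auto intro!: Bochner_Integration.integrable_sum simp: Bochner_Integration.integral_sum)
    have ird: "integrable lborel (\<lambda>x. ramp (\<psi> x / \<epsilon>) * dv x)"
      using ramp_bounds by (intro Bochner_Integration.integrable_bound[OF idiv])
        (auto simp: abs_mult mult_left_le_one_le)
    have iq: "integrable lborel ?q"
      using Bochner_Integration.integrable_diff[OF iP(1) ird] by (simp add: P)
    have "(\<integral>x. ramp (\<psi> x / \<epsilon>) * dv x \<partial>lborel) = (\<integral>x. - ?q x \<partial>lborel)"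
      using iP(2) Bochner_Integration.integral_add[OF ird iq] by (simp add: P)
    then have "ennreal (\<integral>x. ramp (\<psi> x / \<epsilon>) * dv x \<partial>lborel) = ennreal (\<integral>x. - ?q x \<partial>lborel)"
      by (rule arg_cong)
    also have "\<dots> \<le> (\<integral>\<^sup>+x. ennreal (- ?q x) \<partial>lborel)"
      using iq by (intro ennreal_integral_le_nn_integral) auto
    also have "\<dots> \<le> (\<integral>\<^sup>+x. ennreal (ramp' (\<psi> x / \<epsilon>) / \<epsilon> * (graph_density \<gamma> x * N x)) \<partial>lborel)"
    proof (intro nn_integral_mono ennreal_leI)
      fix x
      have "- (\<Sum>b\<in>Basis. pd b \<psi> x * H b x) \<le> (\<Sum>b\<in>Basis. \<bar>n \<bullet> b - pd b \<gamma> x\<bar> * \<bar>H b x\<bar>)"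
        unfolding sum_negf[symmetric] pd\<psi> abs_mult[symmetric] by (intro sum_mono) simp
      also have "\<dots> \<le> graph_density \<gamma> x * N x"
        unfolding N_def graph_density_eq_L2[symmetric] by (rule L2_set_mult_ineq)
      finally show "- ?q x \<le> ramp' (\<psi> x / \<epsilon>) / \<epsilon> * (graph_density \<gamma> x * N x)"
        using \<epsilon> ramp'_nonneg mult_left_mono[of "- (\<Sum>b\<in>Basis. pd b \<psi> x * H b x)" _ "ramp' (\<psi> x / \<epsilon>) / \<epsilon>"]
        by simp
    qed
    finally show ?thesis .
  qed
  have bound: "ennreal ?I \<le> ?B + ennreal \<eta> * (\<integral>\<^sup>+x\<in>{x \<in> slab n. graph_proj n \<gamma> x \<in> cball x0 (\<rho> + 1)}.
      ennreal (graph_density \<gamma> x) \<partial>lborel)" (is "_ \<le> _ + _ * ?K") if \<eta>: "\<eta> > 0" for \<eta>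
  proof -
    have "uniformly_continuous_on (cball x0 (\<rho> + 1)) N"
      by (intro compact_uniformly_continuous cN) auto
    then obtain \<delta>0 where \<delta>0: "\<delta>0 > 0" "\<And>y z. y \<in> cball x0 (\<rho> + 1) \<Longrightarrow> z \<in> cball x0 (\<rho> + 1) \<Longrightarrow>
        dist z y < \<delta>0 \<Longrightarrow> dist (N z) (N y) < \<eta>"
      using \<eta> unfolding uniformly_continuous_on_def by metis
    define \<delta> where "\<delta> = min \<delta>0 1"
    \<comment> \<open>The indicator confines the error \<eta> to a bounded part of the graph, which
      keeps its integral finite. If z lies in the support ball, the cap 1 on \<open>\<delta>\<close>
      puts y within radius \<rho> + 1; otherwise the left side is 0.\<close>
    have \<delta>: "N z \<le> N y + \<eta> * indicator (cball x0 (\<rho> + 1)) y" if "dist z y < \<delta>" for y z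
    proof (cases "z \<in> cball x0 \<rho>")
      case True
      then have "z \<in> cball x0 (\<rho> + 1)" "y \<in> cball x0 (\<rho> + 1)"
        using that dist_triangle[of x0 y z] by (auto simp: \<delta>_def)
      then show ?thesis using \<delta>0(2)[of y z] that by (auto simp: \<delta>_def dist_real_def)
    next
      case False
      then show ?thesis using \<eta> N_nonneg[of y] by (simp add: N0)
    qed
    have J: "ennreal (\<integral>x. ramp (\<psi> x / \<epsilon>) * dv x \<partial>lborel) \<le> ?B + ennreal \<eta> * ?K"
      if \<epsilon>: "\<epsilon> > 0" "\<epsilon> < \<delta>" for \<epsilon>
    proof -
      have "ennreal (\<integral>x. ramp (\<psi> x / \<epsilon>) * dv x \<partial>lborel)
        \<le> (\<integral>\<^sup>+x. ennreal (ramp' (\<psi> x / \<epsilon>) / \<epsilon> * (graph_density \<gamma> x * N x)) \<partial>lborel)"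
        by (rule key[OF \<epsilon>(1)])
      \<comment> \<open>On the fibre over x the height is s - \<gamma> x, and the density does not
        change along \<open>n\<close>.\<close>
      also have "\<dots> = (\<integral>\<^sup>+x\<in>slab n. (\<integral>\<^sup>+s. ennreal (ramp' ((s - \<gamma> x) / \<epsilon>) / \<epsilon>
          * (graph_density \<gamma> x * N (x + (s - x \<bullet> n) *\<^sub>R n))) \<partial>lborel) \<partial>lborel)"
        by (subst nn_integral_lborel_fibres[OF _ norm_n])
          (simp_all add: \<psi>_def const inner_add_left n_n graph_density_along)
      also have "\<dots> \<le> (\<integral>\<^sup>+x\<in>slab n. ennreal (graph_density \<gamma> x
          * (N (graph_proj n \<gamma> x) + \<eta> * indicator (cball x0 (\<rho> + 1)) (graph_proj n \<gamma> x))) \<partial>lborel)"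
      proof (intro nn_integral_mono mult_right_mono)
        fix x
        let ?M = "graph_density \<gamma> x
          * (N (graph_proj n \<gamma> x) + \<eta> * indicator (cball x0 (\<rho> + 1)) (graph_proj n \<gamma> x))"
        have gd: "0 \<le> graph_density \<gamma> x" using graph_density_pos[of x] by simp
        have "(\<integral>\<^sup>+s. ennreal (ramp' ((s - \<gamma> x) / \<epsilon>) / \<epsilon>
            * (graph_density \<gamma> x * N (x + (s - x \<bullet> n) *\<^sub>R n))) \<partial>lborel)
          \<le> (\<integral>\<^sup>+s. ennreal (ramp' ((s - \<gamma> x) / \<epsilon>) / \<epsilon>) * ennreal ?M \<partial>lborel)"
        proof (rule nn_integral_mono)
          fix s
          show "ennreal (ramp' ((s - \<gamma> x) / \<epsilon>) / \<epsilon> * (graph_density \<gamma> x * N (x + (s - x \<bullet> n) *\<^sub>R n)))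
            \<le> ennreal (ramp' ((s - \<gamma> x) / \<epsilon>) / \<epsilon>) * ennreal ?M"
          proof (cases "0 < s - \<gamma> x \<and> s - \<gamma> x < \<epsilon>")
            case True
            have "x + (s - x \<bullet> n) *\<^sub>R n - graph_proj n \<gamma> x = (s - \<gamma> x) *\<^sub>R n"
              by (simp add: graph_proj_def algebra_simps)
            then have "dist (x + (s - x \<bullet> n) *\<^sub>R n) (graph_proj n \<gamma> x) < \<delta>"
              using True \<epsilon> norm_n by (simp add: dist_norm)
            then have "graph_density \<gamma> x * N (x + (s - x \<bullet> n) *\<^sub>R n) \<le> ?M"
              by (intro mult_left_mono \<delta> gd)
            then have "ramp' ((s - \<gamma> x) / \<epsilon>) / \<epsilon> * (graph_density \<gamma> x * N (x + (s - x \<bullet> n) *\<^sub>R n))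
              \<le> ramp' ((s - \<gamma> x) / \<epsilon>) / \<epsilon> * ?M"
              by (rule mult_left_mono) (use \<epsilon> ramp'_nonneg in simp)
            then show ?thesis
              using \<epsilon> ramp'_nonneg by (subst ennreal_mult'[symmetric]) (auto intro: ennreal_leI)
          next
            case False
            then have "ramp' ((s - \<gamma> x) / \<epsilon>) = 0"
              using \<epsilon> by (intro ramp'_outside) (auto simp: field_simps)
            then show ?thesis by simp
          qed
        qed
        also have "\<dots> = ennreal ?M"
          by (simp add: nn_integral_multc nn_integral_ramp'[OF \<epsilon>(1)])
        finally show "(\<integral>\<^sup>+s. ennreal (ramp' ((s - \<gamma> x) / \<epsilon>) / \<epsilon>
            * (graph_density \<gamma> x * N (x + (s - x \<bullet> n) *\<^sub>R n))) \<partial>lborel) \<le> ennreal ?M" .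
      qed simp
      also have "\<dots> = (\<integral>\<^sup>+x. ennreal (graph_density \<gamma> x * N (graph_proj n \<gamma> x)) * indicator (slab n) x
          + ennreal \<eta> * (ennreal (graph_density \<gamma> x)
            * indicator {x \<in> slab n. graph_proj n \<gamma> x \<in> cball x0 (\<rho> + 1)} x) \<partial>lborel)"
        using graph_density_pos N_nonneg \<eta>
        by (intro nn_integral_cong)
          (auto split: split_indicator simp: ring_distribs ennreal_mult' ennreal_plus mult.commute
            order_trans[OF zero_le_one])
      also have "\<dots> = ?B + ennreal \<eta> * ?K"
        unfolding N_def[symmetric] by (subst nn_integral_add) (auto simp: nn_integral_cmult)
      finally show ?thesis .
    qed
    \<comment> \<open>The offset 2 makes every width strictly smaller than \<open>\<delta>\<close>,
      also the one for k = 0.\<close>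
    define \<epsilon> where "\<epsilon> k = \<delta> / real (k + 2)" for k
    have \<delta>_pos: "\<delta> > 0" using \<delta>0(1) by (simp add: \<delta>_def)
    have \<epsilon>: "0 < \<epsilon> k" "\<epsilon> k < \<delta>" for k
      using \<delta>_pos by (auto simp: \<epsilon>_def field_simps intro: add_pos_nonneg)
    have \<epsilon>0: "\<epsilon> \<longlonglongrightarrow> 0"
      unfolding \<epsilon>_def[abs_def] by (rule LIMSEQ_ignore_initial_segment[OF lim_const_over_n])
    \<comment> \<open>Because \<open>ramp\<close> vanishes at 0, the cut-offs tend to the indicator
      of the strict epigraph at every point, those of the graph included; |dv| dominates.\<close>
    have "(\<lambda>k. \<integral>x. ramp (\<psi> x / \<epsilon> k) * dv x \<partial>lborel) \<longlonglongrightarrow> (\<integral>x. indicator {x. \<gamma> x < x \<bullet> n} x * dv x \<partial>lborel)"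
    proof (rule integral_dominated_convergence[where w = "\<lambda>x. norm (dv x)"])
      show "AE x in lborel. (\<lambda>k. ramp (\<psi> x / \<epsilon> k) * dv x) \<longlonglongrightarrow> indicator {x. \<gamma> x < x \<bullet> n} x * dv x"
      proof (intro AE_I2 tendsto_mult tendsto_const)
        fix x
        show "(\<lambda>k. ramp (\<psi> x / \<epsilon> k)) \<longlonglongrightarrow> indicator {x. \<gamma> x < x \<bullet> n} x"
        proof (cases "\<gamma> x < x \<bullet> n")
          case True
          then have "\<psi> x > 0" by (simp add: \<psi>_def)
          then have "\<forall>\<^sub>F k in sequentially. \<epsilon> k < \<psi> x" using \<epsilon>0 order_tendstoD(2) by blast
          then have "\<forall>\<^sub>F k in sequentially. ramp (\<psi> x / \<epsilon> k) = 1"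
            by eventually_elim (use \<epsilon> in \<open>simp add: ramp_ge_1\<close>)
          then show ?thesis using True tendsto_eventually by fastforce
        next
          case False
          then have "ramp (\<psi> x / \<epsilon> k) = 0" for k
            using \<epsilon>(1)[of k] by (intro ramp_le_0) (simp add: \<psi>_def divide_le_0_iff)
          then show ?thesis using False by simp
        qed
      qed
      show "AE x in lborel. norm (ramp (\<psi> x / \<epsilon> k) * dv x) \<le> norm (dv x)" for k
        using ramp_bounds by (auto simp: abs_mult mult_left_le_one_le)
    qed (use idiv in auto)
    then have "(\<lambda>k. ennreal (\<integral>x. ramp (\<psi> x / \<epsilon> k) * dv x \<partial>lborel)) \<longlonglongrightarrow> ennreal ?I"
      by (intro tendsto_ennrealI) (simp add: set_lebesgue_integral_def dv_def)
    then show ?thesis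
      using J[OF \<epsilon>] by (intro LIMSEQ_le_const2) auto
  qed
  let ?K = "\<integral>\<^sup>+x\<in>{x \<in> slab n. graph_proj n \<gamma> x \<in> cball x0 (\<rho> + 1)}. ennreal (graph_density \<gamma> x) \<partial>lborel"
  have K: "?K < \<infinity>" by (rule slab_area_finite) simp
  show ?thesis
  proof (rule ennreal_le_epsilon)
    fix e :: real assume e: "e > 0"
    define \<eta> where "\<eta> = e / (enn2real ?K + 1)"
    have \<eta>: "\<eta> > 0" using e by (simp add: \<eta>_def add_nonneg_pos)
    have "ennreal \<eta> * ?K = ennreal (\<eta> * enn2real ?K)"
      using K \<eta> by (subst ennreal_mult) (auto simp: ennreal_enn2real_if)
    also have "\<dots> \<le> ennreal e"
    proof (rule ennreal_leI)
      have "e / (k + 1) * k \<le> e" if "0 \<le> k" for k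
        using that e by (simp add: field_simps)
      then show "\<eta> * enn2real ?K \<le> e" by (simp add: \<eta>_def)
    qed
    finally show "ennreal ?I \<le> ?B + ennreal e"
      using bound[OF \<eta>] add_left_mono order_trans by blast
  qed
qed

end

section \<open>The divergence inequality on a domain with C^1 boundary\<close>

lemma Ck_open_Un:
  assumes "open U" "open V" "Ck_open k U g" "Ck_open k V g"
  shows "Ck_open k (U \<union> V) g"
  using assms(3,4)
proof (induction k arbitrary: g)
  case 0
  then show ?case using continuous_on_open_Un[OF assms(1,2)] by auto
qed auto

text \<open>The sets \<open>U\<close> and \<open>- K\<close> are open and cover the space; the
  extended function is \<open>g\<close> on the first and 0 on the second, so smoothness on each of
  them is enough.\<close>

lemma Ck_open_extend_zero:
  assumes "open U" "closed K" "K \<subseteq> U" "Ck_open k U g" "\<And>x. x \<in> U - K \<Longrightarrow> g x = 0"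
  shows "Ck_open k UNIV (\<lambda>x. if x \<in> U then g x else 0)"
proof -
  have "Ck_open k U (\<lambda>x. if x \<in> U then g x else 0)"
    using assms(4) by (subst Ck_open_cong[OF assms(1)]) auto
  moreover have "Ck_open k (- K) (\<lambda>x. if x \<in> U then g x else 0)"
    using assms(2,5) Ck_open_const[of k "- K" 0] by (subst Ck_open_cong[where h = "\<lambda>_. 0"]) auto
  ultimately have "Ck_open k (U \<union> - K) (\<lambda>x. if x \<in> U then g x else 0)"
    using assms(1,2) by (intro Ck_open_Un) auto
  moreover have "U \<union> - K = UNIV" using assms(3) by auto
  ultimately show ?thesis by simp
qed

text \<open>The squared distance is a polynomial, so the bump is C^1 also at its centre. The
  argument of \<open>ramp\<close> is at least 1 up to distance \<rho> / sqrt 2 and at most 0 from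
  distance \<rho> on; the plateau thus contains the ball of radius \<rho> / 2.\<close>

definition bump :: "'a::euclidean_space \<Rightarrow> real \<Rightarrow> 'a \<Rightarrow> real" where
  "bump x \<rho> y = ramp (2 - 2 * ((y - x) \<bullet> (y - x)) / \<rho>\<^sup>2)"

lemma bump_bounds: "0 \<le> bump x \<rho> y" "bump x \<rho> y \<le> 1"
  by (simp_all add: bump_def ramp_bounds)

lemma bump_outside:
  assumes "\<rho> > 0" "y \<notin> cball x \<rho>"
  shows "bump x \<rho> y = 0"
proof -
  have "\<rho> \<le> norm (y - x)" using assms by (simp add: dist_norm norm_minus_commute)
  then have "\<rho>\<^sup>2 \<le> (y - x) \<bullet> (y - x)" using assms(1) by (simp add: dot_square_norm power_mono)
  then have "1 \<le> (y - x) \<bullet> (y - x) / \<rho>\<^sup>2" using assms(1) by simp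
  then show ?thesis by (simp add: bump_def ramp_le_0)
qed

lemma bump_inside:
  assumes "\<rho> > 0" "y \<in> ball x (\<rho> / 2)"
  shows "bump x \<rho> y = 1"
proof -
  have "norm (y - x) \<le> \<rho> / 2" using assms by (simp add: dist_norm norm_minus_commute)
  then have "(norm (y - x))\<^sup>2 \<le> (\<rho> / 2)\<^sup>2" by (intro power_mono) auto
  then have "(y - x) \<bullet> (y - x) \<le> \<rho>\<^sup>2 / 4" by (simp add: dot_square_norm power_divide)
  then have "(y - x) \<bullet> (y - x) / \<rho>\<^sup>2 \<le> 1/4" using assms(1) by (simp add: field_simps)
  then have "1 \<le> 2 - 2 * ((y - x) \<bullet> (y - x)) / \<rho>\<^sup>2"
    unfolding times_divide_eq_right[symmetric] by linarith
  then show ?thesis unfolding bump_def by (rule ramp_ge_1)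
qed

lemma Ck_open_bump:
  assumes "\<rho> > 0"
  shows "Ck_open 1 UNIV (bump x \<rho>)"
proof -
  let ?c = "2 / \<rho>\<^sup>2"
  have e: "bump x \<rho> = (\<lambda>y. ramp (2 - ?c * (\<Sum>b\<in>Basis. (y \<bullet> b - x \<bullet> b)\<^sup>2)))"
    by (rule ext, subst bump_def, subst euclidean_inner)
      (simp add: power2_eq_square inner_diff_left)
  show ?thesis unfolding e
    by (rule Ck_open_1_compose[where s = ramp and s' = ramp'])
      (intro open_UNIV Ck_open_diff Ck_open_mult Ck_open_sum Ck_open_power2 Ck_open_const
        Ck_open_inner has_real_derivative_ramp continuous_on_ramp')+
qed

lemma graph_chartD:
  assumes "graph_chart 1 D x0 r n \<gamma>"
  shows "graph_data n \<gamma>" "r > 0" "D \<inter> ball x0 r = {x \<in> ball x0 r. \<gamma> x < x \<bullet> n}"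
  using assms unfolding graph_chart_def graph_data_def by auto

text \<open>A point p of the graph satisfies \<gamma> p = p \<bullet> n, so it misses
  \<open>D\<close>, while p + c n with small c > 0 lies strictly above the graph and hence in
  \<open>D\<close>.\<close>

lemma graph_chart_frontier:
  assumes "open D" "graph_chart 1 D x0 r n \<gamma>" "graph_proj n \<gamma> x \<in> ball x0 r"
  shows "graph_proj n \<gamma> x \<in> frontier D"
proof -
  interpret graph_data n \<gamma> using assms(2) by (rule graph_chartD)
  note D = graph_chartD(3)[OF assms(2)]
  let ?p = "graph_proj n \<gamma> x"
  have "?p \<notin> D"
  proof
    assume "?p \<in> D"
    then have "?p \<in> D \<inter> ball x0 r" using assms(3) by simp
    then have "\<gamma> ?p < ?p \<bullet> n" unfolding D by simp
    then show False using graph_proj_inner[of x] by simp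
  qed
  moreover have "?p \<in> closure D"
    unfolding closure_approachable
  proof (intro allI impI)
    fix e :: real assume e: "e > 0"
    define c where "c = min (e / 2) ((r - dist x0 ?p) / 2)"
    have c: "0 < c" "c < e" "dist x0 ?p + c < r"
      using e assms(3) by (auto simp: c_def min_def field_simps)
    let ?y = "?p + c *\<^sub>R n"
    have d: "dist ?y ?p = c" using c norm_n by (simp add: dist_norm)
    then have "?y \<in> ball x0 r"
      using dist_triangle[of x0 ?y ?p] c by (simp add: dist_commute)
    moreover have "\<gamma> ?y < ?y \<bullet> n"
      using c(1) graph_proj_inner[of x] by (simp add: const inner_add_left n_n)
    ultimately have "?y \<in> D" using D by blast
    then show "\<exists>y\<in>D. dist y ?p < e"
      by (rule bexI[rotated]) (use d c in linarith)
  qed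
  ultimately show ?thesis using assms(1) by (simp add: frontier_def interior_open)
qed

section \<open>The surface measure: charts and finiteness\<close>

locale surface =
  fixes D :: "'a::euclidean_space set" and \<sigma> :: "'a measure"
  assumes open_D: "open D" and bounded_D: "bounded D"
    and C1_boundary: "Ck_boundary 1 D"
    and surface_measure: "is_surface_measure D \<sigma>"
begin

lemma sets_sigma [measurable_cong]: "sets \<sigma> = sets borel"
  using surface_measure by (simp add: is_surface_measure_def)

lemma space_sigma [simp]: "space \<sigma> = UNIV"
  using sets_eq_imp_space_eq[OF sets_sigma] by simp

lemma frontier_measurable [measurable]: "frontier D \<in> sets borel"
  by simp

lemma compact_frontier_D: "compact (frontier D)"
  by (rule compact_frontier_bounded[OF bounded_D])

lemma compact_closure_D: "compact (closure D)"
  using bounded_D by (simp add: compact_closure)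

lemma frontier_Int_D: "x \<in> frontier D \<Longrightarrow> x \<notin> D"
  using open_D by (simp add: frontier_def interior_open)

text \<open>The definition of the surface measure prescribes only the measure of Borel sets inside a
  chart ball. In other words, \<sigma> restricted to the chart is the image under
  \<open>graph_proj\<close> of a weighted Lebesgue measure on the slab; integrals then follow from
  the rules for images and densities.\<close>

lemma nn_integral_chart:
  assumes x0: "x0 \<in> frontier D" and chart: "graph_chart 1 D x0 r n \<gamma>"
    and [measurable]: "f \<in> borel_measurable borel"
  shows "(\<integral>\<^sup>+x\<in>frontier D \<inter> ball x0 r. f x \<partial>\<sigma>) =
    (\<integral>\<^sup>+x\<in>{x \<in> slab n. graph_proj n \<gamma> x \<in> frontier D \<inter> ball x0 r}.
      ennreal (graph_density \<gamma> x) * f (graph_proj n \<gamma> x) \<partial>lborel)"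
proof -
  interpret graph_data n \<gamma> using chart by (rule graph_chartD)
  let ?B = "frontier D \<inter> ball x0 r"
  let ?S = "{x \<in> slab n. graph_proj n \<gamma> x \<in> ?B}"
  let ?w = "\<lambda>x. ennreal (graph_density \<gamma> x) * indicator ?S x"
  have [measurable]: "?B \<in> sets borel" by simp
  have eq: "density \<sigma> (indicator ?B) = distr (density lborel ?w) borel (graph_proj n \<gamma>)"
  proof (rule measure_eqI)
    show "sets (density \<sigma> (indicator ?B)) = sets (distr (density lborel ?w) borel (graph_proj n \<gamma>))"
      by (simp add: sets_sigma)
    fix A assume "A \<in> sets (density \<sigma> (indicator ?B))"
    then have [measurable]: "A \<in> sets borel" by (simp add: sets_sigma)
    have "emeasure (density \<sigma> (indicator ?B)) A = (\<integral>\<^sup>+x. indicator ?B x * indicator A x \<partial>\<sigma>)"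
      by (rule emeasure_density) (simp_all add: sets_sigma)
    also have "\<dots> = (\<integral>\<^sup>+x. indicator (A \<inter> ?B) x \<partial>\<sigma>)"
      by (intro nn_integral_cong) (simp split: split_indicator)
    also have "\<dots> = emeasure \<sigma> (A \<inter> ?B)"
      by (rule nn_integral_indicator) (simp add: sets_sigma)
    also have "\<dots> = (\<integral>\<^sup>+x\<in>{x. 0 \<le> x \<bullet> n \<and> x \<bullet> n \<le> 1 \<and> x + (\<gamma> x - x \<bullet> n) *\<^sub>R n \<in> A \<inter> ?B}.
             ennreal (sqrt (1 + (\<Sum>b\<in>Basis. (pd b \<gamma> x)\<^sup>2))) \<partial>lborel)"
    proof -
      have A: "A \<inter> ?B \<in> sets borel" "A \<inter> ?B \<subseteq> frontier D \<inter> ball x0 r" by auto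
      show ?thesis
        using surface_measure[unfolded is_surface_measure_def, THEN conjunct2, THEN conjunct2, rule_format,
            OF conjI[OF x0 conjI[OF chart conjI[OF A]]]] .
    qed
    also have "\<dots> = (\<integral>\<^sup>+x. ?w x * indicator (graph_proj n \<gamma> -` A) x \<partial>lborel)"
      by (intro nn_integral_cong) (auto simp: graph_proj_def graph_density_def split: split_indicator)
    also have "\<dots> = emeasure (density lborel ?w) (graph_proj n \<gamma> -` A)"
      using measurable_sets[OF measurable_graph(2), of A]
      by (subst emeasure_density) simp_all
    also have "\<dots> = emeasure (distr (density lborel ?w) borel (graph_proj n \<gamma>)) A"
      by (subst emeasure_distr) simp_all
    finally show "emeasure (density \<sigma> (indicator ?B)) A
      = emeasure (distr (density lborel ?w) borel (graph_proj n \<gamma>)) A" .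
  qed
  have "(\<integral>\<^sup>+x\<in>?B. f x \<partial>\<sigma>) = (\<integral>\<^sup>+x. f x \<partial>density \<sigma> (indicator ?B))"
    by (subst nn_integral_density) (auto simp: mult.commute)
  also have "\<dots> = (\<integral>\<^sup>+x. f (graph_proj n \<gamma> x) \<partial>density lborel ?w)"
    unfolding eq by (subst nn_integral_distr) simp_all
  also have "\<dots> = (\<integral>\<^sup>+x. ?w x * f (graph_proj n \<gamma> x) \<partial>lborel)"
    by (subst nn_integral_density) simp_all
  finally show ?thesis by (simp add: mult_ac)
qed

text \<open>Finiteness comes from compactness: finitely many chart balls cover the boundary, each
  chart carries finite area, and the complement of the boundary is a null set.\<close>

lemma finite_sigma: "finite_measure \<sigma>"
proof
  have "\<exists>r>0. emeasure \<sigma> (frontier D \<inter> ball x r) < \<infinity>" if x: "x \<in> frontier D" for x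
  proof -
    obtain r n \<gamma> where chart: "graph_chart 1 D x r n \<gamma>"
      using C1_boundary x unfolding Ck_boundary_def by blast
    interpret graph_data n \<gamma> using chart by (rule graph_chartD)
    have "emeasure \<sigma> (frontier D \<inter> ball x r) = (\<integral>\<^sup>+y\<in>frontier D \<inter> ball x r. 1 \<partial>\<sigma>)"
      by (simp add: sets_sigma)
    also have "\<dots> \<le> (\<integral>\<^sup>+y\<in>{y \<in> slab n. graph_proj n \<gamma> y \<in> ball x r}. ennreal (graph_density \<gamma> y) \<partial>lborel)"
      unfolding nn_integral_chart[OF x chart borel_measurable_const]
      by (intro nn_integral_mono) (auto split: split_indicator)
    also have "\<dots> < \<infinity>" by (rule slab_area_finite) simp
    finally show ?thesis using graph_chartD(2)[OF chart] by blast
  qed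
  then obtain r where r: "\<And>x. x \<in> frontier D \<Longrightarrow> 0 < r x"
    "\<And>x. x \<in> frontier D \<Longrightarrow> emeasure \<sigma> (frontier D \<inter> ball x (r x)) < \<infinity>"
    by metis
  obtain X where X: "X \<subseteq> frontier D" "finite X" "frontier D \<subseteq> (\<Union>x\<in>X. ball x (r x))"
    using compactE_image[OF compact_frontier_D, of "frontier D" "\<lambda>x. ball x (r x)"] r(1)
    by (metis (no_types, lifting) UN_I centre_in_ball open_ball subsetI)
  have "emeasure \<sigma> (frontier D) \<le> emeasure \<sigma> (\<Union>x\<in>X. frontier D \<inter> ball x (r x))"
  proof (rule emeasure_mono)
    show "(\<Union>x\<in>X. frontier D \<inter> ball x (r x)) \<in> sets \<sigma>"
      unfolding sets_sigma by (intro sets.finite_UN X sets.Int) auto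
  qed (use X in auto)
  also have "\<dots> \<le> (\<Sum>x\<in>X. emeasure \<sigma> (frontier D \<inter> ball x (r x)))"
    using X by (intro emeasure_subadditive_finite) (auto simp: sets_sigma)
  also have "\<dots> < \<infinity>" using X r(2) by (induction X rule: infinite_finite_induct) auto
  finally have "emeasure \<sigma> (frontier D) < \<infinity>" .
  moreover have "emeasure \<sigma> (space \<sigma>) \<le> emeasure \<sigma> (frontier D) + emeasure \<sigma> (- frontier D)"
    using emeasure_subadditive[of "frontier D" \<sigma> "- frontier D"] by (simp add: sets_sigma Compl_partition)
  ultimately show "emeasure \<sigma> (space \<sigma>) \<noteq> \<infinity>"
    using surface_measure by (auto simp: is_surface_measure_def)
qed

lemma set_integrable_frontier:
  fixes f :: "'a \<Rightarrow> real"
  assumes "continuous_on (frontier D) f"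
  shows "set_integrable \<sigma> (frontier D) f"
proof -
  obtain L where L: "\<And>x. x \<in> frontier D \<Longrightarrow> \<bar>f x\<bar> \<le> L"
    using compact_imp_bounded[OF compact_continuous_image[OF assms compact_frontier_D]]
    unfolding bounded_iff by auto
  show ?thesis unfolding set_integrable_def
  proof (rule finite_measure.integrable_const_bound[OF finite_sigma])
    show "AE x in \<sigma>. norm (indicator (frontier D) x *\<^sub>R f x) \<le> \<bar>L\<bar>"
      using L by (intro AE_I2) (force split: split_indicator)
    show "(\<lambda>x. indicator (frontier D) x *\<^sub>R f x) \<in> borel_measurable \<sigma>"
      using borel_measurable_continuous_on_indicator[OF _ assms] by (simp add: measurable_cong_sets[OF sets_sigma refl])
  qed
qed

lemma set_integrable_D:
  fixes f :: "'a \<Rightarrow> real"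
  assumes "continuous_on (closure D) f"
  shows "set_integrable lborel D f"
  by (rule set_integrable_subset[of _ "closure D"])
    (use borel_integrable_compact[OF compact_closure_D assms] open_D closure_subset
      in \<open>auto simp: set_integrable_def\<close>)

text \<open>The support is small enough to see either no boundary at all, where the integral is 0,
  or a single chart, where \<open>D\<close> can be replaced by the whole region above the
  graph.\<close>

lemma divergence_local:
  fixes H :: "'a \<Rightarrow> 'a \<Rightarrow> real"
  assumes H: "\<And>b. b \<in> Basis \<Longrightarrow> Ck_open 1 UNIV (H b)"
    and supp: "\<And>b x. x \<notin> cball x0 \<rho> \<Longrightarrow> H b x = 0"
    and loc: "cball x0 \<rho> \<subseteq> D \<or> (x0 \<in> frontier D \<and> (\<exists>r n \<gamma>. graph_chart 1 D x0 r n \<gamma> \<and> \<rho> < r))"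
  shows "(LBINT x:D. \<Sum>b\<in>Basis. pd b (H b) x) \<le> (LINT x:frontier D|\<sigma>. L2_set (\<lambda>b. H b x) Basis)"
  using loc
proof
  have pd0: "pd b (H b) x = 0" if "x \<notin> cball x0 \<rho>" for b x
    by (rule pd_outside_support[OF closed_cball supp that])
  have sum0: "(\<Sum>b\<in>Basis. pd b (H b) x) = 0" if "x \<notin> cball x0 \<rho>" for x
    by (intro sum.neutral ballI pd0 that)
  have cont: "continuous_on S (\<lambda>x. L2_set (\<lambda>b. H b x) Basis)" for S
    unfolding L2_set_def using Ck_open_imp_continuous_on[OF H]
    by (intro continuous_intros) (auto intro: continuous_on_subset)
  have nonneg: "0 \<le> (LINT x:frontier D|\<sigma>. L2_set (\<lambda>b. H b x) Basis)"
    unfolding set_lebesgue_integral_def by (intro integral_nonneg_AE AE_I2) (simp add: L2_set_nonneg)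
  {
    assume "cball x0 \<rho> \<subseteq> D"
    then have "(LBINT x:D. \<Sum>b\<in>Basis. pd b (H b) x) = (\<integral>x. (\<Sum>b\<in>Basis. pd b (H b) x) \<partial>lborel)"
      unfolding set_lebesgue_integral_def using sum0
      by (intro Bochner_Integration.integral_cong) (auto simp: subset_eq split: split_indicator)
    also have "\<dots> = 0"
      using integral_pd_compact_support[OF H _ compact_cball supp]
      by (simp add: Bochner_Integration.integral_sum)
    finally show ?thesis using nonneg by simp
  }
  {
    assume "x0 \<in> frontier D \<and> (\<exists>r n \<gamma>. graph_chart 1 D x0 r n \<gamma> \<and> \<rho> < r)"
    then obtain r n \<gamma> where x0: "x0 \<in> frontier D" and chart: "graph_chart 1 D x0 r n \<gamma>" and \<rho>: "\<rho> < r"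
      by blast
    interpret graph_data n \<gamma> using chart by (rule graph_chartD)
    have sub: "cball x0 \<rho> \<subseteq> ball x0 r" using \<rho> by auto
    have "(LBINT x:D. \<Sum>b\<in>Basis. pd b (H b) x) = (LBINT x:{x. \<gamma> x < x \<bullet> n}. \<Sum>b\<in>Basis. pd b (H b) x)"
      unfolding set_lebesgue_integral_def
    proof (intro Bochner_Integration.integral_cong refl)
      fix x
      show "indicator D x *\<^sub>R (\<Sum>b\<in>Basis. pd b (H b) x)
        = indicator {x. \<gamma> x < x \<bullet> n} x *\<^sub>R (\<Sum>b\<in>Basis. pd b (H b) x)"
      proof (cases "x \<in> cball x0 \<rho>")
        case True
        then have "x \<in> ball x0 r" using sub by blast
        then have "x \<in> D \<longleftrightarrow> \<gamma> x < x \<bullet> n" using graph_chartD(3)[OF chart] by blast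
        then show ?thesis by (simp split: split_indicator)
      qed (simp add: sum0)
    qed
    then have "ennreal (LBINT x:D. \<Sum>b\<in>Basis. pd b (H b) x)
        = ennreal (LBINT x:{x. \<gamma> x < x \<bullet> n}. \<Sum>b\<in>Basis. pd b (H b) x)"
      by simp
    also have "\<dots> \<le> (\<integral>\<^sup>+x\<in>slab n. ennreal (graph_density \<gamma> x * L2_set (\<lambda>b. H b (graph_proj n \<gamma> x)) Basis) \<partial>lborel)"
      by (rule epigraph_divergence[OF H supp])
    also have "\<dots> \<le> (\<integral>\<^sup>+x\<in>{x \<in> slab n. graph_proj n \<gamma> x \<in> frontier D \<inter> ball x0 r}.
      ennreal (graph_density \<gamma> x) * ennreal (L2_set (\<lambda>b. H b (graph_proj n \<gamma> x)) Basis) \<partial>lborel)"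
    proof (rule nn_integral_mono)
      fix x
      let ?p = "graph_proj n \<gamma> x"
      show "ennreal (graph_density \<gamma> x * L2_set (\<lambda>b. H b ?p) Basis) * indicator (slab n) x
        \<le> ennreal (graph_density \<gamma> x) * ennreal (L2_set (\<lambda>b. H b ?p) Basis)
          * indicator {x \<in> slab n. graph_proj n \<gamma> x \<in> frontier D \<inter> ball x0 r} x"
      \<comment> \<open>Projected points in the chart ball lie on the boundary of \<open>D\<close>;
        at the others the field vanishes.\<close>
      proof (cases "?p \<in> ball x0 r")
        case True
        then show ?thesis
          using graph_chart_frontier[OF open_D chart True] graph_density_pos[of x]
          by (simp add: ennreal_mult L2_set_nonneg order_trans[OF zero_le_one] split: split_indicator)
      next
        case False
        then have "H b ?p = 0" for b using sub supp by blast
        then show ?thesis by (simp add: L2_set_def)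
      qed
    qed
    also have "\<dots> = (\<integral>\<^sup>+x\<in>frontier D \<inter> ball x0 r. ennreal (L2_set (\<lambda>b. H b x) Basis) \<partial>\<sigma>)"
      using cont by (intro nn_integral_chart[OF x0 chart, symmetric])
        (auto intro: borel_measurable_continuous_onI)
    also have "\<dots> \<le> (\<integral>\<^sup>+x. ennreal (indicator (frontier D) x *\<^sub>R L2_set (\<lambda>b. H b x) Basis) \<partial>\<sigma>)"
      by (intro nn_integral_mono) (auto split: split_indicator)
    also have "\<dots> = ennreal (LINT x:frontier D|\<sigma>. L2_set (\<lambda>b. H b x) Basis)"
      unfolding set_lebesgue_integral_def
      by (rule nn_integral_eq_integral)
        (use set_integrable_frontier[OF cont] in \<open>auto simp: set_integrable_def L2_set_nonneg\<close>)
    finally show ?thesis using nonneg by simp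
  }
qed

text \<open>Compactness of the closure reduces the claim to finitely many small balls inside
  \<open>U\<close>, each contained in \<open>D\<close> or in a chart ball. The cover uses half the
  radii because there the bumps are equal to 1.\<close>

lemma divergence_le_surface:
  fixes F :: "'a \<Rightarrow> 'a \<Rightarrow> real"
  assumes U: "open U" "closure D \<subseteq> U"
    and F: "\<And>b. b \<in> Basis \<Longrightarrow> Ck_open 1 U (F b)"
  shows "(LBINT x:D. \<Sum>b\<in>Basis. pd b (F b) x) \<le> (LINT x:frontier D|\<sigma>. L2_set (\<lambda>b. F b x) Basis)"
proof -
  have sub: "D \<subseteq> U" "frontier D \<subseteq> U" using U closure_subset[of D] by (auto simp: frontier_def)
  have "\<exists>\<rho>>0. cball x \<rho> \<subseteq> U \<and>
      (cball x \<rho> \<subseteq> D \<or> (x \<in> frontier D \<and> (\<exists>r n \<gamma>. graph_chart 1 D x r n \<gamma> \<and> \<rho> < r)))"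
    if x: "x \<in> closure D" for x
  proof (cases "x \<in> D")
    case True
    then obtain e where "e > 0" "cball x e \<subseteq> D" using open_D open_contains_cball by blast
    then show ?thesis using sub by blast
  next
    case False
    then have xf: "x \<in> frontier D" using x open_D by (simp add: frontier_def interior_open)
    obtain r n \<gamma> where chart: "graph_chart 1 D x r n \<gamma>"
      using C1_boundary xf unfolding Ck_boundary_def by blast
    obtain e where e: "e > 0" "cball x e \<subseteq> U" using U x open_contains_cball by blast
    have "cball x (min e (r / 2)) \<subseteq> U" using e by auto
    moreover have "min e (r / 2) > 0" "min e (r / 2) < r"
      using e graph_chartD(2)[OF chart] by auto
    ultimately show ?thesis using xf chart by blast
  qed
  then obtain \<rho> where \<rho>: "\<And>x. x \<in> closure D \<Longrightarrow> \<rho> x > 0" "\<And>x. x \<in> closure D \<Longrightarrow> cball x (\<rho> x) \<subseteq> U"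
    "\<And>x. x \<in> closure D \<Longrightarrow> cball x (\<rho> x) \<subseteq> D \<or>
      (x \<in> frontier D \<and> (\<exists>r n \<gamma>. graph_chart 1 D x r n \<gamma> \<and> \<rho> x < r))"
    by metis
  obtain X where X: "X \<subseteq> closure D" "finite X" "closure D \<subseteq> (\<Union>x\<in>X. ball x (\<rho> x / 2))"
  proof (rule compactE_image[OF compact_closure_D])
    show "closure D \<subseteq> (\<Union>x\<in>closure D. ball x (\<rho> x / 2))" using \<rho>(1) by fastforce
  qed auto
  txt \<open>Instead of a partition of unity, the bumps are peeled off one by one: F is split into \<phi> F and
    (1 - \<phi>) F, and the latter vanishes on one more ball of the cover.\<close>
  have claim: "(LBINT x:D. \<Sum>b\<in>Basis. pd b (F b) x) \<le> (LINT x:frontier D|\<sigma>. L2_set (\<lambda>b. F b x) Basis)"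
    if "finite X" "X \<subseteq> closure D" "\<And>b. b \<in> Basis \<Longrightarrow> Ck_open 1 U (F b)"
      "\<And>b y. y \<in> closure D \<Longrightarrow> y \<notin> (\<Union>x\<in>X. ball x (\<rho> x / 2)) \<Longrightarrow> F b y = 0"
    for X and F :: "'a \<Rightarrow> 'a \<Rightarrow> real"
    using that
  proof (induction X arbitrary: F rule: finite_induct)
    case empty
    have "pd b (F b) x = 0" if "x \<in> D" for b x
      using pd_cong[OF open_D that, of "F b" "\<lambda>_. 0"] empty(3) closure_subset[of D]
      by (auto simp: pd_const subset_eq)
    then have "(LBINT x:D. \<Sum>b\<in>Basis. pd b (F b) x) = (LBINT x:D. 0)"
      by (intro set_lebesgue_integral_cong) (use open_D in auto)
    also have "\<dots> \<le> (LINT x:frontier D|\<sigma>. L2_set (\<lambda>b. F b x) Basis)"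
      unfolding set_lebesgue_integral_def by (auto intro!: integral_nonneg_AE AE_I2 simp: L2_set_nonneg)
    finally show ?case .
  next
    case (insert x X)
    have x: "x \<in> closure D" using insert.prems by simp
    note \<rho>x = \<rho>[OF x]
    let ?\<phi> = "bump x (\<rho> x)"
    have \<phi>: "Ck_open 1 U ?\<phi>" using Ck_open_subset[OF Ck_open_bump[OF \<rho>x(1)]] by simp
    define G1 where "G1 b y = ?\<phi> y * F b y" for b y
    define G2 where "G2 b y = (1 - ?\<phi> y) * F b y" for b y
    \<comment> \<open>The field is controlled on \<open>U\<close> only; cut off by a bump supported
      in \<open>U\<close> and extended by 0, it becomes a field on the whole space, as the local
      version demands.\<close>
    define H where "H b y = (if y \<in> U then G1 b y else 0)" for b y
    have G1: "Ck_open 1 U (G1 b)" if "b \<in> Basis" for b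
      unfolding G1_def[abs_def] by (intro Ck_open_mult U \<phi> insert.prems that)
    have G2: "Ck_open 1 U (G2 b)" if "b \<in> Basis" for b
      unfolding G2_def[abs_def] by (intro Ck_open_mult Ck_open_diff Ck_open_const U \<phi> insert.prems that)
    have L1: "(LBINT y:D. \<Sum>b\<in>Basis. pd b (H b) y) \<le> (LINT y:frontier D|\<sigma>. L2_set (\<lambda>b. H b y) Basis)"
    proof (rule divergence_local)
      show "Ck_open 1 UNIV (H b)" if "b \<in> Basis" for b
        unfolding H_def[abs_def]
        by (rule Ck_open_extend_zero[OF U(1) closed_cball \<rho>x(2) G1[OF that]])
          (simp add: G1_def bump_outside[OF \<rho>x(1)])
      show "H b y = 0" if "y \<notin> cball x (\<rho> x)" for b y
        using bump_outside[OF \<rho>x(1) that] by (simp add: H_def G1_def)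
    qed (rule \<rho>x(3))
    have L2: "(LBINT y:D. \<Sum>b\<in>Basis. pd b (G2 b) y) \<le> (LINT y:frontier D|\<sigma>. L2_set (\<lambda>b. G2 b y) Basis)"
    proof (rule insert.IH[OF _ G2])
      show "X \<subseteq> closure D" using insert.prems by simp
      show "G2 b y = 0" if "y \<in> closure D" "y \<notin> (\<Union>x\<in>X. ball x (\<rho> x / 2))" for b y
        using insert.prems(3)[OF that(1), of b] that(2) bump_inside[OF \<rho>x(1), of y]
        by (cases "y \<in> ball x (\<rho> x / 2)") (auto simp: G2_def)
    qed
    have dF: "F b differentiable (at y)" "?\<phi> differentiable (at y)" "G1 b differentiable (at y)"
      "G2 b differentiable (at y)" if "y \<in> U" "b \<in> Basis" for b y
      using insert.prems(2)[OF that(2)] \<phi> G1 G2 that by auto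
    have split: "pd b (F b) y = pd b (H b) y + pd b (G2 b) y" if "y \<in> D" "b \<in> Basis" for b y
    proof -
      have y: "y \<in> U" using that sub by blast
      have "pd b (H b) y = pd b (G1 b) y"
        by (rule pd_cong[OF U(1) y]) (simp add: H_def)
      moreover have "pd b (F b) y = pd b (\<lambda>y. G1 b y + G2 b y) y"
        by (simp add: G1_def G2_def algebra_simps)
      ultimately show ?thesis using pd_add[OF dF(3,4)[OF y that(2)], of b] by simp
    qed
    have cU: "continuous_on S (pd b (G b))" "continuous_on S (G b)"
      if "Ck_open 1 U (G b)" "b \<in> Basis" "S \<subseteq> U" for S b and G :: "'a \<Rightarrow> 'a \<Rightarrow> real"
      using that Ck_open_imp_continuous_on[OF that(1)] by (auto intro: continuous_on_subset)
    have cH: "continuous_on S (pd b (H b))" "continuous_on S (H b)"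
      if "b \<in> Basis" "S \<subseteq> U" for S b
    proof -
      have "Ck_open 1 U (H b)"
        using G1[OF that(1)] by (subst Ck_open_cong[OF U(1)]) (auto simp: H_def)
      then show "continuous_on S (pd b (H b))" "continuous_on S (H b)" using cU that by blast+
    qed
    have "(LBINT y:D. \<Sum>b\<in>Basis. pd b (F b) y)
        = (LBINT y:D. (\<Sum>b\<in>Basis. pd b (H b) y) + (\<Sum>b\<in>Basis. pd b (G2 b) y))"
      by (intro set_lebesgue_integral_cong) (use open_D split in \<open>auto simp: sum.distrib\<close>)
    also have "\<dots> = (LBINT y:D. \<Sum>b\<in>Basis. pd b (H b) y) + (LBINT y:D. \<Sum>b\<in>Basis. pd b (G2 b) y)"
      by (intro set_integral_add set_integrable_D continuous_on_sum cH cU[of G2] G2 U)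
    also have "\<dots> \<le> (LINT y:frontier D|\<sigma>. L2_set (\<lambda>b. H b y) Basis) + (LINT y:frontier D|\<sigma>. L2_set (\<lambda>b. G2 b y) Basis)"
      by (rule add_mono[OF L1 L2])
    also have "\<dots> = (LINT y:frontier D|\<sigma>. L2_set (\<lambda>b. H b y) Basis + L2_set (\<lambda>b. G2 b y) Basis)"
      unfolding L2_set_def using sub
      by (intro set_integral_add(2)[symmetric] set_integrable_frontier continuous_intros cH cU[of G2] G2)
    \<comment> \<open>The two parts are nonnegative multiples of one vector with weights adding up
      to 1, so their lengths add up to |F|: the splitting loses nothing.\<close>
    also have "\<dots> = (LINT y:frontier D|\<sigma>. L2_set (\<lambda>b. F b y) Basis)"
    proof (intro set_lebesgue_integral_cong allI impI)
      fix y assume "y \<in> frontier D"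
      then have y: "y \<in> U" using sub by blast
      have "L2_set (\<lambda>b. H b y) Basis = ?\<phi> y * L2_set (\<lambda>b. F b y) Basis"
        using y by (simp add: H_def G1_def L2_set_right_distrib bump_bounds)
      moreover have "L2_set (\<lambda>b. G2 b y) Basis = (1 - ?\<phi> y) * L2_set (\<lambda>b. F b y) Basis"
        by (simp add: G2_def L2_set_right_distrib bump_bounds)
      ultimately show "L2_set (\<lambda>b. H b y) Basis + L2_set (\<lambda>b. G2 b y) Basis = L2_set (\<lambda>b. F b y) Basis"
        by (simp add: algebra_simps)
    qed (simp add: sets_sigma)
    finally show ?case .
  qed
  show ?thesis by (rule claim[OF X(2,1) F]) (use X(3) in auto)
qed

end

section \<open>Energy estimate on a time block\<close>

lemma set_integrable_bounded_continuous:
  fixes f :: "'a::euclidean_space \<Rightarrow> real"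
  assumes sets: "sets M = sets borel" and A: "A \<in> sets borel" "emeasure M A < \<infinity>"
    and f: "continuous_on A f" "bounded (f ` A)"
  shows "set_integrable M A f"
proof -
  obtain L where L: "\<And>x. x \<in> A \<Longrightarrow> \<bar>f x\<bar> \<le> L"
    using f(2) unfolding bounded_iff by auto
  have m: "(\<lambda>x. indicator A x *\<^sub>R f x) \<in> borel_measurable M"
    using borel_measurable_continuous_on_indicator[OF A(1) f(1)]
    by (simp add: measurable_cong_sets[OF sets refl])
  show ?thesis unfolding set_integrable_def
  proof (rule Bochner_Integration.integrable_bound[OF _ m])
    show "integrable M (\<lambda>x. L * indicator A x)"
      using A sets by (intro integrable_mult_right integrable_real_indicator) auto
    show "AE x in M. norm (indicator A x *\<^sub>R f x) \<le> norm (L * indicator A x)"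
      using L by (intro AE_I2) (force split: split_indicator)
  qed
qed

lemma set_integral_Times_swap:
  fixes f :: "'a \<times> 'b \<Rightarrow> real"
  assumes "sigma_finite_measure M" "sigma_finite_measure N"
    and f: "set_integrable (M \<Otimes>\<^sub>M N) (P \<times> Q) f"
  shows "(LINT z:P \<times> Q|M \<Otimes>\<^sub>M N. f z) = (LINT t:Q|N. LINT x:P|M. f (x, t))"
    and "(LINT z:P \<times> Q|M \<Otimes>\<^sub>M N. f z) = (LINT x:P|M. LINT t:Q|N. f (x, t))"
    and "set_integrable N Q (\<lambda>t. LINT x:P|M. f (x, t))"
    and "set_integrable M P (\<lambda>x. LINT t:Q|N. f (x, t))"
proof -
  interpret pair_sigma_finite M N using assms by (simp add: pair_sigma_finite_def)
  let ?g = "\<lambda>x t. indicator P x * indicator Q t * f (x, t)"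
  have g: "integrable (M \<Otimes>\<^sub>M N) (case_prod ?g)"
    using f by (simp add: set_integrable_def indicator_times case_prod_unfold)
  have e: "(LINT z:P \<times> Q|M \<Otimes>\<^sub>M N. f z) = integral\<^sup>L (M \<Otimes>\<^sub>M N) (case_prod ?g)"
    by (simp add: set_lebesgue_integral_def indicator_times case_prod_unfold)
  have et: "(\<integral>x. ?g x t \<partial>M) = indicator Q t *\<^sub>R (LINT x:P|M. f (x, t))" for t
    using Bochner_Integration.integral_mult_right_zero[of M "indicator Q t" "\<lambda>x. indicator P x * f (x, t)"]
    by (simp add: set_lebesgue_integral_def mult_ac)
  have ex: "(\<integral>t. ?g x t \<partial>N) = indicator P x *\<^sub>R (LINT t:Q|N. f (x, t))" for x
    using Bochner_Integration.integral_mult_right_zero[of N "indicator P x" "\<lambda>t. indicator Q t * f (x, t)"]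
    by (simp add: set_lebesgue_integral_def mult_ac)
  show "(LINT z:P \<times> Q|M \<Otimes>\<^sub>M N. f z) = (LINT t:Q|N. LINT x:P|M. f (x, t))"
    unfolding e integral_snd[OF g, symmetric] et by (simp add: set_lebesgue_integral_def)
  show "(LINT z:P \<times> Q|M \<Otimes>\<^sub>M N. f z) = (LINT x:P|M. LINT t:Q|N. f (x, t))"
    unfolding e integral_fst[OF g, symmetric] ex by (simp add: set_lebesgue_integral_def)
  show "set_integrable N Q (\<lambda>t. LINT x:P|M. f (x, t))"
    using integrable_snd[OF g] unfolding et by (simp add: set_integrable_def)
  show "set_integrable M P (\<lambda>x. LINT t:Q|N. f (x, t))"
    using integrable_fst[OF g] unfolding ex by (simp add: set_integrable_def)
qed

text \<open>Cauchy-Schwarz against the constant 1, from the nonnegative polynomial in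
  \<open>c\<close> given by the integral of (|f| - c)^2. For positive measure m its minimum is at c
  = p / m; for m = 0 it is affine in \<open>c\<close>, which forces p = 0.\<close>

lemma set_integral_abs_le_sqrt:
  fixes f :: "'a \<Rightarrow> real"
  assumes A: "A \<in> sets M" "emeasure M A < \<infinity>"
    and f: "set_integrable M A f" "set_integrable M A (\<lambda>x. (f x)\<^sup>2)"
  shows "(LINT x:A|M. \<bar>f x\<bar>) \<le> sqrt (measure M A) * sqrt (LINT x:A|M. (f x)\<^sup>2)"
proof -
  define m where "m = measure M A"
  define p where "p = (LINT x:A|M. \<bar>f x\<bar>)"
  define q where "q = (LINT x:A|M. (f x)\<^sup>2)"
  have nonneg: "0 \<le> m" "0 \<le> p" "0 \<le> q"
    unfolding m_def p_def q_def set_lebesgue_integral_def by (auto intro!: integral_nonneg_AE)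
  have c: "set_integrable M A (\<lambda>x. c::real)" for c
    using A by (simp add: set_integrable_def)
  have quad: "0 \<le> q - 2 * c * p + c\<^sup>2 * m" for c
  proof -
    have "0 \<le> (LINT x:A|M. (\<bar>f x\<bar> - c)\<^sup>2)"
      unfolding set_lebesgue_integral_def by (auto intro!: integral_nonneg_AE)
    also have "\<dots> = (LINT x:A|M. ((f x)\<^sup>2 - (2 * c) * \<bar>f x\<bar>) + c\<^sup>2)"
      by (simp add: power2_diff algebra_simps)
    also have "\<dots> = q - 2 * c * p + c\<^sup>2 * m"
      using f A c
      by (subst set_integral_add) (auto simp: q_def p_def m_def set_integral_diff set_integrable_abs
          set_integral_const mult.commute)
    finally show ?thesis .
  qed
  have "p\<^sup>2 \<le> m * q"
  proof (cases "m = 0")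
    case True
    have "p = 0"
    proof (rule ccontr)
      assume "p \<noteq> 0"
      then show False using quad[of "(q + 1) / (2 * p)"] True by simp
    qed
    then show ?thesis using nonneg by simp
  next
    case False
    then have "0 \<le> (q - 2 * (p / m) * p + (p / m)\<^sup>2 * m) * m"
      using quad[of "p / m"] nonneg by (intro mult_nonneg_nonneg) auto
    also have "\<dots> = m * q - p\<^sup>2" using False by (simp add: field_simps power2_eq_square)
    finally show ?thesis by simp
  qed
  then have "p \<le> sqrt (m * q)" using real_le_rsqrt by blast
  then show ?thesis by (simp add: m_def p_def q_def real_sqrt_mult)
qed

text \<open>\<open>E\<close> need not be differentiable, but its majorant G = A + \<integral>E is; E
  \<le> G makes exp (- (t - a)) G nonincreasing.\<close>

lemma gronwall:
  fixes E :: "real \<Rightarrow> real"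
  assumes cont: "continuous_on {a..b} E"
    and le: "\<And>t. t \<in> {a..b} \<Longrightarrow> E t \<le> A + (LBINT s:{a..t}. E s)"
    and t: "t \<in> {a..b}"
  shows "E t \<le> A * exp (t - a)"
proof -
  define G where "G t = A + integral {a..t} E" for t
  have EG: "E s \<le> G s" if "s \<in> {a..b}" for s
  proof -
    have "set_integrable lborel {a..s} E"
      by (rule borel_integrable_atLeastAtMost', rule continuous_on_subset[OF cont]) (use that in auto)
    then show ?thesis using le[OF that] set_borel_integral_eq_integral(2) by (fastforce simp: G_def)
  qed
  have dG: "(G has_real_derivative E s) (at s within {a..b})" if "s \<in> {a..b}" for s
    unfolding G_def[abs_def]
    using integral_has_real_derivative[OF cont that] by (auto intro!: derivative_eq_intros)
  let ?h = "\<lambda>s. exp (- (s - a)) * G s"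
  have "?h t \<le> ?h a"
  proof (rule DERIV_nonpos_imp_decreasing_open[of a t ?h])
    show "a \<le> t" using t by simp
    fix s assume s: "a < s" "s < t"
    then have "(G has_real_derivative E s) (at s)"
      using dG[of s] t by (simp add: at_within_Icc_at)
    then have "(?h has_real_derivative exp (- (s - a)) * (E s - G s)) (at s)"
      by (auto intro!: derivative_eq_intros simp: algebra_simps)
    moreover have "exp (- (s - a)) * (E s - G s) \<le> 0"
      using EG[of s] s t by (intro mult_nonneg_nonpos) auto
    ultimately show "\<exists>y. (?h has_real_derivative y) (at s) \<and> y \<le> 0" by blast
  next
    have "continuous_on {a..b} G" using dG DERIV_continuous_on by blast
    then have "continuous_on {a..t} G" using continuous_on_subset t by fastforce
    then show "continuous_on {a..t} ?h" by (intro continuous_intros)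
  qed
  then have "exp (- (t - a)) * G t \<le> A" by (simp add: G_def)
  then have "exp (- (t - a)) * G t / exp (- (t - a)) \<le> A / exp (- (t - a))"
    by (rule divide_right_mono) simp
  also have "A / exp (- (t - a)) = A * exp (t - a)"
    unfolding exp_minus by (simp only: divide_inverse inverse_inverse_eq)
  finally have "G t \<le> A * exp (t - a)" by simp
  then show ?thesis using EG[OF t] by simp
qed

section \<open>The energy inequality on a cylinder\<close>

locale space_time_block = surface D \<sigma> for D :: "'a::euclidean_space set" and \<sigma> +
  fixes a b :: real
  assumes ab: "a \<le> b"
begin

sublocale finite_measure \<sigma> by (rule finite_sigma)

lemma sets_sigma_lborel: "sets (\<sigma> \<Otimes>\<^sub>M lborel) = sets (borel :: ('a \<times> real) measure)"
proof -
  have "sets (\<sigma> \<Otimes>\<^sub>M (lborel :: real measure)) = sets (borel \<Otimes>\<^sub>M (borel :: real measure))"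
    by (rule sets_pair_measure_cong[OF sets_sigma sets_lborel])
  then show ?thesis by (simp only: borel_prod)
qed

lemma sets_lborel_lborel: "sets (lborel \<Otimes>\<^sub>M lborel) = sets (borel :: ('a \<times> real) measure)"
  by (simp only: lborel_prod sets_lborel)

lemma compact_block: "compact (closure D \<times> {a..b})"
  by (intro compact_Times compact_closure_D compact_Icc)

lemma set_integrable_block:
  fixes f :: "'a \<times> real \<Rightarrow> real"
  assumes "continuous_on (closure D \<times> {a..b}) f" "t \<le> b"
  shows "set_integrable (lborel \<Otimes>\<^sub>M lborel) (D \<times> {a..t}) f"
    "set_integrable (\<sigma> \<Otimes>\<^sub>M lborel) (frontier D \<times> {a..t}) f"
proof -
  have bdd: "bounded (f ` (closure D \<times> {a..b}))"
    by (intro compact_imp_bounded compact_continuous_image assms compact_block)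
  have sub: "D \<times> {a..t} \<subseteq> closure D \<times> {a..b}" "frontier D \<times> {a..t} \<subseteq> closure D \<times> {a..b}"
    using assms(2) closure_subset[of D] by (auto simp: frontier_def)
  show "set_integrable (lborel \<Otimes>\<^sub>M lborel) (D \<times> {a..t}) f"
  proof (rule set_integrable_bounded_continuous)
    show "D \<times> {a..t} \<in> sets borel" using open_D by (simp add: borel_Times)
    show "emeasure (lborel \<Otimes>\<^sub>M lborel) (D \<times> {a..t}) < \<infinity>"
      unfolding lborel_prod by (intro emeasure_bounded_finite bounded_Times bounded_D bounded_closed_interval) 
    show "sets (lborel \<Otimes>\<^sub>M lborel) = sets (borel :: ('a \<times> real) measure)"
      by (rule sets_lborel_lborel)
  qed (use continuous_on_subset[OF assms(1) sub(1)] bounded_subset[OF bdd image_mono[OF sub(1)]] in auto)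
  show "set_integrable (\<sigma> \<Otimes>\<^sub>M lborel) (frontier D \<times> {a..t}) f"
  proof (rule set_integrable_bounded_continuous)
    show "frontier D \<times> {a..t} \<in> sets borel" by (simp add: borel_Times)
    show "emeasure (\<sigma> \<Otimes>\<^sub>M lborel) (frontier D \<times> {a..t}) < \<infinity>"
      by (subst lborel.emeasure_pair_measure_Times)
        (auto simp: sets_sigma emeasure_lborel_Icc_eq ennreal_mult_eq_top_iff emeasure_finite less_top[symmetric])
    show "sets (\<sigma> \<Otimes>\<^sub>M lborel) = sets (borel :: ('a \<times> real) measure)"
      by (rule sets_sigma_lborel)
  qed (use continuous_on_subset[OF assms(1) sub(2)] bounded_subset[OF bdd image_mono[OF sub(2)]] in auto)
qed

lemma continuous_on_block_slices:
  fixes f :: "'a \<times> real \<Rightarrow> real"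
  assumes "continuous_on (closure D \<times> {a..b}) f" "t \<in> {a..b}"
  shows "continuous_on (closure D) (\<lambda>x. f (x, t))"
  by (rule continuous_on_compose2[OF assms(1)]) (use assms(2) in \<open>auto intro!: continuous_intros\<close>)

text \<open>A continuous function on the compact cylinder is bounded and \<open>D\<close> has finite
  measure, so one constant dominates along every sequence of times.\<close>

lemma continuous_on_integral_D:
  fixes f :: "'a \<times> real \<Rightarrow> real"
  assumes f: "continuous_on (closure D \<times> {a..b}) f"
  shows "continuous_on {a..b} (\<lambda>t. LBINT x:D. f (x, t))"
proof (unfold continuous_on_sequentially, intro allI ballI impI, elim conjE)
  fix x :: "nat \<Rightarrow> real" and t
  assume t: "t \<in> {a..b}" and xn: "\<forall>n. x n \<in> {a..b}" and lim: "x \<longlonglongrightarrow> t"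
  obtain L where L: "\<And>z. z \<in> closure D \<times> {a..b} \<Longrightarrow> \<bar>f z\<bar> \<le> L"
    using compact_imp_bounded[OF compact_continuous_image[OF f compact_block]]
    unfolding bounded_iff by auto
  have int: "set_integrable lborel D (\<lambda>x. f (x, s))" if "s \<in> {a..b}" for s
    by (intro set_integrable_D continuous_on_block_slices f that)
  show "((\<lambda>t. LBINT x:D. f (x, t)) \<circ> x) \<longlonglongrightarrow> (LBINT x:D. f (x, t))"
    unfolding set_lebesgue_integral_def comp_def
  proof (rule integral_dominated_convergence[where w = "\<lambda>y. L * indicator D y"])
    show "integrable lborel (\<lambda>y. L * indicator D y)"
      using open_D emeasure_bounded_finite[OF bounded_D]
      by (intro integrable_mult_right integrable_real_indicator) auto
    show "AE y in lborel. (\<lambda>n. indicator D y *\<^sub>R f (y, x n)) \<longlonglongrightarrow> indicator D y *\<^sub>R f (y, t)"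
    proof (intro AE_I2)
      fix y
      show "(\<lambda>n. indicator D y *\<^sub>R f (y, x n)) \<longlonglongrightarrow> indicator D y *\<^sub>R f (y, t)"
      proof (cases "y \<in> D")
        case True
        then have y: "y \<in> closure D" using closure_subset by blast
        have "(\<lambda>n. f (y, x n)) \<longlonglongrightarrow> f (y, t)"
          by (rule continuous_on_tendsto_compose[OF f])
            (use y xn t lim in \<open>auto intro!: tendsto_intros always_eventually\<close>)
        then show ?thesis using True by simp
      qed simp
    qed
    show "AE y in lborel. norm (indicator D y *\<^sub>R f (y, x n)) \<le> L * indicator D y" for n
      using L xn closure_subset[of D] by (intro AE_I2) (auto split: split_indicator)
    show "(\<lambda>y. indicator D y *\<^sub>R f (y, t)) \<in> borel_measurable lborel"
      "(\<lambda>y. indicator D y *\<^sub>R f (y, x n)) \<in> borel_measurable lborel" for n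
      using int t xn unfolding set_integrable_def by auto
  qed
qed

text \<open>The left side is the time derivative of the energy, stated as an integral so that
  nothing is differentiated under the integral sign. The bound \<open>M\<close> on the spatial
  gradient at the boundary makes the flux |v \<nabla>v| linear in |v|.\<close>

lemma energy_rate:
  fixes v :: "'a \<times> real \<Rightarrow> real"
  assumes U: "open U" "closure D \<times> {a..b} \<subseteq> U" and v: "Ck_open 2 U v" and t: "t \<in> {a..b}"
    and M: "\<And>x. x \<in> frontier D \<Longrightarrow> L2_set (\<lambda>b. pd (b, 0) v (x, t)) Basis \<le> M"
    and R: "continuous_on (closure D \<times> {a..b}) R"
      "\<And>x. x \<in> D \<Longrightarrow> R (x, t) = pd (0, 1) v (x, t) - (\<Sum>b\<in>Basis. pd (b, 0) (pd (b, 0) v) (x, t))"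
  shows "(LBINT x:D. 2 * v (x, t) * pd (0, 1) v (x, t))
    \<le> (LBINT x:D. (R (x, t))\<^sup>2) + (LBINT x:D. (v (x, t))\<^sup>2) + 2 * M * (LINT x:frontier D|\<sigma>. \<bar>v (x, t)\<bar>)"
proof -
  let ?U = "{x. (x, t) \<in> U}"
  have U': "open ?U" "closure D \<subseteq> ?U" "D \<subseteq> ?U" "frontier D \<subseteq> ?U"
    using open_slice[OF U(1)] U(2) t closure_subset[of D] by (auto simp: frontier_def)
  have Basis: "(b, 0) \<in> Basis" if "b \<in> Basis" for b :: 'a using that by (simp add: Basis_prod_def)
  have v1: "Ck_open 1 U v" using Ck_open_le[OF v, of 1] by simp
  have v2: "Ck_open 1 U (pd (b, 0) v)" if "b \<in> Basis" for b
    using Ck_open_pd[OF v[unfolded Suc_1[symmetric]] Basis[OF that]] .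
  have vs: "Ck_open 1 ?U (\<lambda>x. v (x, t))" by (rule Ck_open_slice[OF U(1) v1])
  have vs2: "Ck_open 1 ?U (\<lambda>x. pd (b, 0) v (x, t))" if "b \<in> Basis" for b
    by (rule Ck_open_slice[OF U(1) v2[OF that]])
  have diff: "v differentiable (at z)" "b \<in> Basis \<Longrightarrow> pd (b, 0) v differentiable (at z)" if "z \<in> U" for z b
    using v1 v2 that by auto
  let ?F = "\<lambda>b x. v (x, t) * pd (b, 0) v (x, t)"
  have F: "Ck_open 1 ?U (?F b)" if "b \<in> Basis" for b
    by (intro Ck_open_mult U' vs vs2 that)
  have pdF: "pd b (?F b) x = v (x, t) * pd (b, 0) (pd (b, 0) v) (x, t) + (pd (b, 0) v (x, t))\<^sup>2"
    if "x \<in> ?U" "b \<in> Basis" for b x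
  proof -
    have "pd b (?F b) x = v (x, t) * pd b (\<lambda>x. pd (b, 0) v (x, t)) x + pd b (\<lambda>x. v (x, t)) x * pd (b, 0) v (x, t)"
      using vs vs2[OF that(2)] that(1) by (intro pd_mult) auto
    then show ?thesis using diff that by (simp add: pd_slice power2_eq_square)
  qed
  have cv: "continuous_on (closure D) (\<lambda>x. v (x, t))"
    using Ck_open_imp_continuous_on[OF vs] U'(2) by (rule continuous_on_subset)
  have cD: "continuous_on (closure D) (\<lambda>x. pd (b, 0) v (x, t))"
    "continuous_on (closure D) (\<lambda>x. pd (b, 0) (pd (b, 0) v) (x, t))"
    if "b \<in> Basis" for b
  proof -
    show "continuous_on (closure D) (\<lambda>x. pd (b, 0) v (x, t))"
      using Ck_open_imp_continuous_on[OF vs2[OF that]] U'(2) by (rule continuous_on_subset)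
    have "continuous_on U (pd (b, 0) (pd (b, 0) v))" using v2[OF that] Basis[OF that] by auto
    then show "continuous_on (closure D) (\<lambda>x. pd (b, 0) (pd (b, 0) v) (x, t))"
      by (rule continuous_on_compose2) (use U'(2) in \<open>auto intro!: continuous_intros\<close>)
  qed
  have cR: "continuous_on (closure D) (\<lambda>x. R (x, t))" by (rule continuous_on_block_slices[OF R(1) t])
  have sub: "frontier D \<subseteq> closure D" by (simp add: frontier_def)
  define dv where "dv x = (\<Sum>b\<in>Basis. pd b (?F b) x)" for x
  have idiv: "set_integrable lborel D dv"
  proof -
    have "set_integrable lborel D (\<lambda>x. \<Sum>b\<in>Basis. v (x, t) * pd (b, 0) (pd (b, 0) v) (x, t) + (pd (b, 0) v (x, t))\<^sup>2)"
      by (intro set_integrable_D continuous_intros cv cD)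
    then show ?thesis
      by (rule set_integrable_cong[THEN iffD1, rotated -1])
        (use U' pdF in \<open>auto simp: dv_def subset_eq\<close>)
  qed
  have "(LBINT x:D. dv x) \<le> (LINT x:frontier D|\<sigma>. L2_set (\<lambda>b. ?F b x) Basis)"
    unfolding dv_def by (rule divergence_le_surface[OF U'(1,2) F])
  also have "\<dots> \<le> (LINT x:frontier D|\<sigma>. M * \<bar>v (x, t)\<bar>)"
  proof (rule set_integral_mono)
    show "set_integrable \<sigma> (frontier D) (\<lambda>x. L2_set (\<lambda>b. ?F b x) Basis)"
      unfolding L2_set_def
      by (intro set_integrable_frontier continuous_intros continuous_on_subset[OF cv sub]
          continuous_on_subset[OF cD(1) sub])
    show "set_integrable \<sigma> (frontier D) (\<lambda>x. M * \<bar>v (x, t)\<bar>)"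
      by (intro set_integrable_frontier continuous_intros continuous_on_subset[OF cv sub])
    fix x assume x: "x \<in> frontier D"
    have "L2_set (\<lambda>b. ?F b x) Basis = sqrt ((v (x, t))\<^sup>2 * (\<Sum>b\<in>Basis. (pd (b, 0) v (x, t))\<^sup>2))"
      by (simp add: L2_set_def power_mult_distrib sum_distrib_left)
    also have "\<dots> = \<bar>v (x, t)\<bar> * L2_set (\<lambda>b. pd (b, 0) v (x, t)) Basis"
      by (simp add: L2_set_def real_sqrt_mult)
    also have "\<dots> \<le> \<bar>v (x, t)\<bar> * M" by (intro mult_left_mono M x) simp
    finally show "L2_set (\<lambda>b. ?F b x) Basis \<le> M * \<bar>v (x, t)\<bar>" by (simp add: mult.commute)
  qed
  finally have div_le: "(LBINT x:D. dv x) \<le> M * (LINT x:frontier D|\<sigma>. \<bar>v (x, t)\<bar>)" by simp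
  have "continuous_on (closure D) (\<lambda>x. pd (0, 1) v (x, t))"
  proof -
    have "continuous_on U (pd (0, 1) v)"
      using v Ck_open_le[OF v, of 1] by (simp add: Basis_prod_def)
    then show ?thesis
      by (rule continuous_on_compose2) (use U'(2) in \<open>auto intro!: continuous_intros\<close>)
  qed
  note c = this cv cR
  have "(LBINT x:D. 2 * v (x, t) * pd (0, 1) v (x, t))
    \<le> (LBINT x:D. ((R (x, t))\<^sup>2 + (v (x, t))\<^sup>2) + 2 * dv x)"
  proof (rule set_integral_mono)
    show "set_integrable lborel D (\<lambda>x. 2 * v (x, t) * pd (0, 1) v (x, t))"
      by (intro set_integrable_D continuous_intros c)
    show "set_integrable lborel D (\<lambda>x. ((R (x, t))\<^sup>2 + (v (x, t))\<^sup>2) + 2 * dv x)"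
      by (intro set_integral_add(1) set_integrable_mult_right idiv set_integrable_D continuous_intros c)
    fix x assume x: "x \<in> D"
    let ?L = "\<Sum>b\<in>Basis. pd (b, 0) (pd (b, 0) v) (x, t)"
    have "dv x = v (x, t) * ?L + (\<Sum>b\<in>Basis. (pd (b, 0) v (x, t))\<^sup>2)"
      using x U'(3) by (simp add: dv_def pdF subset_eq sum.distrib sum_distrib_left)
    \<comment> \<open>div (v \<nabla>v) = v \<Delta>v + |\<nabla>v|^2, and the squared gradient is
      dropped by its sign.\<close>
    then have "v (x, t) * ?L \<le> dv x" by (simp add: sum_nonneg)
    moreover have "2 * v (x, t) * R (x, t) \<le> (R (x, t))\<^sup>2 + (v (x, t))\<^sup>2"
      using sum_squares_bound[of "v (x, t)" "R (x, t)"] by simp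
    moreover have "2 * v (x, t) * pd (0, 1) v (x, t) = 2 * v (x, t) * R (x, t) + 2 * (v (x, t) * ?L)"
      by (simp add: R(2)[OF x] algebra_simps)
    ultimately show "2 * v (x, t) * pd (0, 1) v (x, t) \<le> ((R (x, t))\<^sup>2 + (v (x, t))\<^sup>2) + 2 * dv x"
      by linarith
  qed
  also have "\<dots> = (LBINT x:D. (R (x, t))\<^sup>2) + (LBINT x:D. (v (x, t))\<^sup>2) + 2 * (LBINT x:D. dv x)"
    using set_integral_add set_integrable_mult_right[of 2] idiv
      set_integrable_D[OF continuous_on_power[OF cR, of 2]]
      set_integrable_D[OF continuous_on_power[OF cv, of 2]] by simp
  finally show ?thesis using div_le by simp
qed

lemma energy_estimate:
  fixes v :: "'a \<times> real \<Rightarrow> real"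
  assumes U: "open U" "closure D \<times> {a..b} \<subseteq> U" and v: "Ck_open 2 U v" and \<tau>: "\<tau> \<in> {a..b}"
    and M: "\<And>z. z \<in> frontier D \<times> {a..b} \<Longrightarrow> L2_set (\<lambda>b. pd (b, 0) v z) Basis \<le> M" "0 \<le> M"
    and R: "continuous_on (closure D \<times> {a..b}) R"
      "\<And>x t. x \<in> D \<Longrightarrow> t \<in> {a..b} \<Longrightarrow>
        R (x, t) = pd (0, 1) v (x, t) - (\<Sum>b\<in>Basis. pd (b, 0) (pd (b, 0) v) (x, t))"
  shows "(LBINT x:D. (v (x, \<tau>))\<^sup>2) \<le> ((LBINT x:D. (v (x, a))\<^sup>2) + (LBINT z:D \<times> {a..b}. (R z)\<^sup>2)
    + 2 * M * (LINT z:frontier D \<times> {a..b}|\<sigma> \<Otimes>\<^sub>M lborel. \<bar>v z\<bar>)) * exp (b - a)"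
proof -
  define E where "E t = (LBINT x:D. (v (x, t))\<^sup>2)" for t
  define r where "r t = (LBINT x:D. (R (x, t))\<^sup>2)" for t
  define s where "s t = (LINT x:frontier D|\<sigma>. \<bar>v (x, t)\<bar>)" for t
  define g where "g t = (LBINT x:D. 2 * v (x, t) * pd (0, 1) v (x, t))" for t
  define A where "A = E a + (LBINT z:D \<times> {a..b}. (R z)\<^sup>2)
    + 2 * M * (LINT z:frontier D \<times> {a..b}|\<sigma> \<Otimes>\<^sub>M lborel. \<bar>v z\<bar>)"
  have sf: "sigma_finite_measure (lborel :: 'a measure)" "sigma_finite_measure (lborel :: real measure)"
    "sigma_finite_measure \<sigma>"
    by (auto intro: sigma_finite_lborel sigma_finite_measure_axioms)
  have cv: "continuous_on (closure D \<times> {a..b}) v"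
    using Ck_open_imp_continuous_on[OF v] U(2) continuous_on_subset by blast
  have vt: "continuous_on U (pd (0, 1) v)"
    using v Ck_open_le[OF v, of 1] by (simp add: Basis_prod_def)
  then have cvt: "continuous_on (closure D \<times> {a..b}) (pd (0, 1) v)"
    using U(2) continuous_on_subset by blast
  have nonneg: "0 \<le> r t" "0 \<le> s t" "0 \<le> E t" for t
    unfolding r_def s_def E_def set_lebesgue_integral_def by (auto intro!: integral_nonneg_AE)
  \<comment> \<open>The fundamental theorem in time at each fixed x, followed by Fubini: the energy
    identity in integrated form.\<close>
  have split: "E t = E a + (LBINT u:{a..t}. g u)" if t: "t \<in> {a..b}" for t
  proof -
    have i: "set_integrable (lborel \<Otimes>\<^sub>M lborel) (D \<times> {a..t}) (\<lambda>z. 2 * v z * pd (0, 1) v z)"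
      using t by (intro set_integrable_block continuous_intros cv cvt) simp
    have ftc: "(LBINT u:{a..t}. 2 * v (x, u) * pd (0, 1) v (x, u)) = (v (x, t))\<^sup>2 - (v (x, a))\<^sup>2"
      if x: "x \<in> D" for x
    proof -
      have xU: "(x, u) \<in> U" if "a \<le> u" "u \<le> t" for u
        using U(2) x that t closure_subset[of D] by auto
      have "(\<integral>u. (2 * v (x, u) * pd (0, 1) v (x, u)) * indicator {a..t} u \<partial>lborel) = (v (x, t))\<^sup>2 - (v (x, a))\<^sup>2"
      proof (rule integral_FTC_Icc_real)
        show "a \<le> t" using t by simp
        fix u assume u: "a \<le> u" "u \<le> t"
        have dv: "v differentiable (at (x, u))"
          using v xU[OF u] by (simp add: numeral_2_eq_2)
        have "((\<lambda>h. v ((x, u) + h *\<^sub>R (0, 1))) has_real_derivative pd (0, 1) v (x, u)) (at 0)"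
          using has_real_derivative_along_line[of v "(x, u)" 0 "(0, 1)"] dv by simp
        then have "((\<lambda>h. v (x, u + h)) has_real_derivative pd (0, 1) v (x, u)) (at 0)" by simp
        then have d: "((\<lambda>u. v (x, u)) has_real_derivative pd (0, 1) v (x, u)) (at u)"
          using DERIV_at_within_shift[of "\<lambda>u. v (x, u)" "pd (0, 1) v (x, u)" u 0 UNIV] by simp
        then show "((\<lambda>u. (v (x, u))\<^sup>2) has_real_derivative 2 * v (x, u) * pd (0, 1) v (x, u)) (at u)"
          by (auto intro!: derivative_eq_intros)
        have "isCont (pd (0, 1) v) (x, u)"
          using vt U(1) xU[OF u] by (simp add: continuous_on_eq_continuous_at)
        moreover have "isCont (\<lambda>u. (x, u)) u"
          by (intro continuous_Pair continuous_const continuous_ident)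
        ultimately have "isCont (\<lambda>u. pd (0, 1) v (x, u)) u"
          using isCont_o2[of u "\<lambda>u. (x, u)" "pd (0, 1) v"] by simp
        then show "isCont (\<lambda>u. 2 * v (x, u) * pd (0, 1) v (x, u)) u"
          using DERIV_isCont[OF d] by (intro continuous_intros)
      qed
      then show ?thesis by (simp add: set_lebesgue_integral_def mult_ac)
    qed
    have c: "set_integrable lborel D (\<lambda>x. (v (x, u))\<^sup>2)" if "u \<in> {a..b}" for u
      by (intro set_integrable_D continuous_intros continuous_on_block_slices[OF cv that])
    have "(LBINT u:{a..t}. g u) = (LBINT x:D. LBINT u:{a..t}. 2 * v (x, u) * pd (0, 1) v (x, u))"
      unfolding g_def using set_integral_Times_swap(1,2)[OF sf(1,2) i] by simp
    also have "\<dots> = (LBINT x:D. (v (x, t))\<^sup>2 - (v (x, a))\<^sup>2)"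
      by (intro set_lebesgue_integral_cong) (use open_D ftc in auto)
    also have "\<dots> = E t - E a"
      unfolding E_def using c[OF t] c[of a] ab by (intro set_integral_diff) auto
    finally show ?thesis by simp
  qed
  have ig: "set_integrable lborel {a..t} g" if "t \<le> b" for t
    unfolding g_def using that
    by (intro set_integral_Times_swap(3)[OF sf(1,2), where P = D and f = "\<lambda>z. 2 * v z * pd (0, 1) v z"]
        set_integrable_block continuous_intros cv cvt)
  have ir: "set_integrable lborel {a..t} r" if "t \<le> b" for t
    unfolding r_def using that
    by (intro set_integral_Times_swap(3)[OF sf(1,2), where P = D and f = "\<lambda>z. (R z)\<^sup>2"]
        set_integrable_block continuous_intros R(1))
  have iss: "set_integrable lborel {a..t} s" if "t \<le> b" for t
    unfolding s_def using that
    by (intro set_integral_Times_swap(3)[OF sf(3,2), where P = "frontier D" and f = "\<lambda>z. \<bar>v z\<bar>"]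
        set_integrable_block continuous_intros cv)
  have cE: "continuous_on {a..b} E"
    unfolding E_def[abs_def] by (intro continuous_on_integral_D[of "\<lambda>z. (v z)\<^sup>2"] continuous_intros cv)
  have r_eq: "(LBINT t:{a..b}. r t) = (LBINT z:D \<times> {a..b}. (R z)\<^sup>2)"
    unfolding r_def
    using set_integral_Times_swap(1)[OF sf(1,2) set_integrable_block(1)[of "\<lambda>z. (R z)\<^sup>2" b]] R(1)
    by (simp add: lborel_prod continuous_on_power)
  have s_eq: "(LBINT t:{a..b}. s t) = (LINT z:frontier D \<times> {a..b}|\<sigma> \<Otimes>\<^sub>M lborel. \<bar>v z\<bar>)"
    unfolding s_def
    using set_integral_Times_swap(1)[OF sf(3,2) set_integrable_block(2)[of "\<lambda>z. \<bar>v z\<bar>" b]] cv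
    by (simp add: continuous_on_rabs)
  \<comment> \<open>Source and boundary terms are nonnegative, so their integrals over {a..t} may be
    extended to {a..b}. This makes \<open>A\<close> independent of t, as Gronwall's inequality
    requires.\<close>
  have mono: "(LBINT u:{a..t}. h u) \<le> (LBINT u:{a..b}. h u)"
    if "set_integrable lborel {a..b} h" "\<And>u. 0 \<le> h u" "t \<in> {a..b}" for h :: "real \<Rightarrow> real" and t
    unfolding set_lebesgue_integral_def
    using that set_integrable_subset[OF that(1), of "{a..t}"]
    by (intro integral_mono) (auto simp: set_integrable_def split: split_indicator)
  have le: "E t \<le> A + (LBINT u:{a..t}. E u)" if t: "t \<in> {a..b}" for t
  proof -
    have iE: "set_integrable lborel {a..t} E"
      using continuous_on_subset[OF cE, of "{a..t}"] t by (intro borel_integrable_atLeastAtMost') auto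
    have "(LBINT u:{a..t}. g u) \<le> (LBINT u:{a..t}. (r u + E u) + 2 * M * s u)"
    proof (rule set_integral_mono)
      show "set_integrable lborel {a..t} g" using ig t by simp
      show "set_integrable lborel {a..t} (\<lambda>u. (r u + E u) + 2 * M * s u)"
        using ir iE iss t by (intro set_integral_add(1) set_integrable_mult_right) auto
      fix u assume "u \<in> {a..t}"
      then have u: "u \<in> {a..b}" using t by simp
      show "g u \<le> (r u + E u) + 2 * M * s u"
        unfolding g_def r_def E_def s_def using u M R
        by (intro energy_rate[OF U v u]) auto
    qed
    also have "\<dots> = (LBINT u:{a..t}. r u) + (LBINT u:{a..t}. E u) + 2 * M * (LBINT u:{a..t}. s u)"
      using ir iE iss t by (simp add: set_integral_add set_integrable_mult_right)
    also have "\<dots> \<le> (LBINT u:{a..b}. r u) + (LBINT u:{a..t}. E u) + 2 * M * (LBINT u:{a..b}. s u)"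
      using ir[of b] iss[of b] nonneg t M(2) by (intro add_mono mult_left_mono mono) auto
    finally show ?thesis unfolding split[OF t] A_def r_eq s_eq by simp
  qed
  \<comment> \<open>Nonnegativity is what allows exp (\<tau> - a) to be replaced by exp (b -
    a).\<close>
  have A: "0 \<le> A"
    unfolding A_def using nonneg M(2)
    by (intro add_nonneg_nonneg mult_nonneg_nonneg)
      (auto simp: set_lebesgue_integral_def intro!: integral_nonneg_AE)
  have "E \<tau> \<le> A * exp (\<tau> - a)" by (rule gronwall[OF cE le \<tau>])
  also have "\<dots> \<le> A * exp (b - a)" using A \<tau> by (intro mult_left_mono) auto
  finally show ?thesis unfolding E_def A_def .
qed

end

section \<open>Error of the networks\<close>

lemma pd_diff: "g differentiable (at x) \<Longrightarrow> h differentiable (at x) \<Longrightarrow>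
    pd b (\<lambda>x. g x - h x) x = pd b g x - pd b h x"
  by (rule pd_eq) (intro has_derivative_diff has_derivative_pd)

lemma Ck_uptoI:
  assumes "open U" "closure S \<subseteq> U" "Ck_open k U h" "\<And>z. z \<in> S \<Longrightarrow> g z = h z"
  shows "Ck_upto k S g"
  using assms unfolding Ck_upto_def by blast

text \<open>\<open>C1_norm\<close> reads boundary derivatives of \<open>g\<close> as limits from
  \<open>G\<close>. Inside \<open>G\<close> they coincide with those of the C^1 extension
  \<open>h\<close>, which are continuous at the boundary, so the limits are the derivatives of
  \<open>h\<close>.\<close>

lemma sum_pd_le_C1_norm:
  fixes g h :: "'a::euclidean_space \<Rightarrow> real"
  assumes "open G" "bounded G" "S \<subseteq> closure G - G"
    and U: "open U" "closure G \<subseteq> U" "Ck_open 1 U h"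
    and gh: "\<And>z. z \<in> closure G \<Longrightarrow> g z = h z" and z: "z \<in> S"
  shows "(\<Sum>b\<in>Basis. \<bar>pd b h z\<bar>) \<le> C1_norm G S g"
proof -
  have comp: "compact (closure G)" using assms(2) by (simp add: compact_closure)
  have cont: "continuous_on U (pd b h)" if "b \<in> Basis" for b
    using U(3) that by simp
  have bdd: "bdd_above ((\<lambda>z. \<bar>k z\<bar>) ` S)" if "continuous_on U k" for k :: "'a \<Rightarrow> real"
  proof -
    have "bounded ((\<lambda>z. \<bar>k z\<bar>) ` closure G)"
      by (intro compact_imp_bounded compact_continuous_image comp continuous_intros
          continuous_on_subset[OF that U(2)])
    then show ?thesis
      using assms(3) by (intro bounded_imp_bdd_above) (auto intro: bounded_subset)
  qed
  have lim: "Lim (at z within G) (pd b g) = pd b h z" if "b \<in> Basis" "z \<in> S" for b z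
  proof (rule tendsto_Lim)
    have zG: "z \<in> closure G" "z \<notin> G" using assms(3) that by auto
    then show "\<not> trivial_limit (at z within G)"
      by (simp add: trivial_limit_within islimpt_in_closure)
    have "isCont (pd b h) z"
      using cont[OF that(1)] U zG by (auto simp: continuous_on_eq_continuous_at)
    then have "(pd b h \<longlongrightarrow> pd b h z) (at z within G)"
      by (simp add: continuous_at_imp_continuous_at_within continuous_within[symmetric])
    moreover have "\<forall>\<^sub>F y in at z within G. pd b h y = pd b g y"
      unfolding eventually_at_filter
      using gh closure_subset[of G]
      by (intro always_eventually allI impI pd_cong[OF assms(1)]) auto
    ultimately show "(pd b g \<longlongrightarrow> pd b h z) (at z within G)"
      by (rule Lim_transform_eventually)
  qed
  have "0 \<le> \<bar>g z\<bar>" by simp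
  also have "\<dots> \<le> (SUP z\<in>S. \<bar>g z\<bar>)"
  proof (rule cSUP_upper[OF z])
    have "(\<lambda>z. \<bar>g z\<bar>) ` S = (\<lambda>z. \<bar>h z\<bar>) ` S" using gh assms(3) by (intro image_cong) auto
    then show "bdd_above ((\<lambda>z. \<bar>g z\<bar>) ` S)"
      using bdd[OF Ck_open_imp_continuous_on[OF U(3)]] by simp
  qed
  finally have "0 \<le> (SUP z\<in>S. \<bar>g z\<bar>)" .
  moreover have "(\<Sum>b\<in>Basis. \<bar>pd b h z\<bar>) \<le> (\<Sum>b\<in>Basis. SUP z\<in>S. \<bar>Lim (at z within G) (pd b g)\<bar>)"
  proof (rule sum_mono)
    fix b :: 'a assume b: "b \<in> Basis"
    have "(SUP z\<in>S. \<bar>Lim (at z within G) (pd b g)\<bar>) = (SUP z\<in>S. \<bar>pd b h z\<bar>)"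
      using lim[OF b] by (intro SUP_cong) auto
    moreover have "\<bar>pd b h z\<bar> \<le> (SUP z\<in>S. \<bar>pd b h z\<bar>)"
      by (rule cSUP_upper[OF z bdd[OF cont[OF b]]])
    ultimately show "\<bar>pd b h z\<bar> \<le> (SUP z\<in>S. \<bar>Lim (at z within G) (pd b g)\<bar>)" by simp
  qed
  ultimately show ?thesis by (simp add: C1_norm_def)
qed

lemma sum_Basis_slice_le:
  fixes c :: "'a::euclidean_space \<times> real \<Rightarrow> real"
  assumes "\<And>b. 0 \<le> c b"
  shows "(\<Sum>b\<in>Basis. c (b, 0)) \<le> (\<Sum>b\<in>Basis. c b)"
proof -
  have "(\<Sum>b\<in>Basis. c (b, 0)) = (\<Sum>b\<in>(\<lambda>b. (b, 0)) ` Basis. c b)"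
    by (subst sum.reindex) (auto intro: inj_onI)
  also have "\<dots> \<le> (\<Sum>b\<in>Basis. c b)"
    using assms by (intro sum_mono2) (auto simp: Basis_prod_def)
  finally show ?thesis .
qed

text \<open>The situation on the blocks 1 to i, with \<open>h\<close> and \<open>U\<close> a fixed
  C^4 extension of \<open>u\<close> beyond the closed cylinder up to time i \<Delta>t. The bound by
  \<open>T\<close> places this cylinder inside the time span of the heat problem.\<close>

locale heat_setup = surface D \<sigma>
  for D :: "(real^'d) set" and \<sigma> +
  fixes T \<Delta>t :: real and f uin ud u and i :: nat and \<theta> and S :: "nat \<Rightarrow> 'd training_set" and U h
  assumes D_nonempty: "D \<noteq> {}"
    and time: "0 < \<Delta>t" "real i * \<Delta>t \<le> T"
    and heat: "heat_solution D T f uin ud u"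
    and ext: "open U" "closure D \<times> {0..real i * \<Delta>t} \<subseteq> U" "Ck_open 4 U h"
      "\<And>z. z \<in> closure D \<times> {0..real i * \<Delta>t} \<Longrightarrow> u z = h z"
    and nets: "\<And>j. j \<in> {1..i} \<Longrightarrow> is_HLConcPINN (CARD('d) + 1) (\<theta> j)"
    and rules: "\<And>j. j \<in> {1..i} \<Longrightarrow> is_training_set D \<sigma> \<Delta>t j (S j)"
begin

abbreviation "t0 j \<equiv> real (j - 1) * \<Delta>t"
abbreviation "t1 j \<equiv> real j * \<Delta>t"

lemma t01:
  assumes "j \<in> {1..i}"
  shows "0 \<le> t0 j" "t0 j \<le> t1 j" "t1 j \<le> real i * \<Delta>t" "t1 j - t0 j = \<Delta>t" "0 < t1 j"
  using assms time by (auto simp: of_nat_diff algebra_simps)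

lemma ext_block: "j \<in> {1..i} \<Longrightarrow> closure D \<times> {0..t1 j} \<subseteq> U"
  using ext(2) t01(3)[of j] by fastforce

text \<open>Formed with \<open>h\<close> instead of \<open>u\<close>: it agrees with the error on
  the cylinder and is C^4 on all of \<open>U\<close>.\<close>

definition err where "err j z = net (\<theta> j) z - h z"

text \<open>A version of \<open>R_int\<close> that does not mention \<open>f\<close>, about which
  only the heat equation is known; it is C^2 on all of \<open>U\<close>.\<close>

definition heat_residual where
  "heat_residual j z = pd (0, 1) (err j) z - (\<Sum>b\<in>Basis. pd (b, 0) (pd (b, 0) (err j)) z)"

lemma Ck_net: "j \<in> {1..i} \<Longrightarrow> Ck_open k V (net (\<theta> j))"
  using Ck_open_subset[OF Ck_open_net[OF nets]] by blast

lemma Ck_err: "j \<in> {1..i} \<Longrightarrow> Ck_open 4 U (err j)"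
  unfolding err_def[abs_def] by (intro Ck_open_diff ext Ck_net)

text \<open>Two of the four derivatives of the extension are spent on the Laplacian; the two that
  remain are those the quadrature estimate asks for.\<close>

lemma Ck_heat_residual:
  assumes "j \<in> {1..i}"
  shows "Ck_open 2 U (heat_residual j)"
proof -
  have B: "(b, 0) \<in> Basis" if "b \<in> Basis" for b :: "real^'d"
    using that by (simp add: Basis_prod_def)
  have B1: "(0::real^'d, 1::real) \<in> Basis" by (auto simp: Basis_prod_def)
  have 4: "Ck_open (Suc 3) U (err j)" using Ck_err[OF assms] by (simp del: Ck_open.simps)
  have 3: "Ck_open 3 U (pd b (err j))" if "b \<in> Basis" for b by (rule Ck_open_pd[OF 4 that])
  have 2: "Ck_open 2 U (pd (b, 0) (pd (b, 0) (err j)))" if "b \<in> Basis" for b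
    using Ck_open_pd[of 2 U "pd (b, 0) (err j)"] 3[OF B[OF that]] B[OF that]
    by (simp del: Ck_open.simps)
  show ?thesis
    unfolding heat_residual_def[abs_def]
    by (intro Ck_open_diff Ck_open_sum ext 2 Ck_open_le[OF 3[OF B1]]) auto
qed

text \<open>The heat equation is used up to both ends of the time interval, where the derivative of
  \<open>u\<close> is one-sided. It is compared with the two-sided derivative of \<open>h\<close>
  through uniqueness of derivatives within {0..t1 j}, an interval of positive length.\<close>

lemma R_int_eq:
  assumes j: "j \<in> {1..i}" and x: "x \<in> D" and t: "t \<in> {0..t1 j}"
  shows "R_int f \<theta> j (x, t) = heat_residual j (x, t)"
proof -
  have zU: "(y, s) \<in> U" if "y \<in> D" "s \<in> {0..t1 j}" for y s
    using ext_block[OF j] closure_subset[of D] that by auto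
  have t1T: "t1 j \<le> T" using t01(3)[OF j] time(2) by simp
  have uh: "u (y, s) = h (y, s)" if "y \<in> D" "s \<in> {0..t1 j}" for y s
    using ext(4) closure_subset[of D] that t01(3)[OF j] by auto
  have h2: "Ck_open 2 U h" using Ck_open_le[OF ext(3)] by simp
  have w2: "Ck_open 2 U (net (\<theta> j))" by (rule Ck_net[OF j])
  have diff: "k differentiable (at z)" "b \<in> Basis \<Longrightarrow> pd b k differentiable (at z)"
    if "Ck_open 2 U k" "z \<in> U" for k :: "(real^'d) \<times> real \<Rightarrow> real" and z b
    using that by (auto simp: numeral_2_eq_2)
  have B: "(b, 0) \<in> Basis" if "b \<in> Basis" for b :: "real^'d"
    using that by (simp add: Basis_prod_def)
  have "((\<lambda>s. h ((x, t) + s *\<^sub>R (0, 1))) has_real_derivative pd (0, 1) h (x, t)) (at 0)"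
    using has_real_derivative_along_line[of h "(x, t)" 0 "(0, 1)"] diff(1)[OF h2 zU[OF x t]] by simp
  then have "((\<lambda>s. h (x, t + s)) has_real_derivative pd (0, 1) h (x, t)) (at 0)" by simp
  then have "((\<lambda>s. h (x, s)) has_real_derivative pd (0, 1) h (x, t)) (at t)"
    using DERIV_at_within_shift[of "\<lambda>s. h (x, s)" "pd (0, 1) h (x, t)" t 0 UNIV] by simp
  then have d1: "((\<lambda>s. h (x, s)) has_real_derivative pd (0, 1) h (x, t)) (at t within {0..t1 j})"
    by (rule has_field_derivative_at_within)
  have "((\<lambda>s. u (x, s)) has_real_derivative (laplacian (\<lambda>y. u (y, t)) x + f (x, t))) (at t within {0..T})"
    using heat x t t1T unfolding heat_solution_def by auto
  then have "((\<lambda>s. u (x, s)) has_real_derivative (laplacian (\<lambda>y. u (y, t)) x + f (x, t)))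
      (at t within {0..t1 j})"
    by (rule has_field_derivative_subset) (use t1T in auto)
  then have d2: "((\<lambda>s. h (x, s)) has_real_derivative (laplacian (\<lambda>y. u (y, t)) x + f (x, t)))
      (at t within {0..t1 j})"
    by (rule has_field_derivative_transform_within[OF _ zero_less_one t]) (simp add: uh x)
  have "at t within {0..t1 j} \<noteq> bot"
    using t t01(5)[OF j] by (simp add: trivial_limit_within islimpt_Icc)
  then have "pd (0, 1) h (x, t) = laplacian (\<lambda>y. u (y, t)) x + f (x, t)"
    by (rule has_field_derivative_unique[OF d1 d2])
  moreover have "laplacian (\<lambda>y. u (y, t)) x = laplacian (\<lambda>y. h (y, t)) x"
    unfolding laplacian_def
  proof (intro sum.cong refl pd_cong[OF open_D x])
    fix b y assume "y \<in> D"
    then show "pd b (\<lambda>y. u (y, t)) y = pd b (\<lambda>y. h (y, t)) y"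
      by (rule pd_cong[OF open_D]) (rule uh[OF _ t])
  qed
  ultimately have f: "f (x, t) = pd (0, 1) h (x, t) - (\<Sum>b\<in>Basis. pd (b, 0) (pd (b, 0) h) (x, t))"
    using laplacian_slice[OF ext(1) h2 zU[OF x t]] by simp
  have "pd (b, 0) (pd (b, 0) (err j)) (x, t)
      = pd (b, 0) (pd (b, 0) (net (\<theta> j))) (x, t) - pd (b, 0) (pd (b, 0) h) (x, t)" if b: "b \<in> Basis" for b
  proof -
    have "pd (b, 0) (pd (b, 0) (err j)) (x, t)
        = pd (b, 0) (\<lambda>z. pd (b, 0) (net (\<theta> j)) z - pd (b, 0) h z) (x, t)"
      unfolding err_def[abs_def]
      by (rule pd_cong[OF ext(1) zU[OF x t]]) (intro pd_diff diff h2 w2)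
    also have "\<dots> = pd (b, 0) (pd (b, 0) (net (\<theta> j))) (x, t) - pd (b, 0) (pd (b, 0) h) (x, t)"
      by (intro pd_diff diff h2 w2 zU x t B b)
    finally show ?thesis .
  qed
  moreover have "pd (0, 1) (err j) (x, t) = pd (0, 1) (net (\<theta> j)) (x, t) - pd (0, 1) h (x, t)"
    unfolding err_def[abs_def] by (intro pd_diff diff h2 w2 zU x t)
  ultimately show ?thesis
    using laplacian_slice[OF ext(1) w2 zU[OF x t]]
    by (simp add: R_int_def heat_residual_def f sum_subtractf)
qed

section \<open>Residual integrals bounded by the quadrature rules\<close>

lemma integral_le_rule:
  assumes "quadrature_on \<mu> \<Lambda> m q" "Ck_upto 2 \<Lambda> g"
  shows "(LINT z:\<Lambda>|\<mu>. g z) \<le> qconst q g * real (qnum q) powr (- 2 / real m) + quad q g"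
proof -
  have "\<bar>(LINT z:\<Lambda>|\<mu>. g z) - quad q g\<bar> \<le> qconst q g * real (qnum q) powr (- 2 / real m)"
    using assms unfolding quadrature_on_def by blast
  then show ?thesis by linarith
qed

lemma R_int_rule:
  assumes j: "j \<in> {1..i}"
  shows "(LBINT z:D \<times> {t0 j..t1 j}. (heat_residual j z)\<^sup>2)
    \<le> qconst (int_rule (S j)) (\<lambda>z. (R_int f \<theta> j z)\<^sup>2) * real (qnum (int_rule (S j))) powr (- 2 / real (CARD('d) + 1))
      + quad (int_rule (S j)) (\<lambda>z. (R_int f \<theta> j z)\<^sup>2)"
proof -
  have eq: "R_int f \<theta> j z = heat_residual j z" if "z \<in> D \<times> {t0 j..t1 j}" for z
    using that R_int_eq[OF j] t01(1)[OF j] by auto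
  have "Ck_upto 2 (D \<times> {t0 j..t1 j}) (\<lambda>z. (R_int f \<theta> j z)\<^sup>2)"
  proof (rule Ck_uptoI[OF ext(1)])
    show "closure (D \<times> {t0 j..t1 j}) \<subseteq> U"
      using ext_block[OF j] t01(1)[OF j] by (auto simp: closure_Times)
    show "Ck_open 2 U (\<lambda>z. (heat_residual j z)\<^sup>2)" by (intro Ck_open_power2 Ck_heat_residual j ext)
  qed (simp add: eq)
  moreover have "(LBINT z:D \<times> {t0 j..t1 j}. (R_int f \<theta> j z)\<^sup>2) = (LBINT z:D \<times> {t0 j..t1 j}. (heat_residual j z)\<^sup>2)"
    by (intro set_lebesgue_integral_cong)
      (use eq open_D in \<open>auto simp: borel_Times\<close>)
  ultimately show ?thesis
    using integral_le_rule rules[OF j] unfolding is_training_set_def by metis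
qed

text \<open>Replaces \<open>uin\<close>, which is tied to the solution on \<open>D\<close> only, by
  \<open>h\<close> at time 0, so that the residual has a C^2 version near the closure of
  \<open>D\<close>.\<close>

definition start_value where "start_value j x = (if j = 1 then h (x, 0) else net (\<theta> (j - 1)) (x, t0 j))"

lemma R_tb_eq:
  assumes j: "j \<in> {1..i}" and m: "m \<in> {1..j}" and x: "x \<in> D"
  shows "R_tb uin \<Delta>t \<theta> j m x = net (\<theta> j) (x, t0 m) - start_value m x"
proof -
  have "uin x = u (x, 0)" using heat x by (simp add: heat_solution_def)
  also have "\<dots> = h (x, 0)"
    using ext(4) x closure_subset[of D] time by (auto simp: zero_le_mult_iff)
  finally show ?thesis by (simp add: R_tb_def start_value_def)
qed

lemma R_tb_rule:
  assumes j: "j \<in> {1..i}" and m: "m \<in> {1..j}"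
  shows "(LBINT x:D. (R_tb uin \<Delta>t \<theta> j m x)\<^sup>2)
    \<le> qconst (tb_rule (S j)) (\<lambda>x. (R_tb uin \<Delta>t \<theta> j m x)\<^sup>2) * real (qnum (tb_rule (S j))) powr (- 2 / real CARD('d))
      + quad (tb_rule (S j)) (\<lambda>x. (R_tb uin \<Delta>t \<theta> j m x)\<^sup>2)"
proof (rule integral_le_rule)
  show "quadrature_on lborel D CARD('d) (tb_rule (S j))"
    using rules[OF j] by (simp add: is_training_set_def)
  let ?V = "{x. (x, 0) \<in> U}"
  have V: "open ?V" "closure D \<subseteq> ?V"
    using open_slice[OF ext(1)] ext(2) time by (auto simp: zero_le_mult_iff)
  have slice: "Ck_open 2 ?V (\<lambda>x. net (\<theta> k) (x, s))" if "k \<in> {1..i}" for k and s :: real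
    using Ck_open_slice[OF open_UNIV Ck_net[OF that, of 2 UNIV], of s] Ck_open_subset by blast
  have "Ck_open 2 ?V (start_value m)"
  proof (cases "m = 1")
    case True
    then show ?thesis
      using Ck_open_slice[OF ext(1), of 2 h 0] Ck_open_le[OF ext(3), of 2]
      by (simp add: start_value_def[abs_def] del: Ck_open.simps)
  next
    case False
    then have "m - 1 \<in> {1..i}" using j m by auto
    then show ?thesis using False slice[of "m - 1"] by (simp add: start_value_def[abs_def])
  qed
  then have "Ck_open 2 ?V (\<lambda>x. (net (\<theta> j) (x, t0 m) - start_value m x)\<^sup>2)"
    by (intro Ck_open_power2 Ck_open_diff V slice j)
  then show "Ck_upto 2 D (\<lambda>x. (R_tb uin \<Delta>t \<theta> j m x)\<^sup>2)"
    by (rule Ck_uptoI[OF V]) (simp add: R_tb_eq[OF j m])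
qed

lemma R_sb_rule:
  assumes j: "j \<in> {1..i}"
  shows "(LINT z:frontier D \<times> {t0 j..t1 j}|\<sigma> \<Otimes>\<^sub>M lborel. (err j z)\<^sup>2)
    \<le> qconst (sb_rule (S j)) (\<lambda>z. (R_sb ud \<theta> j z)\<^sup>2) * real (qnum (sb_rule (S j))) powr (- 2 / real CARD('d))
      + quad (sb_rule (S j)) (\<lambda>z. (R_sb ud \<theta> j z)\<^sup>2)"
proof -
  let ?S = "frontier D \<times> {t0 j..t1 j}"
  have sub: "?S \<subseteq> closure D \<times> {0..t1 j}" "?S \<subseteq> closure D \<times> {0..real i * \<Delta>t}" "?S \<subseteq> frontier D \<times> {0..T}"
    using t01(1,3)[OF j] time(2) by (auto simp: frontier_def intro: order_trans)
  have eq: "R_sb ud \<theta> j z = err j z" if z: "z \<in> ?S" for z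
  proof -
    have "ud z = u z" using heat sub(3) z by (auto simp: heat_solution_def)
    also have "\<dots> = h z" using ext(4) sub(2) z by blast
    finally show ?thesis by (simp add: R_sb_def err_def)
  qed
  have "Ck_upto 2 ?S (\<lambda>z. (R_sb ud \<theta> j z)\<^sup>2)"
  proof (rule Ck_uptoI[OF ext(1)])
    show "closure ?S \<subseteq> U" using sub(1) ext_block[OF j] by (simp add: closure_Times)
    show "Ck_open 2 U (\<lambda>z. (err j z)\<^sup>2)"
      using Ck_open_le[OF Ck_err[OF j], of 2] by (intro Ck_open_power2 ext) simp
  qed (simp add: eq)
  moreover have "(LINT z:?S|\<sigma> \<Otimes>\<^sub>M lborel. (R_sb ud \<theta> j z)\<^sup>2) = (LINT z:?S|\<sigma> \<Otimes>\<^sub>M lborel. (err j z)\<^sup>2)"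
    by (intro set_lebesgue_integral_cong) (use eq in \<open>auto simp: sets_sigma\<close>)
  ultimately show ?thesis
    using integral_le_rule rules[OF j] unfolding is_training_set_def by metis
qed

text \<open>\<open>C_bd\<close> without the factor |\<partial>D|^(1/2), which enters later through
  Cauchy-Schwarz.\<close>

definition grad_bound where "grad_bound j = C1_norm (D \<times> {0<..<t1 j}) (frontier D \<times> {0..t1 j}) u
    + C1_norm (D \<times> {0<..<t1 j}) (frontier D \<times> {0..t1 j}) (net (\<theta> j))"

lemma gradient_le_grad_bound:
  assumes j: "j \<in> {1..i}" and z: "z \<in> frontier D \<times> {0..t1 j}"
  shows "L2_set (\<lambda>b. pd (b, 0) (err j) z) Basis \<le> grad_bound j"
proof -
  let ?G = "D \<times> {0<..<t1 j}" and ?S = "frontier D \<times> {0..t1 j}"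
  have clG: "closure ?G = closure D \<times> {0..t1 j}"
    using t01(5)[OF j] by (simp add: closure_Times)
  have G: "open ?G" "bounded ?G" "?S \<subseteq> closure ?G - ?G"
    using open_D bounded_D frontier_Int_D unfolding clG
    by (auto intro: open_Times bounded_Times simp: frontier_def)
  have u: "(\<Sum>b\<in>Basis. \<bar>pd b h z\<bar>) \<le> C1_norm ?G ?S u"
  proof (rule sum_pd_le_C1_norm[OF G ext(1) _ _ _ z])
    show "closure ?G \<subseteq> U" unfolding clG by (rule ext_block[OF j])
    show "Ck_open 1 U h" using Ck_open_le[OF ext(3), of 1] by simp
    show "u z = h z" if "z \<in> closure ?G" for z
      using that ext(4) t01(3)[OF j] unfolding clG by auto
  qed
  have w: "(\<Sum>b\<in>Basis. \<bar>pd b (net (\<theta> j)) z\<bar>) \<le> C1_norm ?G ?S (net (\<theta> j))"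
    by (rule sum_pd_le_C1_norm[OF G open_UNIV _ Ck_net[OF j] _ z]) auto
  have zU: "z \<in> U" using z ext_block[OF j] by (auto simp: frontier_def)
  have d: "net (\<theta> j) differentiable (at z)" "h differentiable (at z)"
    using Ck_net[OF j, of 1 UNIV] Ck_open_le[OF ext(3), of 1] zU by auto
  have "L2_set (\<lambda>b. pd (b, 0) (err j) z) Basis \<le> (\<Sum>b\<in>Basis. \<bar>pd (b, 0) (err j) z\<bar>)"
    by (rule L2_set_le_sum_abs)
  also have "\<dots> \<le> (\<Sum>b\<in>Basis. \<bar>pd b (err j) z\<bar>)"
    by (rule sum_Basis_slice_le[where c = "\<lambda>b. \<bar>pd b (err j) z\<bar>"]) simp
  also have "\<dots> \<le> (\<Sum>b\<in>Basis. \<bar>pd b h z\<bar> + \<bar>pd b (net (\<theta> j)) z\<bar>)"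
    unfolding err_def[abs_def] using d by (intro sum_mono) (simp add: pd_diff)
  also have "\<dots> \<le> grad_bound j" using u w by (simp add: sum.distrib grad_bound_def)
  finally show ?thesis .
qed

section \<open>Energy of the error, block by block\<close>

definition energy where "energy j t = (LBINT x:D. (net (\<theta> j) (x, t) - u (x, t))\<^sup>2)"

lemma energy_eq:
  assumes j: "j \<in> {1..i}" and t: "t \<in> {0..t1 j}"
  shows "energy j t = (LBINT x:D. (err j (x, t))\<^sup>2)"
  unfolding energy_def
proof (intro set_lebesgue_integral_cong allI impI)
  fix x assume "x \<in> D"
  then have "(x, t) \<in> closure D \<times> {0..real i * \<Delta>t}"
    using t t01(3)[OF j] closure_subset[of D] by auto
  then show "(net (\<theta> j) (x, t) - u (x, t))\<^sup>2 = (err j (x, t))\<^sup>2"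
    using ext(4) by (simp add: err_def)
qed (use open_D in simp)

lemma continuous_err:
  assumes "j \<in> {1..i}"
  shows "continuous_on (closure D \<times> {t0 j..t1 j}) (err j)"
proof (rule continuous_on_subset)
  show "continuous_on U (err j)" by (rule Ck_open_imp_continuous_on[OF Ck_err[OF assms]])
  show "closure D \<times> {t0 j..t1 j} \<subseteq> U"
    using ext_block[OF assms] t01(1)[OF assms] by fastforce
qed

lemma energy_continuous:
  assumes j: "j \<in> {1..i}"
  shows "continuous_on {t0 j..t1 j} (energy j)"
proof -
  interpret space_time_block D \<sigma> "t0 j" "t1 j"
    by unfold_locales (rule t01(2)[OF j])
  have "continuous_on {t0 j..t1 j} (\<lambda>t. LBINT x:D. (err j (x, t))\<^sup>2)"
    by (intro continuous_on_integral_D[of "\<lambda>z. (err j z)\<^sup>2"] continuous_intros continuous_err j)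
  then show ?thesis
    by (rule continuous_on_cong[THEN iffD1, rotated -1]) (use energy_eq[OF j] t01(1)[OF j] in auto)
qed

text \<open>Cauchy-Schwarz on the lateral boundary, of measure |\<partial>D| \<Delta>t, supplies two
  square roots: |\<partial>D|^(1/2) completes \<open>C_bd\<close>, and |\<Delta>t|^(1/2) stands next
  to it. The integrals of squared residuals are then traded for rule plus error estimate.\<close>

lemma block_estimate:
  assumes j: "j \<in> {1..i}" and t: "t \<in> {t0 j..t1 j}"
  shows "energy j t \<le> (energy j (t0 j)
     + (qconst (int_rule (S j)) (\<lambda>z. (R_int f \<theta> j z)\<^sup>2)
          * real (qnum (int_rule (S j))) powr (- 2 / real (CARD('d) + 1))
        + quad (int_rule (S j)) (\<lambda>z. (R_int f \<theta> j z)\<^sup>2))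
     + 2 * C_bd D \<sigma> u \<Delta>t \<theta> j * sqrt \<bar>\<Delta>t\<bar> *
        sqrt (qconst (sb_rule (S j)) (\<lambda>z. (R_sb ud \<theta> j z)\<^sup>2)
            * real (qnum (sb_rule (S j))) powr (- 2 / real CARD('d))
          + quad (sb_rule (S j)) (\<lambda>z. (R_sb ud \<theta> j z)\<^sup>2))) * exp \<Delta>t"
    (is "_ \<le> (_ + ?I + 2 * _ * _ * sqrt ?B) * _")
proof -
  interpret space_time_block D \<sigma> "t0 j" "t1 j"
    by unfold_locales (rule t01(2)[OF j])
  let ?S = "frontier D \<times> {t0 j..t1 j}"
  have sub: "closure D \<times> {t0 j..t1 j} \<subseteq> U"
    using ext_block[OF j] t01(1)[OF j] by auto
  \<comment> \<open>A nonempty bounded set has a boundary point, and there \<open>grad_bound\<close>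
    lies above the length of a vector. Over an empty boundary the suprema in \<open>C1_norm\<close>
    would carry no information.\<close>
  have "D \<noteq> UNIV" using bounded_D not_bounded_UNIV by auto
  then obtain x0 where "x0 \<in> frontier D" using frontier_not_empty[OF D_nonempty] by auto
  then have grad_bound: "0 \<le> grad_bound j"
    using order_trans[OF L2_set_nonneg gradient_le_grad_bound[OF j, of "(x0, 0)"]] t01(5)[OF j] by simp
  have em: "emeasure (\<sigma> \<Otimes>\<^sub>M lborel) ?S = emeasure \<sigma> (frontier D) * ennreal \<Delta>t"
    using t01(2,4)[OF j] by (subst lborel.emeasure_pair_measure_Times) (auto simp: sets_sigma)
  have "(LINT z:?S|\<sigma> \<Otimes>\<^sub>M lborel. \<bar>err j z\<bar>)
    \<le> sqrt (measure (\<sigma> \<Otimes>\<^sub>M lborel) ?S) * sqrt (LINT z:?S|\<sigma> \<Otimes>\<^sub>M lborel. (err j z)\<^sup>2)"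
  proof (rule set_integral_abs_le_sqrt)
    show "?S \<in> sets (\<sigma> \<Otimes>\<^sub>M lborel)" by (simp add: sets_sigma)
    show "emeasure (\<sigma> \<Otimes>\<^sub>M lborel) ?S < \<infinity>"
      unfolding em by (simp add: ennreal_mult_eq_top_iff less_top[symmetric] emeasure_finite)
  qed (intro set_integrable_block continuous_intros continuous_err j order_refl)+
  also have "measure (\<sigma> \<Otimes>\<^sub>M lborel) ?S = measure \<sigma> (frontier D) * \<Delta>t"
    unfolding measure_def em using time(1) by (simp add: enn2real_mult)
  also have "sqrt (measure \<sigma> (frontier D) * \<Delta>t) * sqrt (LINT z:?S|\<sigma> \<Otimes>\<^sub>M lborel. (err j z)\<^sup>2)
      \<le> sqrt (measure \<sigma> (frontier D) * \<Delta>t) * sqrt ?B"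
    by (intro mult_left_mono real_sqrt_le_mono R_sb_rule j) (use time(1) in auto)
  finally have "grad_bound j * (LINT z:?S|\<sigma> \<Otimes>\<^sub>M lborel. \<bar>err j z\<bar>)
      \<le> grad_bound j * (sqrt (measure \<sigma> (frontier D) * \<Delta>t) * sqrt ?B)"
    by (intro mult_left_mono grad_bound)
  also have "\<dots> = C_bd D \<sigma> u \<Delta>t \<theta> j * sqrt \<bar>\<Delta>t\<bar> * sqrt ?B"
    using time(1) by (simp add: C_bd_def grad_bound_def real_sqrt_mult)
  finally have bd: "grad_bound j * (LINT z:?S|\<sigma> \<Otimes>\<^sub>M lborel. \<bar>err j z\<bar>)
      \<le> C_bd D \<sigma> u \<Delta>t \<theta> j * sqrt \<bar>\<Delta>t\<bar> * sqrt ?B" .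
  have "(LBINT x:D. (err j (x, t))\<^sup>2) \<le> ((LBINT x:D. (err j (x, t0 j))\<^sup>2)
      + (LBINT z:D \<times> {t0 j..t1 j}. (heat_residual j z)\<^sup>2)
      + 2 * grad_bound j * (LINT z:?S|\<sigma> \<Otimes>\<^sub>M lborel. \<bar>err j z\<bar>)) * exp (t1 j - t0 j)"
  proof (rule energy_estimate[OF ext(1) sub _ t _ grad_bound])
    show "Ck_open 2 U (err j)" using Ck_open_le[OF Ck_err[OF j]] by simp
    show "L2_set (\<lambda>b. pd (b, 0) (err j) z) Basis \<le> grad_bound j" if "z \<in> ?S" for z
      using that t01(1)[OF j] by (intro gradient_le_grad_bound[OF j]) auto
    show "continuous_on (closure D \<times> {t0 j..t1 j}) (heat_residual j)"
      by (rule continuous_on_subset[OF Ck_open_imp_continuous_on[OF Ck_heat_residual[OF j]] sub])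
  qed (simp add: heat_residual_def)
  also have "\<dots> \<le> ((LBINT x:D. (err j (x, t0 j))\<^sup>2) + ?I
      + 2 * C_bd D \<sigma> u \<Delta>t \<theta> j * sqrt \<bar>\<Delta>t\<bar> * sqrt ?B) * exp \<Delta>t"
    unfolding t01(4)[OF j] using R_int_rule[OF j] bd by (intro mult_right_mono) auto
  finally have est: "(LBINT x:D. (err j (x, t))\<^sup>2) \<le> \<dots>" .
  have tt: "t \<in> {0..t1 j}" "t0 j \<in> {0..t1 j}"
    using t order_trans[OF t01(1)[OF j], of t] t01(1,2)[OF j] by auto
  show ?thesis unfolding energy_eq[OF j tt(1)] energy_eq[OF j tt(2)] by (rule est)
qed

text \<open>Block j ends when block j + 1 starts, so the induction hypothesis at \<open>t1 j\<close>
  controls the initial energy of the next block. The jump between consecutive networks is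
  \<open>R_tb\<close>, and (a + b)^2 \<le> 2 a^2 + 2 b^2 is the origin of the factors 2 at the
  initial residuals and at the previous constant in \<open>C_T\<close>.\<close>

lemma energy_le:
  assumes "j \<in> {1..i}" and "t \<in> {t0 j..t1 j}"
  shows "energy j t \<le> C_T D \<sigma> f uin ud u \<Delta>t \<theta> S j * exp \<Delta>t"
  using assms
proof (induction j arbitrary: t)
  case (Suc j)
  let ?tb = "\<lambda>m. qconst (tb_rule (S (Suc j))) (\<lambda>x. (R_tb uin \<Delta>t \<theta> (Suc j) m x)\<^sup>2)
          * real (qnum (tb_rule (S (Suc j)))) powr (- 2 / real CARD('d))
        + quad (tb_rule (S (Suc j))) (\<lambda>x. (R_tb uin \<Delta>t \<theta> (Suc j) m x)\<^sup>2)"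
  let ?R = "\<lambda>x. R_tb uin \<Delta>t \<theta> (Suc j) (Suc j) x"
  note sj = Suc.prems(1)
  have tb: "(LBINT x:D. (R_tb uin \<Delta>t \<theta> (Suc j) m x)\<^sup>2) \<le> ?tb m" if "m \<in> {1..Suc j}" for m
    by (rule R_tb_rule[OF sj that])
  \<comment> \<open>Each summand bounds the integral of a square, so it is nonnegative, and the one
    for the start of the block is at most the whole sum.\<close>
  have "0 \<le> ?tb m" if "m \<in> {1..Suc j}" for m
    using tb[OF that] by (rule order_trans[rotated])
      (auto simp: set_lebesgue_integral_def intro!: integral_nonneg_AE)
  then have "?tb (Suc j) \<le> (\<Sum>m = 1..Suc j. ?tb m)"
    by (intro member_le_sum) auto
  then have tbs: "(LBINT x:D. (?R x)\<^sup>2) \<le> (\<Sum>m = 1..Suc j. ?tb m)"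
    using tb[of "Suc j"] by simp
  have start: "energy (Suc j) (t0 (Suc j)) \<le> 2 * (LBINT x:D. (?R x)\<^sup>2)
      + 2 * C_T D \<sigma> f uin ud u \<Delta>t \<theta> S j * exp \<Delta>t"
  \<comment> \<open>In the first block the initial error is \<open>R_tb\<close> itself, by the
    convention that the previous approximation is \<open>uin\<close>; the previous constant is
    0.\<close>
  proof (cases "j = 0")
    case True
    have "energy (Suc j) (t0 (Suc j)) = (LBINT x:D. (?R x)\<^sup>2)"
      unfolding energy_def
      by (intro set_lebesgue_integral_cong)
        (use open_D True heat in \<open>auto simp: R_tb_def heat_solution_def\<close>)
    moreover have "0 \<le> (LBINT x:D. (?R x)\<^sup>2)"
      by (auto simp: set_lebesgue_integral_def intro!: integral_nonneg_AE)
    ultimately show ?thesis using True by simp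
  next
    case False
    then have j: "j \<in> {1..i}" using sj by auto
    interpret space_time_block D \<sigma> "t0 j" "t1 j"
      by unfold_locales (rule t01(2)[OF j])
    have tj: "t1 j \<in> {t0 j..t1 j}" "t1 j \<in> {0..t1 j}" "t1 j \<in> {0..t1 (Suc j)}"
      using t01[OF j] time by auto
    have IH: "energy j (t1 j) \<le> C_T D \<sigma> f uin ud u \<Delta>t \<theta> S j * exp \<Delta>t"
      by (rule Suc.IH[OF j tj(1)])
    have ce: "continuous_on (closure D) (\<lambda>x. err k (x, t1 j))" if "k \<in> {j, Suc j}" for k
    proof -
      have k: "k \<in> {1..i}" using that j sj by auto
      show ?thesis
        by (rule continuous_on_compose2[OF Ck_open_imp_continuous_on[OF Ck_err[OF k]]])
          (use ext_block[OF j] tj in \<open>auto intro!: continuous_intros\<close>)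
    qed
    have R: "?R x = err (Suc j) (x, t1 j) - err j (x, t1 j)" for x
      using False by (simp add: R_tb_def err_def)
    have iR: "set_integrable lborel D (\<lambda>x. (?R x)\<^sup>2)"
      unfolding R by (intro set_integrable_D continuous_intros ce) auto
    have ie: "set_integrable lborel D (\<lambda>x. (err k (x, t1 j))\<^sup>2)" if "k \<in> {j, Suc j}" for k
      by (intro set_integrable_D continuous_intros ce that)
    have "energy (Suc j) (t0 (Suc j)) = (LBINT x:D. (err (Suc j) (x, t1 j))\<^sup>2)"
      using energy_eq[OF sj tj(3)] by simp
    also have "\<dots> \<le> (LBINT x:D. 2 * (?R x)\<^sup>2 + 2 * (err j (x, t1 j))\<^sup>2)"
    proof (rule set_integral_mono)
      \<comment> \<open>The right side minus the left side is the square of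
        \<open>err (Suc j) - 2 * err j\<close> at this point.\<close>
      show "(err (Suc j) (x, t1 j))\<^sup>2 \<le> 2 * (?R x)\<^sup>2 + 2 * (err j (x, t1 j))\<^sup>2" for x
        using sum_squares_ge_zero[of "err (Suc j) (x, t1 j) - 2 * err j (x, t1 j)" 0] unfolding R
        by (simp add: power2_eq_square algebra_simps)
    qed (auto intro!: ie set_integral_add(1) set_integrable_mult_right iR)
    also have "\<dots> = 2 * (LBINT x:D. (?R x)\<^sup>2) + 2 * (LBINT x:D. (err j (x, t1 j))\<^sup>2)"
      using iR ie[of j] by (simp add: set_integral_add set_integrable_mult_right)
    also have "(LBINT x:D. (err j (x, t1 j))\<^sup>2) = energy j (t1 j)" using energy_eq[OF j tj(2)] by simp
    finally show ?thesis using IH by simp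
  qed
  have "energy (Suc j) t \<le> C_T D \<sigma> f uin ud u \<Delta>t \<theta> S (Suc j) * exp \<Delta>t"
    by (rule order_trans[OF block_estimate[OF Suc.prems]], rule mult_right_mono)
      (use start tbs in \<open>simp_all add: C_block_def del: sum.cl_ivl_Suc\<close>)
  then show ?case .
qed simp

lemma block_error:
  assumes j: "j \<in> {1..i}"
  shows "(LBINT t:{t0 j..t1 j}. LBINT x:D. \<bar>net (\<theta> j) (x, t) - u (x, t)\<bar>\<^sup>2)
    \<le> C_T D \<sigma> f uin ud u \<Delta>t \<theta> S j * \<Delta>t * exp \<Delta>t"
proof -
  let ?c = "C_T D \<sigma> f uin ud u \<Delta>t \<theta> S j * exp \<Delta>t"
  have "(LBINT t:{t0 j..t1 j}. energy j t) \<le> (LBINT t:{t0 j..t1 j}. ?c)"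
    by (intro set_integral_mono energy_le j borel_integrable_atLeastAtMost' energy_continuous continuous_on_const)
  also have "\<dots> = \<Delta>t * ?c"
    using t01(2,4)[OF j] by (subst set_integral_const) auto
  finally show ?thesis by (simp add: energy_def mult_ac)
qed

text \<open>\<open>qconst\<close> has no prescribed sign, so this comes from the integral of a
  square below it. It makes the root in \<open>C_block\<close> nonnegative, as is needed before its
  factor \<open>C_bd\<close> is enlarged.\<close>

lemma sb_rule_nonneg:
  assumes j: "j \<in> {1..i}"
  shows "0 \<le> qconst (sb_rule (S j)) (\<lambda>z. (R_sb ud \<theta> j z)\<^sup>2)
      * real (qnum (sb_rule (S j))) powr (- 2 / real CARD('d)) + quad (sb_rule (S j)) (\<lambda>z. (R_sb ud \<theta> j z)\<^sup>2)"
  using R_sb_rule[OF j] by (rule order_trans[rotated])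
    (auto simp: set_lebesgue_integral_def intro!: integral_nonneg_AE)

end

section \<open>Order of the error constants\<close>

lemma quad_power2_nonneg:
  assumes "quadrature_on \<mu> \<Lambda> m q"
  shows "0 \<le> quad q (\<lambda>z. (g z)\<^sup>2)"
  using assms unfolding quad_def quadrature_on_def by (intro sum_nonneg) auto

text \<open>From N \<le> k M with k = max 1 \<kappa> follows M^(-p) \<le> k^p N^(-p), and k^p \<le>
  k^2 since p \<le> 2. The exponents 2/(d+1), 2/d and 1/d are all at most 2, so one constant serves
  them.\<close>

lemma rate_comparable:
  assumes cmp: "comparable \<kappa> M N" and pos: "0 < M" "0 < N" and p: "0 \<le> p" "p \<le> 2"
  shows "real M powr (- p) \<le> (max 1 \<kappa>)\<^sup>2 * real N powr (- p)"
proof -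
  let ?k = "max 1 \<kappa>"
  have "real N \<le> \<kappa> * real M" using cmp by (simp add: comparable_def)
  also have "\<dots> \<le> ?k * real M" by (intro mult_right_mono) auto
  finally have "real N / ?k \<le> real M" by (simp add: field_simps)
  then have "real M powr (- p) \<le> (real N / ?k) powr (- p)"
    using pos p by (intro powr_mono2') auto
  also have "\<dots> = ?k powr p * real N powr (- p)"
    using pos by (simp add: powr_divide powr_minus divide_simps)
  also have "\<dots> \<le> ?k powr 2 * real N powr (- p)"
    using p by (intro mult_right_mono powr_mono) auto
  finally show ?thesis by simp
qed

text \<open>The coefficients in the block constant added up, so that each of them is at most the
  sum. With k = max 1 \<kappa>, the leading 2 covers the quadratures of the interior and initial
  residuals, (2 i + 1) |B| k^2 their rates, and the last summand the boundary term. Absolute values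
  keep it nonnegative for \<open>B\<close> of any sign.\<close>

definition block_factor :: "nat \<Rightarrow> real \<Rightarrow> real \<Rightarrow> real \<Rightarrow> real" where
  "block_factor i \<Delta>t B \<kappa> = 2 + (2 * real i + 1) * (\<bar>B\<bar> * (max 1 \<kappa>)\<^sup>2)
     + 2 * \<bar>B\<bar> * sqrt \<bar>\<Delta>t\<bar> * (sqrt \<bar>B\<bar> * (max 1 \<kappa>)\<^sup>2 + 1)"

lemma block_factor_nonneg: "0 \<le> block_factor i \<Delta>t B \<kappa>"
  by (simp add: block_factor_def)

lemma rule_sum_le:
  fixes c b M k P Q :: real
  assumes "c \<le> b" "0 \<le> b" "0 \<le> M" "M \<le> k * P"
  shows "c * M + Q \<le> b * k * P + Q"
  using mult_right_mono[OF assms(1,3)] mult_left_mono[OF assms(4,2)] by (simp add: mult.assoc)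

lemma block_training_error_sq_nonneg:
  assumes "is_training_set D \<sigma> \<Delta>t j (S j)"
  shows "0 \<le> block_training_error_sq f uin ud \<Delta>t \<theta> S j"
  using assms unfolding block_training_error_sq_def is_training_set_def
  by (intro add_nonneg_nonneg sum_nonneg real_sqrt_ge_zero) (auto intro: quad_power2_nonneg)

lemma C_block_le:
  fixes D :: "(real^'d) set" and S :: "nat \<Rightarrow> 'd training_set"
  assumes rules: "\<And>j. j \<in> {1..i} \<Longrightarrow> is_training_set D \<sigma> \<Delta>t j (S j)"
    and sb: "\<And>j. j \<in> {1..i} \<Longrightarrow> 0 \<le> qconst (sb_rule (S j)) (\<lambda>z. (R_sb ud \<theta> j z)\<^sup>2)
        * real (qnum (sb_rule (S j))) powr (- 2 / real CARD('d)) + quad (sb_rule (S j)) (\<lambda>z. (R_sb ud \<theta> j z)\<^sup>2)"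
    and bdd: "constants_bounded D \<sigma> f uin ud u \<Delta>t \<theta> S i B" and order: "same_order \<kappa> S i"
    and j: "j \<in> {1..i}"
  shows "C_block D \<sigma> f uin ud u \<Delta>t \<theta> S j \<le> block_factor i \<Delta>t B \<kappa> *
    (block_training_error_sq f uin ud \<Delta>t \<theta> S j
      + (real (qnum (int_rule (S i))) powr (- 2 / real (CARD('d) + 1))
        + real (qnum (tb_rule (S i))) powr (- 2 / real CARD('d))
        + real (qnum (sb_rule (S i))) powr (- 1 / real CARD('d))))"
proof -
  have i: "i \<in> {1..i}" using j by simp
  have d: "1 \<le> CARD('d)" by (simp add: Suc_leI)
  let ?k = "(max 1 \<kappa>)\<^sup>2" and ?b = "\<bar>B\<bar>"
  define Pi where "Pi = real (qnum (int_rule (S i))) powr (- 2 / real (CARD('d) + 1))"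
  define Pt where "Pt = real (qnum (tb_rule (S i))) powr (- 2 / real CARD('d))"
  define Ps where "Ps = real (qnum (sb_rule (S i))) powr (- 1 / real CARD('d))"
  define Qi where "Qi = quad (int_rule (S j)) (\<lambda>z. (R_int f \<theta> j z)\<^sup>2)"
  define Qt where "Qt m = quad (tb_rule (S j)) (\<lambda>x. (R_tb uin \<Delta>t \<theta> j m x)\<^sup>2)" for m
  define Qs where "Qs = quad (sb_rule (S j)) (\<lambda>z. (R_sb ud \<theta> j z)\<^sup>2)"
  have P: "0 \<le> Pi" "0 \<le> Pt" "0 \<le> Ps" by (simp_all add: Pi_def Pt_def Ps_def)
  have Q: "0 \<le> Qi" "0 \<le> Qt m" "0 \<le> Qs" for m
    using rules[OF j] unfolding Qi_def Qt_def Qs_def is_training_set_def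
    by (auto intro: quad_power2_nonneg)
  have b: "c \<le> ?b" if "c \<le> B" for c using that by simp
  have pos: "0 < qnum (int_rule (S m))" "0 < qnum (tb_rule (S m))" "0 < qnum (sb_rule (S m))"
    if "m \<in> {1..i}" for m
    using rules[OF that] unfolding is_training_set_def quadrature_on_def by auto
  have cmp: "comparable \<kappa> (qnum (int_rule (S j))) (qnum (int_rule (S i)))"
    "comparable \<kappa> (qnum (tb_rule (S j))) (qnum (tb_rule (S i)))"
    "comparable \<kappa> (qnum (sb_rule (S j))) (qnum (sb_rule (S i)))"
    using order j unfolding same_order_def by auto
  have Mi: "real (qnum (int_rule (S j))) powr (- 2 / real (CARD('d) + 1)) \<le> ?k * Pi"
    using rate_comparable[OF cmp(1) pos(1)[OF j] pos(1)[OF i], of "2 / real (CARD('d) + 1)"]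
    by (simp add: Pi_def field_simps)
  have Mt: "real (qnum (tb_rule (S j))) powr (- 2 / real CARD('d)) \<le> ?k * Pt"
    using rate_comparable[OF cmp(2) pos(2)[OF j] pos(2)[OF i], of "2 / real CARD('d)"] d
    by (simp add: Pt_def field_simps)
  have Ms: "real (qnum (sb_rule (S j))) powr (- 1 / real CARD('d)) \<le> ?k * Ps"
    using rate_comparable[OF cmp(3) pos(3)[OF j] pos(3)[OF i], of "1 / real CARD('d)"] d
    by (simp add: Ps_def field_simps)
  have bounds: "C_bd D \<sigma> u \<Delta>t \<theta> j \<le> ?b" "qconst (int_rule (S j)) (\<lambda>z. (R_int f \<theta> j z)\<^sup>2) \<le> ?b"
    "\<And>m. m \<in> {1..j} \<Longrightarrow> qconst (tb_rule (S j)) (\<lambda>x. (R_tb uin \<Delta>t \<theta> j m x)\<^sup>2) \<le> ?b"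
    "qconst (sb_rule (S j)) (\<lambda>z. (R_sb ud \<theta> j z)\<^sup>2) \<le> ?b"
    using bdd j b unfolding constants_bounded_def by blast+
  have T: "(\<Sum>m = 1..j. qconst (tb_rule (S j)) (\<lambda>x. (R_tb uin \<Delta>t \<theta> j m x)\<^sup>2)
          * real (qnum (tb_rule (S j))) powr (- 2 / real CARD('d)) + Qt m)
      \<le> real i * (?b * ?k * Pt) + (\<Sum>m = 1..j. Qt m)"
  proof -
    have "(\<Sum>m = 1..j. qconst (tb_rule (S j)) (\<lambda>x. (R_tb uin \<Delta>t \<theta> j m x)\<^sup>2)
          * real (qnum (tb_rule (S j))) powr (- 2 / real CARD('d)) + Qt m)
        \<le> (\<Sum>m = 1..j. ?b * ?k * Pt + Qt m)"
      by (intro sum_mono rule_sum_le bounds Mt) auto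
    also have "\<dots> = real j * (?b * ?k * Pt) + (\<Sum>m = 1..j. Qt m)"
      by (simp add: sum.distrib)
    also have "\<dots> \<le> real i * (?b * ?k * Pt) + (\<Sum>m = 1..j. Qt m)"
      using j P by (intro add_right_mono mult_right_mono) auto
    finally show ?thesis .
  qed
  let ?s = "sqrt (qconst (sb_rule (S j)) (\<lambda>z. (R_sb ud \<theta> j z)\<^sup>2)
            * real (qnum (sb_rule (S j))) powr (- 2 / real CARD('d)) + Qs)"
  have "?s \<le> sqrt (?b * real (qnum (sb_rule (S j))) powr (- 2 / real CARD('d)) + Qs)"
    by (intro real_sqrt_le_mono add_right_mono mult_right_mono bounds) auto
  \<comment> \<open>Subadditivity of the root separates rate and quadrature: M^(-2/d) becomes
    M^(-1/d), and the root of the quadrature is the one in the training error.\<close>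
  also have "\<dots> \<le> sqrt (?b * real (qnum (sb_rule (S j))) powr (- 2 / real CARD('d))) + sqrt Qs"
    using Q by (intro sqrt_add_le_add_sqrt) auto
  also have "\<dots> = sqrt ?b * real (qnum (sb_rule (S j))) powr (- 1 / real CARD('d)) + sqrt Qs"
  proof -
    have "real (qnum (sb_rule (S j))) powr (- 2 / real CARD('d))
        = (real (qnum (sb_rule (S j))) powr (- 1 / real CARD('d)))\<^sup>2"
      by (simp add: power2_eq_square flip: powr_add)
    then show ?thesis by (simp add: real_sqrt_mult)
  qed
  also have "\<dots> \<le> sqrt ?b * (?k * Ps) + sqrt Qs" by (intro add_right_mono mult_left_mono Ms) auto
  finally have s: "?s \<le> sqrt ?b * (?k * Ps) + sqrt Qs" .
  have "2 * C_bd D \<sigma> u \<Delta>t \<theta> j * sqrt \<bar>\<Delta>t\<bar> * ?s \<le> 2 * ?b * sqrt \<bar>\<Delta>t\<bar> * ?s"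
  proof (intro mult_right_mono)
    show "0 \<le> ?s" using sb[OF j] by (simp add: Qs_def)
  qed (use bounds(1) in auto)
  also have "\<dots> \<le> 2 * ?b * sqrt \<bar>\<Delta>t\<bar> * (sqrt ?b * (?k * Ps) + sqrt Qs)"
    by (intro mult_left_mono s) auto
  finally have Sb: "2 * C_bd D \<sigma> u \<Delta>t \<theta> j * sqrt \<bar>\<Delta>t\<bar> * ?s
      \<le> 2 * ?b * sqrt \<bar>\<Delta>t\<bar> * (sqrt ?b * (?k * Ps) + sqrt Qs)" .
  have I: "qconst (int_rule (S j)) (\<lambda>z. (R_int f \<theta> j z)\<^sup>2)
      * real (qnum (int_rule (S j))) powr (- 2 / real (CARD('d) + 1)) + Qi \<le> ?b * ?k * Pi + Qi"
    by (intro rule_sum_le bounds Mi) auto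
  have "C_block D \<sigma> f uin ud u \<Delta>t \<theta> S j
      \<le> 2 * (real i * (?b * ?k * Pt) + (\<Sum>m = 1..j. Qt m)) + (?b * ?k * Pi + Qi)
        + 2 * ?b * sqrt \<bar>\<Delta>t\<bar> * (sqrt ?b * (?k * Ps) + sqrt Qs)"
    unfolding C_block_def Qi_def[symmetric] Qt_def[symmetric] Qs_def[symmetric]
      add.assoc[of "2 * _" "_ * _" Qi]
    by (intro add_mono[OF add_mono[OF mult_left_mono[OF T] I] Sb]) simp
  also have "\<dots> = 2 * real i * (?b * ?k) * Pt + 2 * (\<Sum>m = 1..j. Qt m) + ?b * ?k * Pi + 1 * Qi
        + 2 * ?b * sqrt \<bar>\<Delta>t\<bar> * (sqrt ?b * ?k) * Ps + 2 * ?b * sqrt \<bar>\<Delta>t\<bar> * sqrt Qs"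
    by (simp add: algebra_simps)
  also have "\<dots> \<le> block_factor i \<Delta>t B \<kappa> * Pt + block_factor i \<Delta>t B \<kappa> * (\<Sum>m = 1..j. Qt m)
        + block_factor i \<Delta>t B \<kappa> * Pi + block_factor i \<Delta>t B \<kappa> * Qi
        + block_factor i \<Delta>t B \<kappa> * Ps + block_factor i \<Delta>t B \<kappa> * sqrt Qs"
  proof -
    have n: "0 \<le> ?b * ?k" "0 \<le> 2 * real i * (?b * ?k)" "0 \<le> 2 * ?b * sqrt \<bar>\<Delta>t\<bar> * (sqrt ?b * ?k)"
      "0 \<le> 2 * ?b * sqrt \<bar>\<Delta>t\<bar>" by auto
    have e: "block_factor i \<Delta>t B \<kappa> = 2 + 2 * real i * (?b * ?k) + ?b * ?k
        + 2 * ?b * sqrt \<bar>\<Delta>t\<bar> * (sqrt ?b * ?k) + 2 * ?b * sqrt \<bar>\<Delta>t\<bar>"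
      by (simp add: block_factor_def algebra_simps)
    have "2 * real i * (?b * ?k) \<le> block_factor i \<Delta>t B \<kappa>" "2 \<le> block_factor i \<Delta>t B \<kappa>"
      "?b * ?k \<le> block_factor i \<Delta>t B \<kappa>" "1 \<le> block_factor i \<Delta>t B \<kappa>"
      "2 * ?b * sqrt \<bar>\<Delta>t\<bar> * (sqrt ?b * ?k) \<le> block_factor i \<Delta>t B \<kappa>"
      "2 * ?b * sqrt \<bar>\<Delta>t\<bar> \<le> block_factor i \<Delta>t B \<kappa>"
      unfolding e using n by linarith+
    then show ?thesis
      using P Q by (intro add_mono mult_right_mono sum_nonneg real_sqrt_ge_zero) auto
  qed
  also have "\<dots> = block_factor i \<Delta>t B \<kappa> *
      (block_training_error_sq f uin ud \<Delta>t \<theta> S j + (Pi + Pt + Ps))"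
    by (simp add: block_training_error_sq_def Qi_def Qt_def Qs_def algebra_simps)
  finally show ?thesis unfolding Pi_def Pt_def Ps_def .
qed

text \<open>Unrolling the recursion of \<open>C_T\<close> gives the geometric sum in 2 exp
  \<Delta>t, since the squared training errors do not decrease with j and the rates are all taken at
  block i.\<close>

lemma C_T_le:
  fixes D :: "(real^'d) set" and S :: "nat \<Rightarrow> 'd training_set"
  assumes rules: "\<And>j. j \<in> {1..i} \<Longrightarrow> is_training_set D \<sigma> \<Delta>t j (S j)"
    and sb: "\<And>j. j \<in> {1..i} \<Longrightarrow> 0 \<le> qconst (sb_rule (S j)) (\<lambda>z. (R_sb ud \<theta> j z)\<^sup>2)
        * real (qnum (sb_rule (S j))) powr (- 2 / real CARD('d)) + quad (sb_rule (S j)) (\<lambda>z. (R_sb ud \<theta> j z)\<^sup>2)"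
    and bdd: "constants_bounded D \<sigma> f uin ud u \<Delta>t \<theta> S i B" and order: "same_order \<kappa> S i"
    and "j \<le> i"
  shows "C_T D \<sigma> f uin ud u \<Delta>t \<theta> S j \<le> block_factor i \<Delta>t B \<kappa> * (\<Sum>m<j. (2 * exp \<Delta>t) ^ m) *
    ((training_error f uin ud \<Delta>t \<theta> S j)\<^sup>2
      + (real (qnum (int_rule (S i))) powr (- 2 / real (CARD('d) + 1))
        + real (qnum (tb_rule (S i))) powr (- 2 / real CARD('d))
        + real (qnum (sb_rule (S i))) powr (- 1 / real CARD('d))))"
    (is "_ \<le> ?c * ?s j * (?e j + ?P)")
  using assms(5)
proof (induction j)
  case (Suc j)
  let ?b = "block_training_error_sq f uin ud \<Delta>t \<theta> S (Suc j)"
  have j: "Suc j \<in> {1..i}" using Suc.prems by simp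
  have b: "0 \<le> ?b" by (rule block_training_error_sq_nonneg[where S = S]) (rule rules[OF j])
  have e: "?e (Suc j) = ?b + ?e j" using b by simp
  have s: "?s (Suc j) = 1 + 2 * exp \<Delta>t * ?s j"
    by (simp only: sum.lessThan_Suc_shift) (simp add: sum_distrib_left)
  have P: "0 \<le> ?P" by simp
  have s0: "0 \<le> ?s j" by (intro sum_nonneg) auto
  have c: "0 \<le> ?c" by (rule block_factor_nonneg)
  have "C_T D \<sigma> f uin ud u \<Delta>t \<theta> S (Suc j)
      \<le> ?c * (?b + ?P) + 2 * (?c * ?s j * (?e j + ?P)) * exp \<Delta>t"
    using C_block_le[OF rules sb bdd order j] Suc by (auto intro!: add_mono)
  also have "\<dots> \<le> ?c * (?e (Suc j) + ?P) + 2 * (?c * ?s j * (?e (Suc j) + ?P)) * exp \<Delta>t"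
    unfolding e using b c s0 by (intro add_mono mult_left_mono mult_right_mono mult_nonneg_nonneg) auto
  also have "\<dots> = ?c * ?s (Suc j) * (?e (Suc j) + ?P)"
    unfolding s by (simp add: algebra_simps)
  finally show ?case .
qed simp

text \<open>For a given dimension, \<open>K\<close> is chosen before the domain, the data, the
  networks and the rules, so the implied constant depends on i, \<Delta>t, the bound
  \<open>B\<close> of the constants and the comparability factor \<kappa> alone.\<close>

theorem theorem3p4:
  shows "\<exists>K :: nat \<Rightarrow> real \<Rightarrow> real \<Rightarrow> real \<Rightarrow> real.
    \<forall>(D :: (real^'d) set) k \<sigma> T l i \<Delta>t f uin ud u \<theta> S.
      open D \<and> connected D \<and> bounded D \<and> D \<noteq> {} \<and>
      1 \<le> k \<and> Ck_boundary k D \<and> is_surface_measure D \<sigma> \<and>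
      0 < T \<and> 1 \<le> i \<and> i \<le> l \<and> \<Delta>t = T / real l \<and>
      heat_solution D T f uin ud u \<and>
      Ck_upto 4 (closure D \<times> {0..real i * \<Delta>t}) u \<and>
      (\<forall>j\<in>{1..i}. is_HLConcPINN (CARD('d) + 1) (\<theta> j) \<and> is_training_set D \<sigma> \<Delta>t j (S j))
      \<longrightarrow>
      (LBINT t:{real (i - 1) * \<Delta>t..real i * \<Delta>t}. LBINT x:D. \<bar>net (\<theta> i) (x, t) - u (x, t)\<bar>\<^sup>2)
        \<le> C_T D \<sigma> f uin ud u \<Delta>t \<theta> S i * \<Delta>t * exp \<Delta>t
      \<and>
      (\<forall>B \<kappa>. constants_bounded D \<sigma> f uin ud u \<Delta>t \<theta> S i B \<and> same_order \<kappa> S i \<longrightarrow>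
        C_T D \<sigma> f uin ud u \<Delta>t \<theta> S i * \<Delta>t * exp \<Delta>t
          \<le> K i \<Delta>t B \<kappa> *
            ((training_error f uin ud \<Delta>t \<theta> S i)\<^sup>2
             + real (qnum (int_rule (S i))) powr (- 2 / real (CARD('d) + 1))
             + real (qnum (tb_rule (S i))) powr (- 2 / real CARD('d))
             + real (qnum (sb_rule (S i))) powr (- 1 / real CARD('d))))"
\<comment> \<open>The constant in the bound for \<open>C_T\<close>, times the factor \<Delta>t exp
  \<Delta>t of the error bound.\<close>
proof (rule exI[where x = "\<lambda>i \<Delta>t B \<kappa>. block_factor i \<Delta>t B \<kappa> * (\<Sum>m<i. (2 * exp \<Delta>t) ^ m) * \<Delta>t * exp \<Delta>t"],
    intro allI impI, elim conjE)
  fix D :: "(real^'d) set" and k \<sigma> T l i \<Delta>t f uin ud u \<theta> and S :: "nat \<Rightarrow> 'd training_set"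
  assume D: "open D" "bounded D" "D \<noteq> {}" "1 \<le> k" "Ck_boundary k D" "is_surface_measure D \<sigma>"
    and T: "0 < T" "1 \<le> i" "i \<le> l" "\<Delta>t = T / real l"
    and heat: "heat_solution D T f uin ud u"
    and u: "Ck_upto 4 (closure D \<times> {0..real i * \<Delta>t}) u"
    and nets: "\<forall>j\<in>{1..i}. is_HLConcPINN (CARD('d) + 1) (\<theta> j) \<and> is_training_set D \<sigma> \<Delta>t j (S j)"
  have "Ck_boundary 1 D"
    using D(4,5) Ck_open_le unfolding Ck_boundary_def graph_chart_def by meson
  moreover have dt: "0 < \<Delta>t" "real i * \<Delta>t \<le> T"
  proof -
    show "0 < \<Delta>t" using T by simp
    then have "real i * \<Delta>t \<le> real l * \<Delta>t" using T(3) by (intro mult_right_mono) auto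
    then show "real i * \<Delta>t \<le> T" using T by simp
  qed
  moreover obtain U h where "open U" "closure D \<times> {0..real i * \<Delta>t} \<subseteq> U" "Ck_open 4 U h"
    "\<And>z. z \<in> closure D \<times> {0..real i * \<Delta>t} \<Longrightarrow> u z = h z"
    using u unfolding Ck_upto_def by (auto simp: closure_Times)
  ultimately interpret heat_setup D \<sigma> T \<Delta>t f uin ud u i \<theta> S U h
    using D heat nets by unfold_locales auto
  let ?CT = "C_T D \<sigma> f uin ud u \<Delta>t \<theta> S i"
  have i: "i \<in> {1..i}" using T by simp
  have "?CT * \<Delta>t * exp \<Delta>t \<le> block_factor i \<Delta>t B \<kappa> * (\<Sum>m<i. (2 * exp \<Delta>t) ^ m) * \<Delta>t * exp \<Delta>t *
      ((training_error f uin ud \<Delta>t \<theta> S i)\<^sup>2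
       + real (qnum (int_rule (S i))) powr (- 2 / real (CARD('d) + 1))
       + real (qnum (tb_rule (S i))) powr (- 2 / real CARD('d))
       + real (qnum (sb_rule (S i))) powr (- 1 / real CARD('d)))"
    if "constants_bounded D \<sigma> f uin ud u \<Delta>t \<theta> S i B" "same_order \<kappa> S i" for B \<kappa>
    using mult_right_mono[OF C_T_le[OF rules sb_rule_nonneg that order_refl], of "\<Delta>t * exp \<Delta>t"] dt(1)
    by (simp add: mult_ac add_ac)
  then show "(LBINT t:{real (i - 1) * \<Delta>t..real i * \<Delta>t}. LBINT x:D. \<bar>net (\<theta> i) (x, t) - u (x, t)\<bar>\<^sup>2)
        \<le> ?CT * \<Delta>t * exp \<Delta>t
      \<and> (\<forall>B \<kappa>. constants_bounded D \<sigma> f uin ud u \<Delta>t \<theta> S i B \<and> same_order \<kappa> S i \<longrightarrow>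
        ?CT * \<Delta>t * exp \<Delta>t \<le> block_factor i \<Delta>t B \<kappa> * (\<Sum>m<i. (2 * exp \<Delta>t) ^ m) * \<Delta>t * exp \<Delta>t *
            ((training_error f uin ud \<Delta>t \<theta> S i)\<^sup>2
             + real (qnum (int_rule (S i))) powr (- 2 / real (CARD('d) + 1))
             + real (qnum (tb_rule (S i))) powr (- 2 / real CARD('d))
             + real (qnum (sb_rule (S i))) powr (- 1 / real CARD('d))))"
    using block_error[OF i] by blast
qed

end
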